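(* There are universal constants $c, C > 0$ and an algorithm for the certification problem, with running time $(kd)^{O(1)}$, with the following guarantee. Let $Z_1,\ldots,Z_k$ be i.i.d. copies of a random vector $Z$ in $\mathbb{R}^d$ with mean $\mu$ and covariance $\Sigma \neq 0$. Then, given as input $Z_1,\ldots,Z_k$, the point $x = \mu$, $p = 1/100$ and $r = C\left(\sqrt{\operatorname{Tr}\Sigma/k} + \sqrt{\|\Sigma\|}\right)$, the algorithm outputs YES with probability at least $1 - 2^{-ck}$.
   Context: Centrality: for $Z_1,\ldots,Z_k \in \mathbb{R}^d$, $r>0$ and $p\in[0,1]$, a point $x\in\mathbb{R}^d$ is $(r,p)$-central with respect to $Z_1,\ldots,Z_k$ if for every unit vector $u\in\mathbb{R}^d$ there are at most $pk$ indices $i$ with $\langle Z_i - x,u\rangle \geq r$. Certification problem: given $Z_1,\ldots,Z_k,x\in\mathbb{R}^d$, $r>0$ and $p\in[0,1]$, a certification algorithm outputs YES or DO NOT KNOW. If the output is YES, then $x$ must be $(r,p)$-central with respect to $Z_1,\ldots,Z_k$. If the output is DO NOT KNOW, then $x$ may or may not be $(r,p)$-central. (This must hold for all inputs.) $\|\Sigma\|$ denotes the operator norm (maximum eigenvalue). *)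

theory Defs
  imports "HOL-Probability.Probability"
begin

section \<open>Vectors and matrices of varying dimension\<close>

text \<open>
  The dimension \<open>d\<close> is quantified after the algorithm, so it cannot be a type.
  A vector in \<open>d\<close>-space is a function \<open>nat \<Rightarrow> real\<close> of which only the entries below \<open>d\<close>
  matter, and its Euclidean norm is the library's \<^const>\<open>L2_set\<close> on \<open>{..<d}\<close>.
  Points \<open>Z\<^sub>1, \<dots>, Z\<^sub>k\<close> are \<open>Z 0, \<dots>, Z (k - 1)\<close>.
\<close>

definition inner_prod :: "nat \<Rightarrow> (nat \<Rightarrow> real) \<Rightarrow> (nat \<Rightarrow> real) \<Rightarrow> real" where
  "inner_prod d v w = (\<Sum>j<d. v j * w j)"

definition op_norm :: "nat \<Rightarrow> (nat \<Rightarrow> nat \<Rightarrow> real) \<Rightarrow> real" where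
  "op_norm d A =
     (SUP u\<in>{u. L2_set u {..<d} = 1}. L2_set (\<lambda>i. inner_prod d (A i) u) {..<d})"

definition mat_trace :: "nat \<Rightarrow> (nat \<Rightarrow> nat \<Rightarrow> real) \<Rightarrow> real" where
  "mat_trace d A = (\<Sum>j<d. A j j)"

definition central ::
  "nat \<Rightarrow> nat \<Rightarrow> (nat \<Rightarrow> nat \<Rightarrow> real) \<Rightarrow> real \<Rightarrow> real \<Rightarrow> (nat \<Rightarrow> real) \<Rightarrow> bool" where
  "central k d Z r p x \<longleftrightarrow>
     (\<forall>u. L2_set u {..<d} = 1 \<longrightarrow>
        real (card {i. i < k \<and> inner_prod d (\<lambda>j. Z i j - x j) u \<ge> r}) \<le> p * real k)"


section \<open>Distributions of random vectors\<close>

text \<open>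
  A random vector is given by its law \<open>D\<close>, a Borel probability measure on \<open>d\<close>-space.
  Square integrability says that the covariance matrix exists; it also makes the mean exist.
\<close>

definition random_vector_law :: "nat \<Rightarrow> (nat \<Rightarrow> real) measure \<Rightarrow> bool" where
  "random_vector_law d D \<longleftrightarrow>
     prob_space D \<and> sets D = sets (\<Pi>\<^sub>M j\<in>{..<d}. (borel :: real measure)) \<and>
     (\<forall>j<d. integrable D (\<lambda>z. (z j)\<^sup>2))"

definition mean :: "(nat \<Rightarrow> real) measure \<Rightarrow> nat \<Rightarrow> real" where
  "mean D j = (\<integral>z. z j \<partial>D)"

definition covariance :: "(nat \<Rightarrow> real) measure \<Rightarrow> nat \<Rightarrow> nat \<Rightarrow> real" where
  "covariance D i j = (\<integral>z. (z i - mean D i) * (z j - mean D j) \<partial>D)"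

text \<open>Law of \<open>k\<close> independent copies.\<close>

definition iid_law :: "nat \<Rightarrow> (nat \<Rightarrow> real) measure \<Rightarrow> (nat \<Rightarrow> nat \<Rightarrow> real) measure" where
  "iid_law k D = (\<Pi>\<^sub>M i\<in>{..<k}. D)"


section \<open>Algorithms on real inputs: a real RAM\<close>

text \<open>
  Inputs are exact real numbers, so algorithms are programs of a deterministic real RAM
  (Blum--Shub--Smale style): exact field operations and comparisons on reals at unit cost,
  with no square roots and no rounding.  Real memory consists of arrays with two indices.
  Natural number variables serve for indexing and loop control; they support only constants,
  addition and truncated subtraction, since unit-cost multiplication and division of unbounded
  integers would be unreasonably strong.  The only literals are natural numbers.
  Division by zero yields zero, as usual in HOL.
\<close>

datatype nexp = NConst nat | NVar nat | NAdd nexp nexp | NSub nexp nexp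

datatype rexp =
    ROfNat nexp
  | RCell nat nexp nexp
  | RAdd rexp rexp | RSub rexp rexp | RMul rexp rexp | RDiv rexp rexp

datatype bexp = NLess nexp nexp | RLess rexp rexp | BNot bexp | BAnd bexp bexp

datatype com =
    Skip
  | NAssign nat nexp
  | RAssign nat nexp nexp rexp
  | Seq com com
  | Cond bexp com com
  | While bexp com

record state =
  nvar :: "nat \<Rightarrow> nat"
  cell :: "nat \<Rightarrow> nat \<Rightarrow> nat \<Rightarrow> real"

primrec nval :: "nexp \<Rightarrow> state \<Rightarrow> nat" where
  "nval (NConst n) s = n"
| "nval (NVar v) s = nvar s v"
| "nval (NAdd e f) s = nval e s + nval f s"
| "nval (NSub e f) s = nval e s - nval f s"

primrec rval :: "rexp \<Rightarrow> state \<Rightarrow> real" where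
  "rval (ROfNat e) s = real (nval e s)"
| "rval (RCell a e f) s = cell s a (nval e s) (nval f s)"
| "rval (RAdd e f) s = rval e s + rval f s"
| "rval (RSub e f) s = rval e s - rval f s"
| "rval (RMul e f) s = rval e s * rval f s"
| "rval (RDiv e f) s = rval e s / rval f s"

primrec bval :: "bexp \<Rightarrow> state \<Rightarrow> bool" where
  "bval (NLess e f) s \<longleftrightarrow> nval e s < nval f s"
| "bval (RLess e f) s \<longleftrightarrow> rval e s < rval f s"
| "bval (BNot b) s \<longleftrightarrow> \<not> bval b s"
| "bval (BAnd b c) s \<longleftrightarrow> bval b s \<and> bval c s"

text \<open>
  \<open>exec c s t s'\<close>: started in \<open>s\<close>, the program \<open>c\<close> halts in \<open>s'\<close> after \<open>t\<close> steps.  Every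
  assignment and every test is one step; as the expressions are part of the fixed program,
  this is the number of elementary operations up to a constant factor depending on \<open>c\<close>.
\<close>

inductive exec :: "com \<Rightarrow> state \<Rightarrow> nat \<Rightarrow> state \<Rightarrow> bool" where
  Skip: "exec Skip s 1 s"
| NAssign: "exec (NAssign v e) s 1 (s\<lparr>nvar := (nvar s)(v := nval e s)\<rparr>)"
| RAssign: "exec (RAssign a e f q) s 1
     (s\<lparr>cell := (cell s)(a := (cell s a)(nval e s :=
        (cell s a (nval e s))(nval f s := rval q s)))\<rparr>)"
| Seq: "exec c\<^sub>1 s t\<^sub>1 s' \<Longrightarrow> exec c\<^sub>2 s' t\<^sub>2 s'' \<Longrightarrow> exec (Seq c\<^sub>1 c\<^sub>2) s (t\<^sub>1 + t\<^sub>2) s''"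
| CondTrue: "bval b s \<Longrightarrow> exec c\<^sub>1 s t s' \<Longrightarrow> exec (Cond b c\<^sub>1 c\<^sub>2) s (t + 1) s'"
| CondFalse: "\<not> bval b s \<Longrightarrow> exec c\<^sub>2 s t s' \<Longrightarrow> exec (Cond b c\<^sub>1 c\<^sub>2) s (t + 1) s'"
| WhileFalse: "\<not> bval b s \<Longrightarrow> exec (While b c) s 1 s"
| WhileTrue: "bval b s \<Longrightarrow> exec c s t\<^sub>1 s' \<Longrightarrow> exec (While b c) s' t\<^sub>2 s'' \<Longrightarrow>
     exec (While b c) s (t\<^sub>1 + t\<^sub>2 + 1) s''"

inductive_cases SkipE: "exec Skip s t s'"
inductive_cases NAssignE: "exec (NAssign v e) s t s'"
inductive_cases RAssignE: "exec (RAssign a e f q) s t s'"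
inductive_cases SeqE: "exec (Seq c\<^sub>1 c\<^sub>2) s t s'"
inductive_cases CondE: "exec (Cond b c\<^sub>1 c\<^sub>2) s t s'"
inductive_cases WhileE: "exec (While b c) s t s'"

lemma exec_deterministic:
  assumes "exec c s t s'" and "exec c s u s''"
  shows "u = t \<and> s'' = s'"
  using assms
proof (induction arbitrary: u s'' rule: exec.induct)
  case (Skip s)
  then show ?case by (auto elim: SkipE)
next
  case (NAssign v e s)
  then show ?case by (auto elim: NAssignE)
next
  case (RAssign a e f q s)
  then show ?case by (auto elim: RAssignE)
next
  case (Seq c\<^sub>1 s t\<^sub>1 s' c\<^sub>2 t\<^sub>2 s\<^sub>2)
  from Seq.prems obtain u\<^sub>1 u\<^sub>2 r where
    "u = u\<^sub>1 + u\<^sub>2" "exec c\<^sub>1 s u\<^sub>1 r" "exec c\<^sub>2 r u\<^sub>2 s''"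
    by (rule SeqE)
  with Seq.IH(1)[of u\<^sub>1 r] Seq.IH(2)[of u\<^sub>2 s''] show ?case by simp
next
  case (CondTrue b s c\<^sub>1 t s' c\<^sub>2)
  from CondTrue.prems CondTrue.hyps(1) obtain u' where "u = u' + 1" "exec c\<^sub>1 s u' s''"
    by (auto elim: CondE)
  with CondTrue.IH[of u' s''] show ?case by simp
next
  case (CondFalse b s c\<^sub>2 t s' c\<^sub>1)
  from CondFalse.prems CondFalse.hyps(1) obtain u' where "u = u' + 1" "exec c\<^sub>2 s u' s''"
    by (auto elim: CondE)
  with CondFalse.IH[of u' s''] show ?case by simp
next
  case (WhileFalse b s c)
  from WhileFalse.prems WhileFalse.hyps show ?case by (auto elim: WhileE)
next
  case (WhileTrue b s c t\<^sub>1 s' t\<^sub>2 s\<^sub>2)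
  from WhileTrue.prems WhileTrue.hyps(1) obtain u\<^sub>1 u\<^sub>2 r where
    "u = u\<^sub>1 + u\<^sub>2 + 1" "exec c s u\<^sub>1 r" "exec (While b c) r u\<^sub>2 s''"
    by (auto elim: WhileE)
  with WhileTrue.IH(1)[of u\<^sub>1 r] WhileTrue.IH(2)[of u\<^sub>2 s''] show ?case by simp
qed


section \<open>The certification problem\<close>

text \<open>
  Calling convention: variables 0 and 1 hold \<open>k\<close> and \<open>d\<close>; array 0 holds the points, row 0 of
  array 1 the point \<open>x\<close>, and row 0 of array 2 the numbers \<open>r\<close> and \<open>p\<close>.  Everything else is
  zero.  The answer is YES iff variable 2 is 1 at the end.
\<close>

definition initial_state ::
  "nat \<Rightarrow> nat \<Rightarrow> (nat \<Rightarrow> nat \<Rightarrow> real) \<Rightarrow> (nat \<Rightarrow> real) \<Rightarrow> real \<Rightarrow> real \<Rightarrow> state" where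
  "initial_state k d Z x r p =
     \<lparr>nvar = (\<lambda>v. if v = 0 then k else if v = 1 then d else 0),
      cell = (\<lambda>a i j.
        if a = 0 \<and> i < k \<and> j < d then Z i j
        else if a = 1 \<and> i = 0 \<and> j < d then x j
        else if a = 2 \<and> i = 0 \<and> j = 0 then r
        else if a = 2 \<and> i = 0 \<and> j = 1 then p
        else 0)\<rparr>"

datatype verdict = YES | DO_NOT_KNOW

definition verdict_of :: "state \<Rightarrow> verdict" where
  "verdict_of s = (if nvar s 2 = 1 then YES else DO_NOT_KNOW)"

definition outputs ::
  "com \<Rightarrow> nat \<Rightarrow> nat \<Rightarrow> (nat \<Rightarrow> nat \<Rightarrow> real) \<Rightarrow> (nat \<Rightarrow> real) \<Rightarrow> real \<Rightarrow> real \<Rightarrow> verdict \<Rightarrow> bool"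
where
  "outputs c k d Z x r p v \<longleftrightarrow>
     (\<exists>t s. exec c (initial_state k d Z x r p) t s \<and> verdict_of s = v)"

definition certification_algorithm :: "com \<Rightarrow> bool" where
  "certification_algorithm c \<longleftrightarrow>
     (\<forall>k d Z x r p. k \<ge> 1 \<longrightarrow> d \<ge> 1 \<longrightarrow> r > 0 \<longrightarrow> 0 \<le> p \<longrightarrow> p \<le> 1 \<longrightarrow>
        (\<exists>v. outputs c k d Z x r p v) \<and>
        (outputs c k d Z x r p YES \<longrightarrow> central k d Z r p x))"

text \<open>Running time \<open>(k d)\<^sup>O\<^sup>(\<^sup>1\<^sup>)\<close> on all inputs, uniformly in the real data.\<close>

definition polynomial_time :: "com \<Rightarrow> bool" where
  "polynomial_time c \<longleftrightarrow>
     (\<exists>A m :: nat. \<forall>k d Z x r p. k \<ge> 1 \<longrightarrow> d \<ge> 1 \<longrightarrow> r > 0 \<longrightarrow> 0 \<le> p \<longrightarrow> p \<le> 1 \<longrightarrow>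
        (\<exists>t s. exec c (initial_state k d Z x r p) t s \<and> t \<le> A * (k * d) ^ m))"

end

theory Submission
  imports Defs
begin

text \<open>
  Put \<open>Y\<^sub>i = Z\<^sub>i - x\<close>.  Suppose weights \<open>w\<^sub>i\<close> between 0 and 1 satisfy
  \<open>\<Sum>\<^sub>i (1 - w\<^sub>i) \<le> k / 200\<close> and \<open>\<Sum>\<^sub>i w\<^sub>i \<langle>Y\<^sub>i, u\<rangle>\<^sup>2 \<le> r\<^sup>2 k / 200\<close> for all unit vectors \<open>u\<close>.  The indices
  with \<open>\<langle>Y\<^sub>i, u\<rangle> \<ge> r\<close> carry weight at most \<open>k / 200\<close> by the second condition and lack weight at most
  \<open>k / 200\<close> by the first, so there are at most \<open>k / 100\<close> of them.  Such weights therefore prove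
  centrality (\<open>accepts_imp_central\<close>), and the algorithm searches for them.

  The second condition bounds the largest eigenvalue of \<open>A = (200 / (r\<^sup>2 k)) \<Sum>\<^sub>i w\<^sub>i Y\<^sub>i Y\<^sub>i\<^sup>T\<close> by 1.
  Without square roots or eigenvectors this is tested by repeated squaring: the Frobenius norm of
  \<open>N = A\<^sup>q\<close>, with \<open>q\<close> a large power of two, is at most 1 only if the eigenvalue is, and exceeds 1
  only if \<open>tr (A N\<^sup>2) > |N|\<^sup>2 / 2\<close>, so that \<open>N\<^sup>2\<close> points to directions of large moment.  In the second
  case \<open>w\<^sub>i\<close> is multiplied by \<open>1 - \<tau>\<^sub>i / max \<tau>\<close> with \<open>\<tau>\<^sub>i = |N Y\<^sub>i|\<^sup>2\<close>, the filter of robust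
  statistics.  Every such round destroys a weight, so there are at most \<open>k\<close> of them.

  The filter succeeds if some core weights \<open>v\<close> with \<open>\<Sum>\<^sub>i (1 - v\<^sub>i) \<le> k / 400\<close> have a moment matrix of
  norm at most \<open>r\<^sup>2 k / 800\<close>: then each round removes at least twice as much weight in total as it
  removes from the core, hence at most \<open>k / 200\<close> altogether (\<open>spread_imp_accepts\<close>).  Core weights
  exist as soon as for every matrix \<open>N\<close> at most \<open>k / 400\<close> of the points have
  \<open>|N Y\<^sub>i|\<^sup>2 > (r\<^sup>2 / 1600) |N|\<^sup>2\<close>: minimise the trace of a high power of the moment matrix over
  the admissible weights and read off the first-order condition (\<open>exists_core_weights\<close>).

  It remains to see that this spread condition holds outside an event of probability at most \<open>2\<^sup>-\<^sup>k\<close>.  A random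
  signed sum of the rows of a violating \<open>N\<close> yields one direction \<open>g\<close> along which a constant fraction
  of the points is long (\<open>not_spread_direction\<close>).  Running a one-pass margin perceptron on these
  points makes few mistakes, and the mistakes alone determine its hypotheses.  So there are a pattern,
  one of \<open>4\<^sup>k\<close>, and a constant fraction of indices \<open>i\<close> such that \<open>Y\<^sub>i\<close> is unusually long or has an
  unusually large product with a vector computed from other points (\<open>not_spread_pattern\<close>).  For a
  fixed pattern these events are conditionally independent and by Chebyshev each has probability at most
  any prescribed constant, once \<open>C\<close> is large; the union bound over the patterns concludes
  (\<open>spread_with_high_probability\<close>).  This replaces symmetrisation, contraction and bounded
  differences in the usual proof.
\<close>


section \<open>Certifying the largest eigenvalue by repeated squaring\<close>

definition mat_mult :: "nat \<Rightarrow> (nat \<Rightarrow> nat \<Rightarrow> real) \<Rightarrow> (nat \<Rightarrow> nat \<Rightarrow> real) \<Rightarrow> nat \<Rightarrow> nat \<Rightarrow> real" where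
  "mat_mult d A B i j = (\<Sum>l<d. A i l * B l j)"

definition frob_inner :: "nat \<Rightarrow> (nat \<Rightarrow> nat \<Rightarrow> real) \<Rightarrow> (nat \<Rightarrow> nat \<Rightarrow> real) \<Rightarrow> real" where
  "frob_inner d A B = (\<Sum>i<d. \<Sum>j<d. A i j * B i j)"

definition image_norm_sq :: "nat \<Rightarrow> (nat \<Rightarrow> nat \<Rightarrow> real) \<Rightarrow> (nat \<Rightarrow> real) \<Rightarrow> real" where
  "image_norm_sq d N y = (\<Sum>a<d. (inner_prod d (N a) y)\<^sup>2)"

definition moment_mat ::
  "nat \<Rightarrow> (nat \<Rightarrow> real) \<Rightarrow> (nat \<Rightarrow> nat \<Rightarrow> real) \<Rightarrow> nat \<Rightarrow> nat \<Rightarrow> real" where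
  "moment_mat k w Y a b = (\<Sum>i<k. w i * Y i a * Y i b)"

definition mat_square :: "nat \<Rightarrow> (nat \<Rightarrow> nat \<Rightarrow> real) \<Rightarrow> nat \<Rightarrow> nat \<Rightarrow> real" where
  "mat_square d A = mat_mult d A A"

primrec mat_pow :: "nat \<Rightarrow> (nat \<Rightarrow> nat \<Rightarrow> real) \<Rightarrow> nat \<Rightarrow> nat \<Rightarrow> nat \<Rightarrow> real" where
  "mat_pow d A 0 = (\<lambda>i j. if i = j then 1 else 0)"
| "mat_pow d A (Suc n) = mat_mult d A (mat_pow d A n)"

definition sym_mat :: "nat \<Rightarrow> (nat \<Rightarrow> nat \<Rightarrow> real) \<Rightarrow> bool" where
  "sym_mat d A \<longleftrightarrow> (\<forall>i<d. \<forall>j<d. A i j = A j i)"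

lemma frob_cong:
  assumes "\<And>i j. i < d \<Longrightarrow> j < d \<Longrightarrow> A i j = A' i j" "\<And>i j. i < d \<Longrightarrow> j < d \<Longrightarrow> B i j = B' i j"
  shows "frob_inner d A B = frob_inner d A' B'"
  unfolding frob_inner_def using assms by (intro sum.cong) auto

lemma frob_nonneg [simp]: "0 \<le> frob_inner d A A"
  unfolding frob_inner_def by (intro sum_nonneg) auto

lemma image_norm_sq_nonneg [simp]: "0 \<le> image_norm_sq d N y"
  unfolding image_norm_sq_def by (intro sum_nonneg) auto

lemma image_norm_sq_cong:
  assumes "\<And>i j. i < d \<Longrightarrow> j < d \<Longrightarrow> N i j = N' i j" "\<And>j. j < d \<Longrightarrow> y j = y' j"
  shows "image_norm_sq d N y = image_norm_sq d N' y'"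
  unfolding image_norm_sq_def inner_prod_def using assms by (intro sum.cong arg_cong[where f="\<lambda>x. x\<^sup>2"]) auto

lemma mat_mult_assoc: "mat_mult d (mat_mult d A B) C = mat_mult d A (mat_mult d B C)"
proof (intro ext)
  fix i j
  have "mat_mult d (mat_mult d A B) C i j = (\<Sum>l<d. \<Sum>m<d. A i m * B m l * C l j)"
    unfolding mat_mult_def by (simp add: sum_distrib_right)
  also have "\<dots> = (\<Sum>m<d. \<Sum>l<d. A i m * B m l * C l j)"
    by (rule sum.swap)
  also have "\<dots> = mat_mult d A (mat_mult d B C) i j"
    unfolding mat_mult_def by (simp add: sum_distrib_left mult.assoc)
  finally show "mat_mult d (mat_mult d A B) C i j = mat_mult d A (mat_mult d B C) i j" .
qed

lemma mat_mult_cong: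
  assumes "\<And>l. l < d \<Longrightarrow> A i l = A' i l" "\<And>l. l < d \<Longrightarrow> B l j = B' l j"
  shows "mat_mult d A B i j = mat_mult d A' B' i j"
  unfolding mat_mult_def using assms by (intro sum.cong) auto

text \<open>
  The restriction to rows below \<open>d\<close> is needed for exponent 0: \<open>mat_pow d A 0\<close> is a unit for
  \<open>mat_mult d\<close> only on the block of indices below \<open>d\<close>.
\<close>

lemma mat_pow_add:
  "i < d \<Longrightarrow> mat_pow d A (m + n) i j = mat_mult d (mat_pow d A m) (mat_pow d A n) i j"
proof (induction m arbitrary: i)
  case 0
  then show ?case by (simp add: mat_mult_def if_distrib[of "\<lambda>x. x * _"] cong: if_cong)
next
  case (Suc m)
  have "mat_pow d A (Suc m + n) i j = mat_mult d A (mat_mult d (mat_pow d A m) (mat_pow d A n)) i j"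
    using Suc.IH by (simp, intro mat_mult_cong) auto
  then show ?case by (simp add: mat_mult_assoc)
qed

lemma mat_pow_one: "j < d \<Longrightarrow> mat_pow d A 1 i j = A i j"
  by (simp add: mat_mult_def if_distrib[of "\<lambda>x. _ * x"] cong: if_cong)

lemma sym_mat_pow:
  assumes "sym_mat d A" shows "sym_mat d (mat_pow d A n)"
proof (induction n)
  case 0
  then show ?case by (auto simp: sym_mat_def)
next
  case (Suc n)
  show ?case unfolding sym_mat_def
  proof (intro allI impI)
    fix i j assume ij: "i < d" "j < d"
    have "mat_pow d A (Suc n) i j = (\<Sum>l<d. A i l * mat_pow d A n l j)"
      by (simp add: mat_mult_def)
    also have "\<dots> = (\<Sum>l<d. mat_pow d A n j l * mat_pow d A 1 l i)"
    proof (intro sum.cong refl)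
      fix l assume "l \<in> {..<d}"
      then show "A i l * mat_pow d A n l j = mat_pow d A n j l * mat_pow d A 1 l i"
        using Suc assms ij unfolding mat_pow_one[OF ij(1)] sym_mat_def by (metis lessThan_iff mult.commute)
    qed
    also have "\<dots> = mat_pow d A (n + 1) j i"
      unfolding mat_pow_add[OF ij(2), of A n 1] by (rule mat_mult_def[symmetric])
    finally show "mat_pow d A (Suc n) i j = mat_pow d A (Suc n) j i" by simp
  qed
qed

lemma sym_mat_square: "sym_mat d A \<Longrightarrow> sym_mat d (mat_square d A)"
  unfolding sym_mat_def mat_square_def mat_mult_def
  by (auto intro!: sum.cong simp: mult.commute)

lemma mat_square_iter_eq_pow:
  "i < d \<Longrightarrow> j < d \<Longrightarrow> (mat_square d ^^ m) A i j = mat_pow d A (2 ^ m) i j"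
proof (induction m arbitrary: i j)
  case 0
  then show ?case using mat_pow_one by simp
next
  case (Suc m)
  have "(mat_square d ^^ Suc m) A i j
      = mat_mult d (mat_pow d A (2 ^ m)) (mat_pow d A (2 ^ m)) i j"
    using Suc by (simp add: mat_square_def, intro mat_mult_cong) auto
  also have "\<dots> = mat_pow d A (2 ^ m + 2 ^ m) i j"
    using mat_pow_add Suc.prems(1) by simp
  finally show ?case by (simp add: mult_2)
qed

lemma sym_moment_mat: "sym_mat d (moment_mat k w Y)"
  unfolding sym_mat_def moment_mat_def by (auto intro!: sum.cong)

definition mat_vec :: "nat \<Rightarrow> (nat \<Rightarrow> nat \<Rightarrow> real) \<Rightarrow> (nat \<Rightarrow> real) \<Rightarrow> nat \<Rightarrow> real" where
  "mat_vec d A u i = inner_prod d (A i) u"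

lemma inner_prod_commute: "inner_prod d u v = inner_prod d v u"
  by (simp add: inner_prod_def mult.commute)

lemma inner_prod_Cauchy_Schwarz:
  "(inner_prod d u v)\<^sup>2 \<le> inner_prod d u u * inner_prod d v v"
  unfolding inner_prod_def
  using Cauchy_Schwarz_ineq_sum[of u v "{..<d}"] by (simp add: power2_eq_square)

lemma inner_prod_self_nonneg [simp]: "0 \<le> inner_prod d u u"
  unfolding inner_prod_def by (intro sum_nonneg) auto

lemma image_norm_sq_eq: "image_norm_sq d N y = inner_prod d (mat_vec d N y) (mat_vec d N y)"
  by (simp add: image_norm_sq_def mat_vec_def inner_prod_def power2_eq_square)

lemma image_norm_sq_le_frob: "image_norm_sq d N y \<le> frob_inner d N N * inner_prod d y y"
proof -
  have "image_norm_sq d N y \<le> (\<Sum>a<d. inner_prod d (N a) (N a) * inner_prod d y y)"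
    unfolding image_norm_sq_def by (intro sum_mono inner_prod_Cauchy_Schwarz)
  also have "\<dots> = frob_inner d N N * inner_prod d y y"
    by (simp add: frob_inner_def inner_prod_def sum_distrib_right)
  finally show ?thesis .
qed

lemma quad_form_mat_square:
  assumes "sym_mat d A"
  shows "inner_prod d u (mat_vec d (mat_square d A) u) = image_norm_sq d A u"
proof -
  have "inner_prod d u (mat_vec d (mat_square d A) u)
      = (\<Sum>i<d. \<Sum>j<d. \<Sum>l<d. u i * A i l * A l j * u j)"
    unfolding inner_prod_def mat_vec_def mat_square_def mat_mult_def
    by (simp add: sum_distrib_left sum_distrib_right mult.assoc)
  also have "\<dots> = (\<Sum>i<d. \<Sum>l<d. \<Sum>j<d. u i * A i l * A l j * u j)"
    by (intro sum.cong refl sum.swap)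
  also have "\<dots> = (\<Sum>l<d. \<Sum>i<d. \<Sum>j<d. u i * A i l * A l j * u j)"
    by (rule sum.swap)
  also have "\<dots> = (\<Sum>l<d. \<Sum>i<d. \<Sum>j<d. (A l i * u i) * (A l j * u j))"
    using assms by (intro sum.cong refl) (auto simp: sym_mat_def)
  also have "\<dots> = image_norm_sq d A u"
    unfolding image_norm_sq_def inner_prod_def power2_eq_square by (simp add: sum_product)
  finally show ?thesis .
qed


lemma quad_form_sq_le:
  "(inner_prod d u (mat_vec d A u))\<^sup>2 \<le> inner_prod d u u * image_norm_sq d A u"
  unfolding image_norm_sq_eq by (rule inner_prod_Cauchy_Schwarz)

lemma quad_form_le_of_image_norm_sq_le:
  assumes "image_norm_sq d A u \<le> \<sigma>\<^sup>2 * inner_prod d u u" "0 \<le> \<sigma>"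
  shows "inner_prod d u (mat_vec d A u) \<le> \<sigma> * inner_prod d u u"
proof (rule power2_le_imp_le)
  have "(inner_prod d u (mat_vec d A u))\<^sup>2 \<le> inner_prod d u u * (\<sigma>\<^sup>2 * inner_prod d u u)"
    using order_trans[OF quad_form_sq_le mult_left_mono[OF assms(1) inner_prod_self_nonneg]] .
  also have "\<dots> = (\<sigma> * inner_prod d u u)\<^sup>2"
    by (simp add: power2_eq_square)
  finally show "(inner_prod d u (mat_vec d A u))\<^sup>2 \<le> (\<sigma> * inner_prod d u u)\<^sup>2" .
  show "0 \<le> \<sigma> * inner_prod d u u" using assms(2) by simp
qed

text \<open>
  By Cauchy--Schwarz \<open>\<langle>u, A u\<rangle>\<^sup>2 \<le> |u|\<^sup>2 |A u|\<^sup>2 = |u|\<^sup>2 \<langle>u, A\<^sup>2 u\<rangle>\<close>, so a bound \<open>\<sigma>\<^sup>2\<close> for the form of \<open>A\<^sup>2\<close>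
  is a bound \<open>\<sigma>\<close> for the form of \<open>A\<close>.  Iterating along the squarings reaches a power whose form is
  bounded by its Frobenius norm.
\<close>

lemma quad_form_le_of_frob_iter:
  assumes "sym_mat d A" "0 \<le> \<sigma>"
    and "frob_inner d ((mat_square d ^^ m) A) ((mat_square d ^^ m) A) \<le> \<sigma> ^ (2 ^ Suc m)"
  shows "inner_prod d u (mat_vec d A u) \<le> \<sigma> * inner_prod d u u"
  using assms
proof (induction m arbitrary: A \<sigma>)
  case 0
  have "frob_inner d A A \<le> \<sigma>\<^sup>2" using 0(3) by simp
  then have "frob_inner d A A * inner_prod d u u \<le> \<sigma>\<^sup>2 * inner_prod d u u"
    by (rule mult_right_mono) (rule inner_prod_self_nonneg)
  then show ?case
    using quad_form_le_of_image_norm_sq_le[OF order_trans[OF image_norm_sq_le_frob]] 0(2) by blast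
next
  case (Suc m)
  have "inner_prod d u (mat_vec d (mat_square d A) u) \<le> \<sigma>\<^sup>2 * inner_prod d u u"
  proof (rule Suc.IH)
    have 1: "(mat_square d ^^ m) (mat_square d A) = (mat_square d ^^ Suc m) A"
      by (simp only: funpow_Suc_right o_apply)
    have 2: "(\<sigma>\<^sup>2) ^ (2 ^ Suc m) = \<sigma> ^ (2 ^ Suc (Suc m))"
      unfolding power_Suc[of 2 "Suc m"] by (rule power_mult[symmetric])
    show "frob_inner d ((mat_square d ^^ m) (mat_square d A)) ((mat_square d ^^ m) (mat_square d A))
        \<le> (\<sigma>\<^sup>2) ^ (2 ^ Suc m)"
      unfolding 1 2 by (rule Suc.prems(3))
    show "sym_mat d (mat_square d A)" by (rule sym_mat_square[OF Suc.prems(1)])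
    show "0 \<le> \<sigma>\<^sup>2" by simp
  qed
  then have "image_norm_sq d A u \<le> \<sigma>\<^sup>2 * inner_prod d u u"
    unfolding quad_form_mat_square[OF Suc.prems(1)] .
  then show ?case using Suc.prems(2) by (rule quad_form_le_of_image_norm_sq_le)
qed

lemma quad_form_moment_mat:
  "inner_prod d u (mat_vec d (moment_mat k w Y) u) = (\<Sum>i<k. w i * (inner_prod d (Y i) u)\<^sup>2)"
proof -
  have "inner_prod d u (mat_vec d (moment_mat k w Y) u)
      = (\<Sum>a<d. \<Sum>b<d. \<Sum>i<k. w i * (Y i a * u a) * (Y i b * u b))"
    unfolding inner_prod_def mat_vec_def moment_mat_def
    by (simp add: sum_distrib_left sum_distrib_right ac_simps)
  also have "\<dots> = (\<Sum>a<d. \<Sum>i<k. \<Sum>b<d. w i * (Y i a * u a) * (Y i b * u b))"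
    by (intro sum.cong refl sum.swap)
  also have "\<dots> = (\<Sum>i<k. \<Sum>a<d. \<Sum>b<d. w i * (Y i a * u a) * (Y i b * u b))"
    by (rule sum.swap)
  also have "\<dots> = (\<Sum>i<k. w i * (inner_prod d (Y i) u)\<^sup>2)"
      proof (intro sum.cong refl)
    fix i
    have "(\<Sum>a<d. \<Sum>b<d. w i * (Y i a * u a) * (Y i b * u b))
        = w i * (\<Sum>a<d. \<Sum>b<d. (Y i a * u a) * (Y i b * u b))"
      by (simp only: sum_distrib_left mult.assoc)
    then show "(\<Sum>a<d. \<Sum>b<d. w i * (Y i a * u a) * (Y i b * u b)) = w i * (inner_prod d (Y i) u)\<^sup>2"
      by (simp only: inner_prod_def power2_eq_square sum_product)
  qed
  finally show ?thesis .
qed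

text \<open>
  As a bilinear form in \<open>X\<close> and \<open>Z\<close> this is the trace of \<open>X M Z\<^sup>T\<close> for the moment matrix \<open>M\<close>.  It is
  written as a sum over the points because Cauchy--Schwarz for it is then immediate, with no square root
  of \<open>M\<close>.
\<close>

definition moment_form ::
  "nat \<Rightarrow> nat \<Rightarrow> (nat \<Rightarrow> real) \<Rightarrow> (nat \<Rightarrow> nat \<Rightarrow> real)
    \<Rightarrow> (nat \<Rightarrow> nat \<Rightarrow> real) \<Rightarrow> (nat \<Rightarrow> nat \<Rightarrow> real) \<Rightarrow> real" where
  "moment_form k d w Y X Z = (\<Sum>i<k. w i * inner_prod d (mat_vec d X (Y i)) (mat_vec d Z (Y i)))"

lemma moment_form_self: "moment_form k d w Y X X = (\<Sum>i<k. w i * image_norm_sq d X (Y i))"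
  by (simp add: moment_form_def image_norm_sq_eq)

lemma moment_form_eq_frob: "moment_form k d w Y X Z = frob_inner d (mat_mult d X (moment_mat k w Y)) Z"
proof -
  have "moment_form k d w Y X Z = (\<Sum>i<k. \<Sum>a<d. \<Sum>c<d. \<Sum>b<d. w i * (X a b * Y i b) * (Z a c * Y i c))"
    unfolding moment_form_def inner_prod_def mat_vec_def
    by (simp add: sum_distrib_left sum_distrib_right mult.assoc)
  also have "\<dots> = (\<Sum>a<d. \<Sum>i<k. \<Sum>c<d. \<Sum>b<d. w i * (X a b * Y i b) * (Z a c * Y i c))"
    by (rule sum.swap)
  also have "\<dots> = (\<Sum>a<d. \<Sum>c<d. \<Sum>i<k. \<Sum>b<d. w i * (X a b * Y i b) * (Z a c * Y i c))"
    by (intro sum.cong refl sum.swap)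
  also have "\<dots> = (\<Sum>a<d. \<Sum>c<d. \<Sum>b<d. \<Sum>i<k. w i * (X a b * Y i b) * (Z a c * Y i c))"
    by (intro sum.cong refl sum.swap)
  also have "\<dots> = frob_inner d (mat_mult d X (moment_mat k w Y)) Z"
    unfolding frob_inner_def mat_mult_def moment_mat_def
    by (simp add: sum_distrib_left sum_distrib_right ac_simps)
  finally show ?thesis .
qed

definition pow_trace :: "nat \<Rightarrow> (nat \<Rightarrow> nat \<Rightarrow> real) \<Rightarrow> nat \<Rightarrow> real" where
  "pow_trace d A n = mat_trace d (mat_pow d A n)"

lemma frob_mat_pow:
  assumes "sym_mat d A"
  shows "frob_inner d (mat_pow d A m) (mat_pow d A n) = pow_trace d A (m + n)"
  unfolding frob_inner_def pow_trace_def mat_trace_def using sym_mat_pow[OF assms, of n]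
  by (intro sum.cong refl) (auto simp: mat_pow_add mat_mult_def sym_mat_def intro!: sum.cong)

lemma moment_form_mat_pow:
  fixes w Y k
  defines "A \<equiv> moment_mat k w Y"
  shows "moment_form k d w Y (mat_pow d A m) (mat_pow d A n) = pow_trace d A (Suc (m + n))"
proof -
  have "moment_form k d w Y (mat_pow d A m) (mat_pow d A n) = frob_inner d (mat_mult d (mat_pow d A m) A) (mat_pow d A n)"
    by (simp add: moment_form_eq_frob A_def)
  also have "\<dots> = frob_inner d (mat_pow d A (m + 1)) (mat_pow d A n)"
    by (rule frob_cong[OF _ refl], subst mat_pow_add)
       (auto intro!: mat_mult_cong simp: mat_pow_one simp del: mat_pow.simps One_nat_def)
  also have "\<dots> = pow_trace d A (Suc (m + n))"
    using frob_mat_pow[of d A "m + 1" n] sym_moment_mat by (simp add: A_def del: mat_pow.simps)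
  finally show ?thesis .
qed

lemma frob_Cauchy_Schwarz: "(frob_inner d A B)\<^sup>2 \<le> frob_inner d A A * frob_inner d B B"
  using Cauchy_Schwarz_ineq_sum[of "\<lambda>(i,j). A i j" "\<lambda>(i,j). B i j" "{..<d} \<times> {..<d}"]
  unfolding frob_inner_def
  by (simp add: sum.cartesian_product power2_eq_square case_prod_unfold)

lemma moment_form_Cauchy_Schwarz:
  assumes "\<And>i. i < k \<Longrightarrow> 0 \<le> w i"
  shows "(moment_form k d w Y A B)\<^sup>2 \<le> moment_form k d w Y A A * moment_form k d w Y B B"
proof -
  define f where "f C = (\<lambda>(i,a). sqrt (w i) * mat_vec d C (Y i) a)" for C
  have *: "moment_form k d w Y C D = (\<Sum>p\<in>{..<k}\<times>{..<d}. f C p * f D p)" for C D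
  proof -
    have "moment_form k d w Y C D = (\<Sum>i<k. \<Sum>a<d. f C (i,a) * f D (i,a))"
      unfolding moment_form_def inner_prod_def sum_distrib_left
    proof (intro sum.cong refl)
      fix i a assume "i \<in> {..<k}" "a \<in> {..<d}"
      then have "sqrt (w i) * sqrt (w i) = w i" using assms by simp
      then have "w i * (mat_vec d C (Y i) a * mat_vec d D (Y i) a) = 
         sqrt (w i) * sqrt (w i) * (mat_vec d C (Y i) a * mat_vec d D (Y i) a)" by simp
      then show "w i * (mat_vec d C (Y i) a * mat_vec d D (Y i) a) = f C (i, a) * f D (i, a)"
        by (simp add: f_def)
    qed
    then show ?thesis by (simp add: sum.cartesian_product)
  qed
  show ?thesis unfolding * using Cauchy_Schwarz_ineq_sum[of "f A" "f B"] by (simp add: power2_eq_square)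
qed

text \<open>
  For \<open>t\<^sub>n = tr A\<^sup>n\<close> log-convexity needs no diagonalisation: \<open>t\<^bsub>m+n\<^esub>\<close> is the Frobenius product and
  \<open>t\<^bsub>m+n+1\<^esub>\<close> the moment form of \<open>A\<^sup>m\<close> and \<open>A\<^sup>n\<close>.  Cauchy--Schwarz for the two forms, with exponents
  \<open>m\<close> and \<open>m + 1\<close>, covers the two parities.
\<close>

lemma pow_trace_moment_mat:
  fixes w Y k d
  defines "A \<equiv> moment_mat k w Y"
  assumes w: "\<And>i. i < k \<Longrightarrow> 0 \<le> w i"
  shows "0 \<le> pow_trace d A n" and "(pow_trace d A (Suc n))\<^sup>2 \<le> pow_trace d A n * pow_trace d A (Suc (Suc n))"
proof -
  have sym: "sym_mat d A" by (simp add: A_def sym_moment_mat)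
  have wf: "moment_form k d w Y (mat_pow d A m) (mat_pow d A n) = pow_trace d A (Suc (m + n))" for m n
    unfolding A_def by (rule moment_form_mat_pow)
  show "0 \<le> pow_trace d A n"
  proof (cases "even n")
    case True
    then obtain m where "n = m + m" by (auto elim: evenE simp: mult_2)
    then show ?thesis using frob_mat_pow[OF sym, of m m] frob_nonneg[of d "mat_pow d A m"] by simp
  next
    case False
    then obtain m where "n = Suc (m + m)" by (auto elim!: oddE simp: mult_2)
    moreover have "0 \<le> moment_form k d w Y (mat_pow d A m) (mat_pow d A m)"
      unfolding moment_form_self using w by (intro sum_nonneg) auto
    ultimately show ?thesis using wf[of m m] by simp
  qed
  show "(pow_trace d A (Suc n))\<^sup>2 \<le> pow_trace d A n * pow_trace d A (Suc (Suc n))"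
  proof (cases "even n")
    case True
    then obtain m where n: "n = m + m" by (auto elim: evenE simp: mult_2)
    show ?thesis using frob_Cauchy_Schwarz[of d "mat_pow d A m" "mat_pow d A (Suc m)"]
      unfolding frob_mat_pow[OF sym] n by simp
  next
    case False
    then obtain m where n: "n = Suc (m + m)" by (auto elim!: oddE simp: mult_2)
    show ?thesis using moment_form_Cauchy_Schwarz[where A = "mat_pow d A m" and B = "mat_pow d A (Suc m)" and d = d and Y = Y and w = w and k = k, OF w]
      unfolding wf n by simp
  qed
qed

text \<open>
  Log-convexity makes the ratios of successive terms increase, so a bound on the last one bounds all.
\<close>

lemma log_convex_growth:
  fixes t :: "nat \<Rightarrow> real"
  assumes nonneg: "\<And>n. 0 \<le> t n" and conv: "\<And>n. (t (Suc n))\<^sup>2 \<le> t n * t (Suc (Suc n))"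
    and "0 \<le> \<rho>" and last: "t (Suc q) \<le> \<rho> * t q"
  shows "t q \<le> \<rho> ^ q * t 0"
proof -
  have ratio: "t (Suc n) \<le> \<rho> * t n" if "n \<le> q" for n
    using that
  proof (induction rule: inc_induct)
    case base
    show ?case by (rule last)
  next
    case (step n)
    show ?case
    proof (cases "t (Suc n) = 0")
      case True
      then show ?thesis using nonneg \<open>0 \<le> \<rho>\<close> by simp
    next
      case False
      then have pos: "0 < t (Suc n)" using nonneg[of "Suc n"] by simp
      have "t (Suc n) * t (Suc n) \<le> t n * t (Suc (Suc n))"
        using conv[of n] by (simp add: power2_eq_square)
      also have "\<dots> \<le> t n * (\<rho> * t (Suc n))"
        using step.IH nonneg[of n] by (intro mult_left_mono)
      finally have "t (Suc n) * t (Suc n) \<le> (\<rho> * t n) * t (Suc n)" by (simp add: ac_simps)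
      then show ?thesis using pos by (rule mult_right_le_imp_le)
    qed
  qed
  have "n \<le> q \<Longrightarrow> t n \<le> \<rho> ^ n * t 0" for n
  proof (induction n)
    case (Suc n)
    have "t (Suc n) \<le> \<rho> * t n" using ratio Suc.prems by simp
    also have "\<dots> \<le> \<rho> * (\<rho> ^ n * t 0)" using Suc \<open>0 \<le> \<rho>\<close> by (intro mult_left_mono) auto
    finally show ?case by (simp add: ac_simps)
  qed simp
  then show ?thesis by simp
qed

lemma le_double_exp:
  assumes "d \<le> m" shows "d \<le> 2 ^ (2 ^ Suc m)"
proof -
  have "d \<le> 2 ^ d" by (rule less_imp_le[OF less_exp])
  also have "d \<le> 2 ^ Suc m"
    by (rule order_trans[OF less_imp_le[OF less_exp]], rule power_increasing) (use assms in auto)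
  then have "(2::nat) ^ d \<le> 2 ^ (2 ^ Suc m)" by (intro power_increasing) auto
  finally show ?thesis .
qed

text \<open>
  The converse direction of the eigenvalue test.  The sum on the left of the last hypothesis is
  \<open>tr A\<^sup>q\<^sup>+\<^sup>1\<close> for \<open>q = 2\<^bsup>m+1\<^esup>\<close> and the moment matrix \<open>A\<close>, and \<open>|N|\<^sup>2\<close> is \<open>tr A\<^sup>q\<close>, so log-convexity
  gives \<open>tr A\<^sup>q \<le> d \<rho>\<^sup>q\<close>; the bound on \<open>d\<close> absorbs the dimension into \<open>2\<^sup>q\<close>.
\<close>

lemma frob_iter_le_of_ratio:
  fixes w Y k d m
  defines "N \<equiv> (mat_square d ^^ m) (moment_mat k w Y)"
  assumes w: "\<And>i. i < k \<Longrightarrow> 0 \<le> w i" and \<rho>: "0 \<le> \<rho>" and d: "d \<le> 2 ^ (2 ^ Suc m)"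
    and ratio: "(\<Sum>i<k. w i * image_norm_sq d N (Y i)) \<le> \<rho> * frob_inner d N N"
  shows "frob_inner d N N \<le> (2 * \<rho>) ^ (2 ^ Suc m)"
proof -
  define A where "A = moment_mat k w Y"
  define n :: nat where "n = 2 ^ m"
  have N: "N i j = mat_pow d A n i j" if "i < d" "j < d" for i j
    using mat_square_iter_eq_pow[OF that] by (simp add: N_def A_def n_def)
  have fN: "frob_inner d N N = pow_trace d A (n + n)"
    using frob_mat_pow[of d A n n] sym_moment_mat frob_cong[of d N _ N, OF N N] by (simp add: A_def)
  have "(\<Sum>i<k. w i * image_norm_sq d N (Y i)) = moment_form k d w Y (mat_pow d A n) (mat_pow d A n)"
    unfolding moment_form_self by (intro sum.cong refl arg_cong2[where f="(*)"] image_norm_sq_cong N)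
  then have "pow_trace d A (Suc (n + n)) \<le> \<rho> * pow_trace d A (n + n)"
    using ratio moment_form_mat_pow[of k d w Y n n] by (simp add: fN A_def)
  then have "pow_trace d A (n + n) \<le> \<rho> ^ (n + n) * pow_trace d A 0"
    using pow_trace_moment_mat[OF w] \<rho> unfolding A_def by (intro log_convex_growth) auto
  also have "pow_trace d A 0 = d" by (simp add: pow_trace_def mat_trace_def)
  also have "\<rho> ^ (n + n) * d \<le> \<rho> ^ (n + n) * 2 ^ (n + n)"
  proof (rule mult_left_mono)
    have "d \<le> 2 ^ (n + n)" using d by (simp add: n_def mult_2)
    then have "real d \<le> real (2 ^ (n + n))" by (simp only: of_nat_le_iff)
    then show "real d \<le> 2 ^ (n + n)" by simp
  qed (use \<rho> in auto)
  finally show ?thesis by (simp add: fN n_def power_mult_distrib mult_2 mult.commute)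
qed

section \<open>Fractional cores of spread point sets\<close>

lemma mat_trace_commute: "mat_trace d (mat_mult d A B) = mat_trace d (mat_mult d B A)"
proof -
  have "mat_trace d (mat_mult d A B) = (\<Sum>l<d. \<Sum>i<d. A i l * B l i)"
    unfolding mat_trace_def mat_mult_def by (rule sum.swap)
  then show ?thesis by (simp add: mat_trace_def mat_mult_def mult.commute)
qed

lemma mat_trace_cong: "(\<And>i. i < d \<Longrightarrow> A i i = B i i) \<Longrightarrow> mat_trace d A = mat_trace d B"
  by (simp add: mat_trace_def)

lemma mat_mult_add_right:
  "mat_mult d A (\<lambda>i j. B i j + C i j) i j = mat_mult d A B i j + mat_mult d A C i j"
  by (simp add: mat_mult_def distrib_left sum.distrib)

primrec mat_pow_deriv ::
  "nat \<Rightarrow> (nat \<Rightarrow> nat \<Rightarrow> real) \<Rightarrow> (nat \<Rightarrow> nat \<Rightarrow> real) \<Rightarrow> nat \<Rightarrow> nat \<Rightarrow> nat \<Rightarrow> real" where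
  "mat_pow_deriv d A B 0 = (\<lambda>i j. 0)"
| "mat_pow_deriv d A B (Suc n) =
     (\<lambda>i j. mat_mult d B (mat_pow d A n) i j + mat_mult d A (mat_pow_deriv d A B n) i j)"

lemma DERIV_mat_pow:
  assumes "\<And>i j. ((\<lambda>h. A h i j) has_real_derivative B i j) (at h)"
  shows "((\<lambda>h. mat_pow d (A h) n i j) has_real_derivative mat_pow_deriv d (A h) B n i j) (at h)"
proof (induction n arbitrary: i)
  case (Suc n)
  have "((\<lambda>h. \<Sum>l<d. A h i l * mat_pow d (A h) n l j) has_real_derivative
      (\<Sum>l<d. B i l * mat_pow d (A h) n l j + mat_pow_deriv d (A h) B n l j * A h i l)) (at h)"
    by (intro DERIV_sum DERIV_mult assms Suc)
  then show ?case by (simp add: mat_mult_def sum.distrib mult.commute)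
qed simp

text \<open>
  Cyclicity of the trace makes all \<open>n\<close> terms of the product rule equal.  The extra factor \<open>A\<^sup>a\<close> on
  the left is what the induction on \<open>n\<close> needs.
\<close>

lemma mat_trace_mat_pow_deriv:
  "mat_trace d (mat_mult d (mat_pow d A a) (mat_pow_deriv d A B n))
     = real n * mat_trace d (mat_mult d (mat_pow d A (a + n - 1)) B)"
proof (induction n arbitrary: a)
  case 0
  then show ?case by (simp add: mat_trace_def mat_mult_def)
next
  case (Suc n)
  let ?P = "mat_pow d A" and ?D = "mat_pow_deriv d A B"
  have 1: "mat_trace d (mat_mult d (?P a) (mat_mult d B (?P n))) = mat_trace d (mat_mult d (?P (a + n)) B)"
  proof -
    have "mat_trace d (mat_mult d (?P a) (mat_mult d B (?P n)))
        = mat_trace d (mat_mult d (mat_mult d (?P n) (?P a)) B)"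
      unfolding mat_mult_assoc[symmetric] by (subst mat_trace_commute) (simp add: mat_mult_assoc)
    also have "\<dots> = mat_trace d (mat_mult d (?P (n + a)) B)"
      by (intro mat_trace_cong mat_mult_cong) (simp_all add: mat_pow_add)
    finally show ?thesis by (simp add: add.commute)
  qed
  have 2: "mat_trace d (mat_mult d (?P a) (mat_mult d A (?D n))) = mat_trace d (mat_mult d (?P (Suc a)) (?D n))"
    unfolding mat_mult_assoc[symmetric]
  proof (intro mat_trace_cong mat_mult_cong)
    fix i l assume "i < d" "l < d"
    then show "mat_mult d (?P a) A i l = ?P (Suc a) i l"
      using mat_pow_add[of i d A a 1] mat_mult_cong[of d "?P a" i "?P a" "?P 1" l A] mat_pow_one
      by (simp del: mat_pow.simps)
  qed simp
  have "mat_trace d (mat_mult d (?P a) (?D (Suc n)))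
      = mat_trace d (mat_mult d (?P a) (mat_mult d B (?P n))) + mat_trace d (mat_mult d (?P a) (mat_mult d A (?D n)))"
    by (simp add: mat_mult_add_right mat_trace_def sum.distrib)
  also have "\<dots> = mat_trace d (mat_mult d (?P (a + n)) B) + real n * mat_trace d (mat_mult d (?P (Suc a + n - 1)) B)"
    unfolding 1 2 Suc.IH ..
  finally show ?case by (simp add: algebra_simps)
qed

lemma DERIV_pow_trace:
  assumes "\<And>i j. ((\<lambda>h. A h i j) has_real_derivative B i j) (at h)"
  shows "((\<lambda>h. pow_trace d (A h) (Suc n)) has_real_derivative
     real (Suc n) * mat_trace d (mat_mult d (mat_pow d (A h) n) B)) (at h)"
proof -
  have "((\<lambda>h. pow_trace d (A h) (Suc n)) has_real_derivative (\<Sum>i<d. mat_pow_deriv d (A h) B (Suc n) i i)) (at h)"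
    unfolding pow_trace_def mat_trace_def by (intro DERIV_sum DERIV_mat_pow assms)
  moreover have "(\<Sum>i<d. mat_pow_deriv d (A h) B (Suc n) i i)
      = mat_trace d (mat_mult d (mat_pow d (A h) 0) (mat_pow_deriv d (A h) B (Suc n)))"
    unfolding mat_trace_def
    by (rule sum.cong[OF refl]) (simp add: mat_mult_def[of _ "\<lambda>i j. if i = j then 1 else 0"] if_distrib[of "\<lambda>x. x * _"] del: mat_pow_deriv.simps cong: if_cong)
  ultimately show ?thesis using mat_trace_mat_pow_deriv[of d "A h" 0 B "Suc n"] by (simp del: mat_pow_deriv.simps mat_pow.simps(2))
qed

lemma mat_trace_pow_moment_mat:
  assumes "sym_mat d A"
  shows "mat_trace d (mat_mult d (mat_pow d A (n + n)) (moment_mat k v Y))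
       = (\<Sum>i<k. v i * image_norm_sq d (mat_pow d A n) (Y i))"
proof -
  let ?P = "mat_pow d A n" and ?B = "moment_mat k v Y"
  have "(\<Sum>i<k. v i * image_norm_sq d ?P (Y i)) = frob_inner d (mat_mult d ?P ?B) ?P"
    by (simp add: moment_form_self[symmetric] moment_form_eq_frob)
  also have "\<dots> = mat_trace d (mat_mult d (mat_mult d ?P ?B) ?P)"
    unfolding mat_trace_def frob_inner_def mat_mult_def[of d "mat_mult d ?P ?B"]
    using sym_mat_pow[OF assms, of n] by (auto simp: sym_mat_def intro!: sum.cong)
  also have "\<dots> = mat_trace d (mat_mult d (mat_mult d ?P ?P) ?B)"
    by (subst mat_trace_commute) (simp add: mat_mult_assoc)
  also have "\<dots> = mat_trace d (mat_mult d (mat_pow d A (n + n)) ?B)"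
    by (intro mat_trace_cong mat_mult_cong) (simp_all add: mat_pow_add)
  finally show ?thesis by simp
qed

lemma continuous_on_pow_trace:
  "continuous_on S (\<lambda>w. pow_trace d (moment_mat k w Y) n)"
proof -
  have entry: "continuous_on S (\<lambda>w. moment_mat k w Y i j)" for i j
    unfolding moment_mat_def
    by (intro continuous_intros continuous_on_subset[OF continuous_on_product_coordinates]) auto
  have "continuous_on S (\<lambda>w. mat_pow d (moment_mat k w Y) n i j)" for i j
  proof (induction n arbitrary: i)
    case (Suc n)
    then show ?case unfolding mat_pow.simps mat_mult_def
      by (intro continuous_intros entry)
  qed simp
  then show ?thesis unfolding pow_trace_def mat_trace_def by (intro continuous_intros)
qed

text \<open>
  The weights outside \<open>{..<k}\<close> are pinned to 0 so that the polytope is compact in the product topology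
  of all functions.
\<close>

definition weight_polytope :: "nat \<Rightarrow> real \<Rightarrow> (nat \<Rightarrow> real) set" where
  "weight_polytope k e = {w \<in> (\<Pi>\<^sub>E i\<in>UNIV. if i < k then {0..1} else {0}). (\<Sum>i<k. 1 - w i) \<le> e}"

lemma compact_weight_polytope: "compact (weight_polytope k e)"
proof -
  have "compactin (product_topology (\<lambda>i. euclidean) UNIV) (\<Pi>\<^sub>E i\<in>UNIV. if i < k then {0..1::real} else {0})"
    by (subst compactin_PiE) auto
  then have "compact (\<Pi>\<^sub>E i\<in>UNIV. if i < k then {0..1::real} else {0})"
    by (simp add: euclidean_product_topology)
  moreover have "closed {w :: nat \<Rightarrow> real. (\<Sum>i<k. 1 - w i) \<le> e}"
    by (intro closed_Collect_le continuous_intros continuous_on_product_coordinates)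
  ultimately have "compact ((\<Pi>\<^sub>E i\<in>UNIV. if i < k then {0..1::real} else {0}) \<inter> {w. (\<Sum>i<k. 1 - w i) \<le> e})"
    by (rule compact_Int_closed)
  moreover have "weight_polytope k e
      = (\<Pi>\<^sub>E i\<in>UNIV. if i < k then {0..1::real} else {0}) \<inter> {w. (\<Sum>i<k. 1 - w i) \<le> e}"
    unfolding weight_polytope_def by blast
  ultimately show ?thesis by simp
qed

lemma weight_polytope_D:
  assumes "w \<in> weight_polytope k e" "i < k"
  shows "0 \<le> w i" "w i \<le> 1"
proof -
  have "w i \<in> (if i < k then {0..1} else {0})"
    using assms(1) unfolding weight_polytope_def by (blast intro: PiE_mem)
  then show "0 \<le> w i" "w i \<le> 1" using assms(2) by auto
qed

lemma weight_polytope_convex: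
  assumes w: "w \<in> weight_polytope k e" and v: "v \<in> weight_polytope k e" and h: "0 \<le> h" "h \<le> 1"
  shows "(\<lambda>i. w i + h * (v i - w i)) \<in> weight_polytope k e"
proof -
  have eq: "w i + h * (v i - w i) = (1 - h) * w i + h * v i" for i by (simp add: algebra_simps)
  have "w i + h * (v i - w i) \<in> (if i < k then {0..1} else {0})" for i
  proof -
    have "w i \<in> (if i < k then {0..1} else {0})" "v i \<in> (if i < k then {0..1} else {0})"
      using w v unfolding weight_polytope_def by (blast intro: PiE_mem)+
    then show ?thesis using h unfolding eq
      by (auto split: if_splits simp: convex_bound_le)
  qed
  moreover have "(\<Sum>i<k. 1 - (w i + h * (v i - w i))) \<le> e"
  proof -
    have "(\<Sum>i<k. 1 - (w i + h * (v i - w i))) = (1 - h) * (\<Sum>i<k. 1 - w i) + h * (\<Sum>i<k. 1 - v i)"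
      by (simp add: sum_distrib_left sum.distrib[symmetric] algebra_simps)
    also have "\<dots> \<le> e" using w v h by (intro convex_bound_le) (auto simp: weight_polytope_def)
    finally show ?thesis .
  qed
  ultimately show ?thesis unfolding weight_polytope_def by (auto simp: PiE_UNIV_domain)
qed

text \<open>
  Normalised to \<open>|N| = 1\<close>, these are the points outside the ellipsoid \<open>y\<^sup>T N\<^sup>T N y \<le> b\<close>.
\<close>

definition heavy_points ::
  "nat \<Rightarrow> nat \<Rightarrow> (nat \<Rightarrow> nat \<Rightarrow> real) \<Rightarrow> real \<Rightarrow> (nat \<Rightarrow> nat \<Rightarrow> real) \<Rightarrow> nat set" where
  "heavy_points k d Y b N = {i. i < k \<and> b * frob_inner d N N < image_norm_sq d N (Y i)}"

text \<open>
  The centrality condition with density matrices \<open>N\<^sup>T N\<close> in place of single directions.  It is the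
  dual form of the existence of core weights.
\<close>

definition spread :: "nat \<Rightarrow> nat \<Rightarrow> (nat \<Rightarrow> nat \<Rightarrow> real) \<Rightarrow> real \<Rightarrow> real \<Rightarrow> bool" where
  "spread k d Y b e \<longleftrightarrow> (\<forall>N. real (card (heavy_points k d Y b N)) \<le> e)"

lemma sum_image_norm_sq_le:
  assumes "\<And>u. inner_prod d u (mat_vec d (moment_mat k w Y) u) \<le> \<sigma> * inner_prod d u u"
  shows "(\<Sum>i<k. w i * image_norm_sq d N (Y i)) \<le> \<sigma> * frob_inner d N N"
proof -
  have "(\<Sum>i<k. w i * image_norm_sq d N (Y i)) = (\<Sum>a<d. \<Sum>i<k. w i * (inner_prod d (Y i) (N a))\<^sup>2)"
    unfolding image_norm_sq_def sum_distrib_left by (subst sum.swap) (simp add: inner_prod_commute)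
  also have "\<dots> \<le> (\<Sum>a<d. \<sigma> * inner_prod d (N a) (N a))"
    using assms unfolding quad_form_moment_mat by (intro sum_mono) auto
  also have "\<dots> = \<sigma> * frob_inner d N N"
    by (simp add: frob_inner_def inner_prod_def sum_distrib_left)
  finally show ?thesis .
qed

text \<open>
  This is a minimax statement, proved without duality.  Let \<open>w\<close> minimise \<open>tr A\<^sup>2\<^sup>n\<^sup>+\<^sup>1\<close> over the
  polytope, \<open>A\<close> being the moment matrix of \<open>w\<close>.  Up to a constant the gradient at \<open>w\<close> has the entries
  \<open>|A\<^sup>n Y\<^sub>i|\<^sup>2\<close>, so among the admissible weights \<open>v\<close> the sum \<open>\<Sum>\<^sub>i v\<^sub>i |A\<^sup>n Y\<^sub>i|\<^sup>2\<close> is smallest at \<open>w\<close>.  The indicator of the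
  points that are not heavy for \<open>N = A\<^sup>n\<close> is admissible and makes this sum at most \<open>k b |N|\<^sup>2\<close>.  Hence
  \<open>tr (A N\<^sup>2) \<le> k b |N|\<^sup>2\<close>, and as \<open>n\<close> is large this bounds the largest eigenvalue of \<open>A\<close> by \<open>2 k b\<close>.
\<close>

lemma exists_core_weights:
  assumes b: "0 \<le> b" and spread: "spread k d Y b e"
  obtains w where "\<And>i. i < k \<Longrightarrow> 0 \<le> w i" "\<And>i. i < k \<Longrightarrow> w i \<le> 1" "(\<Sum>i<k. 1 - w i) \<le> e"
    "\<And>N. (\<Sum>i<k. w i * image_norm_sq d N (Y i)) \<le> 2 * real k * b * frob_inner d N N"
proof -
  define n :: nat where "n = 2 ^ d"
  define F where "F w = pow_trace d (moment_mat k w Y) (Suc (n + n))" for w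
  define good where "good N = (\<lambda>i. if i < k \<and> i \<notin> heavy_points k d Y b N then 1 else (0::real))" for N
  have good_mem: "good N \<in> weight_polytope k e" for N
  proof -
    have "(\<Sum>i<k. 1 - good N i) = (\<Sum>i<k. if i \<in> heavy_points k d Y b N then 1 else 0)"
      by (intro sum.cong) (auto simp: good_def)
    also have "\<dots> = real (card ({..<k} \<inter> heavy_points k d Y b N))"
      by (simp add: sum.If_cases)
    also have "{..<k} \<inter> heavy_points k d Y b N = heavy_points k d Y b N"
      by (auto simp: heavy_points_def)
    finally show ?thesis using spread unfolding spread_def weight_polytope_def
      by (auto simp: good_def)
  qed
  then have "weight_polytope k e \<noteq> {}" by blast
  then obtain w where w: "w \<in> weight_polytope k e" and min: "\<And>v. v \<in> weight_polytope k e \<Longrightarrow> F w \<le> F v"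
    using continuous_attains_inf[OF compact_weight_polytope _ continuous_on_pow_trace, of k e d k Y "Suc (n + n)"]
    unfolding F_def by blast
  define A where "A = moment_mat k w Y"
  define N where "N = (mat_square d ^^ d) A"
  have N: "N i j = mat_pow d A n i j" if "i < d" "j < d" for i j
    using mat_square_iter_eq_pow[OF that] by (simp add: N_def n_def)
  have first_order: "(\<Sum>i<k. w i * image_norm_sq d N (Y i)) \<le> (\<Sum>i<k. good N i * image_norm_sq d N (Y i))"
  proof (rule ccontr)
    assume neg: "\<not> ?thesis"
    define v where "v i = good N i - w i" for i
    \<comment> \<open>The segment from \<open>w\<close> to the indicator; moving along it would decrease the objective.\<close>
    define path where "path h = moment_mat k (\<lambda>i. w i + h * v i) Y" for h :: real
    have path0: "path 0 = A" by (simp add: path_def A_def)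
    have "((\<lambda>h. path h i j) has_real_derivative moment_mat k v Y i j) (at 0)" for i j
      unfolding path_def moment_mat_def
      by (auto intro!: derivative_eq_intros sum.cong)
    from DERIV_pow_trace[where A = path and B = "moment_mat k v Y" and d = d and n = "n + n", OF this]
    have "((\<lambda>h. pow_trace d (path h) (Suc (n + n))) has_real_derivative
        real (Suc (n + n)) * (\<Sum>i<k. v i * image_norm_sq d (mat_pow d A n) (Y i))) (at 0)"
      unfolding path0 by (subst (asm) mat_trace_pow_moment_mat) (simp_all add: A_def sym_moment_mat)
    moreover have "(\<Sum>i<k. v i * image_norm_sq d (mat_pow d A n) (Y i))
        = (\<Sum>i<k. good N i * image_norm_sq d N (Y i)) - (\<Sum>i<k. w i * image_norm_sq d N (Y i))"
      unfolding sum_subtractf[symmetric]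
    proof (intro sum.cong refl)
      fix i
      have "image_norm_sq d (mat_pow d A n) (Y i) = image_norm_sq d N (Y i)"
        by (intro image_norm_sq_cong) (simp_all add: N)
      then show "v i * image_norm_sq d (mat_pow d A n) (Y i)
          = good N i * image_norm_sq d N (Y i) - w i * image_norm_sq d N (Y i)"
        by (simp add: v_def algebra_simps)
    qed
    moreover have "real (Suc (n + n)) * ((\<Sum>i<k. good N i * image_norm_sq d N (Y i)) - (\<Sum>i<k. w i * image_norm_sq d N (Y i))) < 0"
      using neg by (intro mult_pos_neg) auto
    ultimately obtain \<delta> where "0 < \<delta>" and
      dec: "\<And>h. 0 < h \<Longrightarrow> h < \<delta> \<Longrightarrow> pow_trace d (path (0 + h)) (Suc (n + n)) < pow_trace d (path 0) (Suc (n + n))"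
      using DERIV_neg_dec_right by (metis (no_types, lifting))
    define h where "h = min 1 (\<delta> / 2)"
    have h: "0 < h" "h < \<delta>" "h \<le> 1" using \<open>0 < \<delta>\<close> by (auto simp: h_def)
    have "(\<lambda>i. w i + h * v i) \<in> weight_polytope k e"
      unfolding v_def using weight_polytope_convex[OF w good_mem, of h] h by simp
    from min[OF this] dec[OF h(1,2)] show False
      by (simp add: F_def path_def)
  qed
  have "(\<Sum>i<k. good N i * image_norm_sq d N (Y i)) \<le> (\<Sum>i<k. b * frob_inner d N N)"
    using b by (intro sum_mono) (auto simp: good_def heavy_points_def)
  with first_order have ratio: "(\<Sum>i<k. w i * image_norm_sq d N (Y i)) \<le> (real k * b) * frob_inner d N N"
    by simp
  have "frob_inner d N N \<le> (2 * (real k * b)) ^ (2 ^ Suc d)"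
    using frob_iter_le_of_ratio[of k w "real k * b" d d Y] weight_polytope_D[OF w] b le_double_exp[OF order_refl] ratio
    by (simp add: N_def A_def)
  then have "inner_prod d u (mat_vec d A u) \<le> (2 * (real k * b)) * inner_prod d u u" for u
    using quad_form_le_of_frob_iter[of d A "2 * (real k * b)" d u] sym_moment_mat b
    by (simp add: N_def A_def)
  then have "(\<Sum>i<k. w i * image_norm_sq d N (Y i)) \<le> 2 * real k * b * frob_inner d N N" for N
    using sum_image_norm_sq_le[of d k w Y "2 * (real k * b)" N] by (simp add: A_def mult.assoc)
  moreover have "(\<Sum>i<k. 1 - w i) \<le> e" using w by (simp add: weight_polytope_def)
  ultimately show ?thesis using that weight_polytope_D[OF w] by blast
qed

section \<open>The filter and its analysis\<close>

primrec max_score :: "(nat \<Rightarrow> real) \<Rightarrow> (nat \<Rightarrow> real) \<Rightarrow> nat \<Rightarrow> real" where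
  "max_score w \<tau> 0 = 0"
| "max_score w \<tau> (Suc n) = (if 0 < w n \<and> max_score w \<tau> n < \<tau> n then \<tau> n else max_score w \<tau> n)"

text \<open>
  The factor \<open>200 / (r\<^sup>2 k)\<close> turns the eigenvalue bound \<open>r\<^sup>2 k / 200\<close> into 1, and \<open>2 d\<close> squarings
  make the dimension factor harmless by a wide margin.
\<close>

definition filter_mat ::
  "nat \<Rightarrow> nat \<Rightarrow> real \<Rightarrow> (nat \<Rightarrow> nat \<Rightarrow> real) \<Rightarrow> (nat \<Rightarrow> real) \<Rightarrow> nat \<Rightarrow> nat \<Rightarrow> real" where
  "filter_mat k d r Y w =
     (mat_square d ^^ (2 * d)) (\<lambda>a b. moment_mat k w Y a b * 200 / (r * r * real k))"

text \<open>
  The maximum ranges over the indices of positive weight only.  So the new weights are nonnegative, and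
  if the maximum is positive, an index of positive weight gets weight 0.
\<close>

definition filter_step ::
  "nat \<Rightarrow> nat \<Rightarrow> real \<Rightarrow> (nat \<Rightarrow> nat \<Rightarrow> real) \<Rightarrow> (nat \<Rightarrow> real) \<Rightarrow> nat \<Rightarrow> real" where
  "filter_step k d r Y w =
     (let N = filter_mat k d r Y w; \<tau> = (\<lambda>i. image_norm_sq d N (Y i))
      in if 1 < frob_inner d N N then (\<lambda>i. w i * (1 - \<tau> i / max_score w \<tau> k)) else w)"

definition filter_weights ::
  "nat \<Rightarrow> nat \<Rightarrow> real \<Rightarrow> (nat \<Rightarrow> nat \<Rightarrow> real) \<Rightarrow> nat \<Rightarrow> nat \<Rightarrow> real" where
  "filter_weights k d r Y t = (filter_step k d r Y ^^ t) (\<lambda>i. 1)"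

text \<open>
  After \<open>k\<close> effective rounds no weight would be left, so the weights after \<open>k\<close> rounds are the final ones.
\<close>

definition accepts :: "nat \<Rightarrow> nat \<Rightarrow> real \<Rightarrow> real \<Rightarrow> (nat \<Rightarrow> nat \<Rightarrow> real) \<Rightarrow> bool" where
  "accepts k d r p Y \<longleftrightarrow>
     (let w = filter_weights k d r Y k; N = filter_mat k d r Y w
      in frob_inner d N N \<le> 1 \<and> (\<Sum>i<k. 1 - w i) \<le> real k / 200 \<and> 1 / 100 \<le> p)"

lemma max_score_nonneg: "(\<And>i. 0 \<le> \<tau> i) \<Longrightarrow> 0 \<le> max_score w \<tau> n"
  by (induction n) auto

lemma max_score_ge: "i < n \<Longrightarrow> 0 < w i \<Longrightarrow> \<tau> i \<le> max_score w \<tau> n"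
  by (induction n) (auto simp: less_Suc_eq)

lemma max_score_attained:
  "0 < max_score w \<tau> n \<Longrightarrow> \<exists>i<n. 0 < w i \<and> \<tau> i = max_score w \<tau> n"
  by (induction n) (auto simp: less_Suc_eq split: if_splits)

lemma filter_mat_eq:
  "filter_mat k d r Y w
     = (mat_square d ^^ (2 * d)) (moment_mat k (\<lambda>i. w i * 200 / (r * r * real k)) Y)"
  unfolding filter_mat_def moment_mat_def sum_distrib_right sum_divide_distrib
  by (intro arg_cong[where f = "mat_square d ^^ (2 * d)"] ext sum.cong) auto

lemma filter_step_bounds:
  assumes "\<And>i. i < k \<Longrightarrow> 0 \<le> w i \<and> w i \<le> 1" "i < k"
  shows "0 \<le> filter_step k d r Y w i \<and> filter_step k d r Y w i \<le> w i"
proof -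
  define N where "N = filter_mat k d r Y w"
  define \<tau> where "\<tau> = (\<lambda>i. image_norm_sq d N (Y i))"
  have nonneg: "0 \<le> max_score w \<tau> k" by (rule max_score_nonneg) (simp add: \<tau>_def)
  have "0 \<le> w i * (1 - \<tau> i / max_score w \<tau> k) \<and> w i * (1 - \<tau> i / max_score w \<tau> k) \<le> w i"
  proof (cases "0 < w i")
    case True
    then have "\<tau> i \<le> max_score w \<tau> k" using max_score_ge assms(2) by blast
    moreover have "0 \<le> \<tau> i" by (simp add: \<tau>_def)
    ultimately have "0 \<le> \<tau> i / max_score w \<tau> k" "\<tau> i / max_score w \<tau> k \<le> 1"
      using nonneg by (auto simp: divide_le_eq_1)
    then show ?thesis using True by (simp add: mult_le_cancel_left2)
  next
    case False
    then have "w i = 0" using assms by fastforce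
    then show ?thesis by simp
  qed
  then show ?thesis using assms by (simp add: filter_step_def Let_def N_def \<tau>_def)
qed

lemma filter_weights_bounds:
  "i < k \<Longrightarrow> 0 \<le> filter_weights k d r Y t i \<and> filter_weights k d r Y t i \<le> 1"
proof (induction t arbitrary: i)
  case (Suc t)
  then have "0 \<le> filter_step k d r Y (filter_weights k d r Y t) i
      \<and> filter_step k d r Y (filter_weights k d r Y t) i \<le> filter_weights k d r Y t i"
    by (intro filter_step_bounds) auto
  then show ?case using Suc by (force simp: filter_weights_def)
qed (simp add: filter_weights_def)

text \<open>
  Among the indices with \<open>\<langle>Y\<^sub>i, u\<rangle> \<ge> r\<close>, the certified eigenvalue bound limits the sum of the
  \<open>w\<^sub>i\<close> and the removed weight limits the sum of the \<open>1 - w\<^sub>i\<close>, each by \<open>k / 200\<close>.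
\<close>

lemma accepts_imp_central:
  assumes "1 \<le> k" "0 < r" and acc: "accepts k d r p (\<lambda>i j. Z i j - x j)"
  shows "central k d Z r p x"
  unfolding central_def
proof (intro allI impI)
  fix u assume u: "L2_set u {..<d} = 1"
  define Y where "Y = (\<lambda>i j. Z i j - x j)"
  define w where "w = filter_weights k d r Y k"
  define B where "B = {i. i < k \<and> inner_prod d (\<lambda>j. Z i j - x j) u \<ge> r}"
  define c where "c = 200 / (r * r * real k)"
  have w: "0 \<le> w i" "w i \<le> 1" if "i < k" for i
    using filter_weights_bounds that by (auto simp: w_def)
  have "0 < c" using assms by (simp add: c_def)
  have norm_le: "frob_inner d (filter_mat k d r Y w) (filter_mat k d r Y w) \<le> 1"
    and deleted: "(\<Sum>i<k. 1 - w i) \<le> real k / 200" and p: "1 / 100 \<le> p"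
    using acc by (simp_all add: accepts_def Let_def w_def Y_def)
  have "inner_prod d u u = 1" using u
    by (simp add: L2_set_def inner_prod_def power2_eq_square)
  moreover have "inner_prod d u (mat_vec d (moment_mat k (\<lambda>i. w i * c) Y) u) \<le> 1 * inner_prod d u u"
    using norm_le by (intro quad_form_le_of_frob_iter[where m = "2 * d"] sym_moment_mat)
      (simp_all add: filter_mat_eq c_def)
  ultimately have quad: "(\<Sum>i<k. w i * c * (inner_prod d (Y i) u)\<^sup>2) \<le> 1"
    by (simp add: quad_form_moment_mat)
  have fin: "finite B" and sub: "B \<subseteq> {..<k}" by (auto simp: B_def)
  have "(\<Sum>i\<in>B. w i) * (c * r\<^sup>2) \<le> (\<Sum>i\<in>B. w i * c * (inner_prod d (Y i) u)\<^sup>2)"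
    unfolding sum_distrib_right
  proof (intro sum_mono)
    fix i assume i: "i \<in> B"
    then have "r\<^sup>2 \<le> (inner_prod d (Y i) u)\<^sup>2"
      using \<open>0 < r\<close> by (intro power_mono) (auto simp: B_def Y_def)
    then show "w i * (c * r\<^sup>2) \<le> w i * c * (inner_prod d (Y i) u)\<^sup>2"
      using w[of i] i sub \<open>0 < c\<close> by (auto simp: mult.assoc intro!: mult_left_mono)
  qed
  also have "\<dots> \<le> (\<Sum>i<k. w i * c * (inner_prod d (Y i) u)\<^sup>2)"
    using sub w \<open>0 < c\<close> by (intro sum_mono2) (auto intro!: mult_nonneg_nonneg)
  finally have "(\<Sum>i\<in>B. w i) * (c * r\<^sup>2) \<le> 1" using quad by simp
  moreover have "c * r\<^sup>2 = 200 / real k"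
    using assms by (simp add: c_def power2_eq_square)
  ultimately have 1: "(\<Sum>i\<in>B. w i) \<le> real k / 200"
    using assms by (simp add: field_simps)
  have "(\<Sum>i\<in>B. 1 - w i) \<le> (\<Sum>i<k. 1 - w i)"
    using sub w by (intro sum_mono2) auto
  with 1 deleted have "(\<Sum>i\<in>B. w i) + (\<Sum>i\<in>B. 1 - w i) \<le> real k / 100" by simp
  then have "real (card B) \<le> 1 / 100 * real k"
    by (simp add: sum.distrib[symmetric])
  also have "\<dots> \<le> p * real k" using p by (intro mult_right_mono) auto
  finally show "real (card {i. i < k \<and> inner_prod d (\<lambda>j. Z i j - x j) u \<ge> r}) \<le> p * real k"
    by (simp add: B_def)
qed

text \<open>
  Otherwise the converse eigenvalue test with ratio \<open>1 / 2\<close> would give \<open>|N|\<^sup>2 \<le> 1\<close>.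
\<close>

lemma uncertified_score_sum:
  assumes "1 \<le> k" "0 < r" and w: "\<And>i. i < k \<Longrightarrow> 0 \<le> w i"
    and uncert: "1 < frob_inner d (filter_mat k d r Y w) (filter_mat k d r Y w)"
  shows "r\<^sup>2 * real k / 400 * frob_inner d (filter_mat k d r Y w) (filter_mat k d r Y w)
     < (\<Sum>i<k. w i * image_norm_sq d (filter_mat k d r Y w) (Y i))"
proof (rule ccontr)
  let ?N = "filter_mat k d r Y w"
  define c where "c = 200 / (r * r * real k)"
  have "0 < c" using assms by (simp add: c_def)
  assume "\<not> ?thesis"
  then have "c * (\<Sum>i<k. w i * image_norm_sq d ?N (Y i)) \<le> c * (r\<^sup>2 * real k / 400 * frob_inner d ?N ?N)"
    using \<open>0 < c\<close> by (intro mult_left_mono) auto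
  moreover have "c * (r\<^sup>2 * real k / 400) = 1 / 2"
    using assms by (simp add: c_def power2_eq_square)
  then have "c * (r\<^sup>2 * real k / 400 * frob_inner d ?N ?N) = 1 / 2 * frob_inner d ?N ?N"
    by (simp only: mult.assoc[symmetric])
  moreover have "(\<Sum>i<k. w i * c * image_norm_sq d ?N (Y i)) = c * (\<Sum>i<k. w i * image_norm_sq d ?N (Y i))"
    by (simp add: sum_distrib_left ac_simps)
  ultimately have ratio: "(\<Sum>i<k. w i * c * image_norm_sq d ?N (Y i)) \<le> 1 / 2 * frob_inner d ?N ?N"
    by linarith
  have N: "?N = (mat_square d ^^ (2 * d)) (moment_mat k (\<lambda>i. w i * c) Y)"
    by (simp add: filter_mat_eq c_def)
  have "frob_inner d ?N ?N \<le> (2 * (1 / 2)) ^ (2 ^ Suc (2 * d))"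
    unfolding N
    by (rule frob_iter_le_of_ratio[OF _ _ le_double_exp[of d "2 * d"]])
       (use w \<open>0 < c\<close> ratio in \<open>simp_all only: N[symmetric], auto\<close>)
  then show False using uncert by simp
qed

lemma uncertified_step:
  fixes k d r Y w
  defines "N \<equiv> filter_mat k d r Y w"
  defines "w' \<equiv> filter_step k d r Y w"
  assumes "1 \<le> k" "0 < r" and w: "\<And>i. i < k \<Longrightarrow> 0 \<le> w i \<and> w i \<le> 1"
    and uncert: "1 < frob_inner d N N"
  shows "\<exists>m>0. \<forall>i. w' i = w i - w i * image_norm_sq d N (Y i) / m"
    and "card {i. i < k \<and> 0 < w' i} < card {i. i < k \<and> 0 < w i}"
proof -
  define \<tau> where "\<tau> = (\<lambda>i. image_norm_sq d N (Y i))"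
  define m where "m = max_score w \<tau> k"
  have w': "w' i = w i * (1 - \<tau> i / m)" for i
    using uncert by (simp add: w'_def filter_step_def Let_def N_def \<tau>_def m_def)
  have "0 \<le> r\<^sup>2 * real k / 400 * frob_inner d N N" by simp
  also have "\<dots> < (\<Sum>i<k. w i * \<tau> i)"
    using uncertified_score_sum[OF assms(3,4), of w d Y] w uncert by (simp add: N_def \<tau>_def)
  finally have "\<exists>i<k. 0 < w i * \<tau> i"
    by (metis (no_types, lifting) lessThan_iff not_less sum_nonpos)
  then obtain i where i: "i < k" "0 < w i * \<tau> i" by blast
  moreover have "0 \<le> \<tau> i" by (simp add: \<tau>_def)
  ultimately have "0 < w i" "0 < \<tau> i" by (auto simp: zero_less_mult_iff)
  then have m: "0 < m" using max_score_ge[of i k w \<tau>] i by (simp add: m_def)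
  then show "\<exists>m>0. \<forall>i. w' i = w i - w i * image_norm_sq d N (Y i) / m"
    by (intro exI[of _ m]) (simp add: w' \<tau>_def right_diff_distrib)
  obtain j where j: "j < k" "0 < w j" "\<tau> j = m"
    using max_score_attained m unfolding m_def by metis
  have "w' j = 0" using j m by (simp add: w')
  moreover have "w' i \<le> w i" if "i < k" for i
    using filter_step_bounds[where w = w, OF w that] by (simp add: w'_def)
  then have "{i. i < k \<and> 0 < w' i} \<subseteq> {i. i < k \<and> 0 < w i}" by (auto intro: less_le_trans)
  ultimately have "{i. i < k \<and> 0 < w' i} \<subset> {i. i < k \<and> 0 < w i}"
    using j(1,2) by (metis (mono_tags, lifting) less_irrefl mem_Collect_eq psubsetI)
  then show "card {i. i < k \<and> 0 < w' i} < card {i. i < k \<and> 0 < w i}"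
    by (intro psubset_card_mono) auto
qed

text \<open>
  Let \<open>v\<close> be the core weights.  In an uncertified round the weighted score sum is at least
  \<open>(r\<^sup>2 k / 400) |N|\<^sup>2\<close>, while the scores weighted by \<open>v\<close> sum to at most \<open>(r\<^sup>2 k / 800) |N|\<^sup>2\<close>.  As the removed weight is
  proportional to the score, at most half of it is taken from the core.  So the total removed weight
  \<open>R\<close> satisfies \<open>R \<le> R / 2 + \<Sum>\<^sub>i (1 - v\<^sub>i)\<close>.
\<close>

lemma spread_imp_accepts:
  assumes k: "1 \<le> k" and r: "0 < r" and p: "1 / 100 \<le> p"
    and spread: "spread k d Y (r\<^sup>2 / 1600) (real k / 400)"
  shows "accepts k d r p Y"
proof -
  obtain v where v0: "\<And>i. i < k \<Longrightarrow> 0 \<le> v i" and v1: "\<And>i. i < k \<Longrightarrow> v i \<le> 1"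
    and v_sum: "(\<Sum>i<k. 1 - v i) \<le> real k / 400"
    and v_core: "\<And>N. (\<Sum>i<k. v i * image_norm_sq d N (Y i)) \<le> 2 * real k * (r\<^sup>2 / 1600) * frob_inner d N N"
    using exists_core_weights[OF _ spread] by auto
  define w where "w = filter_weights k d r Y"
  define N where "N t = filter_mat k d r Y (w t)" for t
  have w_Suc: "w (Suc t) = filter_step k d r Y (w t)" for t
    by (simp add: w_def filter_weights_def)
  have w: "0 \<le> w t i \<and> w t i \<le> 1" if "i < k" for t i
    using filter_weights_bounds that by (auto simp: w_def)
  have stable: "w (Suc t) = w t" if "frob_inner d (N t) (N t) \<le> 1" for t
    using that by (simp add: w_Suc filter_step_def Let_def N_def)
  \<comment> \<open>As long as no round is certified, every round leaves fewer positive weights.\<close>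
  have progress: "frob_inner d (N t) (N t) \<le> 1 \<or> card {i. i < k \<and> 0 < w t i} + t \<le> k" for t
  proof (induction t)
    case 0
    have "card {i. i < k \<and> 0 < w 0 i} \<le> card {..<k}" by (intro card_mono) auto
    then show ?case by simp
  next
    case (Suc t)
    show ?case
    proof (cases "frob_inner d (N t) (N t) \<le> 1")
      case True
      then show ?thesis using stable[OF True] by (simp add: N_def)
    next
      case False
      then have "card {i. i < k \<and> 0 < w (Suc t) i} < card {i. i < k \<and> 0 < w t i}"
        unfolding w_Suc N_def by (intro uncertified_step(2)[where w = "w t", OF k r w]) auto
      then show ?thesis using Suc False by simp
    qed
  qed
  have certified: "frob_inner d (N k) (N k) \<le> 1"
  proof (rule ccontr)
    assume uncert: "\<not> ?thesis"
    then have "card {i. i < k \<and> 0 < w k i} = 0" using progress[of k] by simp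
    moreover have "card {i. i < k \<and> 0 < w (Suc k) i} < card {i. i < k \<and> 0 < w k i}"
      using uncert unfolding w_Suc N_def by (intro uncertified_step(2)[where w = "w k", OF k r w]) auto
    ultimately show False by linarith
  qed
  \<comment> \<open>At most half of the removed weight comes from the core.\<close>
  have invar: "2 * (\<Sum>i<k. v i * (1 - w t i)) \<le> (\<Sum>i<k. 1 - w t i)" for t
  proof (induction t)
    case 0
    then show ?case by (simp add: w_def filter_weights_def)
  next
    case (Suc t)
    show ?case
    proof (cases "frob_inner d (N t) (N t) \<le> 1")
      case True
      then show ?thesis using Suc stable[OF True] by simp
    next
      case False
      then have uncert: "1 < frob_inner d (N t) (N t)" by simp
      define \<tau> where "\<tau> = (\<lambda>i. image_norm_sq d (N t) (Y i))"
      obtain m where m: "0 < m" "\<And>i. w (Suc t) i = w t i - w t i * \<tau> i / m"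
        using uncertified_step(1)[where w = "w t", OF k r w uncert[unfolded N_def]]
        unfolding w_Suc N_def \<tau>_def by blast
      have "2 * (\<Sum>i<k. v i * (w t i * \<tau> i)) \<le> 2 * (\<Sum>i<k. v i * \<tau> i)"
        using w v0 by (intro mult_left_mono sum_mono) (auto simp: \<tau>_def intro!: mult_left_mono mult_left_le_one_le)
      also have "\<dots> \<le> r\<^sup>2 * real k / 400 * frob_inner d (N t) (N t)"
        using v_core[of "N t"] by (simp add: \<tau>_def mult_ac)
      also have "\<dots> \<le> (\<Sum>i<k. w t i * \<tau> i)"
        using uncertified_score_sum[where w = "w t", OF k r _ uncert[unfolded N_def]] w by (simp add: N_def \<tau>_def less_imp_le)
      finally have "2 * (\<Sum>i<k. v i * (w t i * \<tau> i)) / m \<le> (\<Sum>i<k. w t i * \<tau> i) / m"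
        using m(1) by (intro divide_right_mono) auto
      then have "2 * (\<Sum>i<k. v i * (w t i * \<tau> i / m)) \<le> (\<Sum>i<k. w t i * \<tau> i / m)"
        by (simp add: sum_divide_distrib[symmetric])
      moreover have "(\<Sum>i<k. v i * (1 - w (Suc t) i)) = (\<Sum>i<k. v i * (1 - w t i)) + (\<Sum>i<k. v i * (w t i * \<tau> i / m))"
        unfolding m(2) sum.distrib[symmetric] by (intro sum.cong) (auto simp: algebra_simps)
      moreover have "(\<Sum>i<k. 1 - w (Suc t) i) = (\<Sum>i<k. 1 - w t i) + (\<Sum>i<k. w t i * \<tau> i / m)"
        unfolding m(2) sum.distrib[symmetric] by (intro sum.cong) auto
      ultimately show ?thesis using Suc by simp
    qed
  qed
  have "(\<Sum>i<k. 1 - w k i) = (\<Sum>i<k. v i * (1 - w k i)) + (\<Sum>i<k. (1 - v i) * (1 - w k i))"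
    unfolding sum.distrib[symmetric] by (intro sum.cong) (auto simp: algebra_simps)
  also have "(\<Sum>i<k. (1 - v i) * (1 - w k i)) \<le> (\<Sum>i<k. 1 - v i)"
    using w v0 v1 by (intro sum_mono mult_left_le) auto
  finally have "(\<Sum>i<k. 1 - w k i) \<le> real k / 200" using invar[of k] v_sum by simp
  then show ?thesis using certified p by (simp add: accepts_def Let_def w_def N_def)
qed

section \<open>From spread violations to combinatorial patterns\<close>

text \<open>
  For a sum \<open>x + S\<close> with \<open>S\<close> a Rademacher sum of variance \<open>V\<close>, this is a lower bound of the expectation
  of \<open>p ((x + S)\<^sup>2 / v)\<close> with \<open>p z = z / 3 - z\<^sup>2 / 36 - 1 / 6\<close>; it uses that \<open>3 V\<^sup>2\<close> bounds the
  fourth moment of \<open>S\<close>.  The polynomial \<open>p\<close> lies below the indicator of \<open>z \<ge> 1 / 2\<close> for \<open>z \<ge> 0\<close>, and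
  the value for \<open>x = 0\<close> and \<open>V = v\<close> is \<open>1 / 12\<close>: a Paley--Zygmund inequality in the form of a
  potential function.
\<close>

definition small_ball :: "real \<Rightarrow> real \<Rightarrow> real \<Rightarrow> real" where
  "small_ball v x V = (x\<^sup>2 + V) / (3 * v) - (x ^ 4 + 6 * x\<^sup>2 * V + 3 * V\<^sup>2) / (36 * v\<^sup>2) - 1 / 6"

text \<open>
  Fixing one more sign does not decrease the potential on average, so a good sign can be picked greedily.
\<close>

lemma small_ball_split:
  assumes "0 < v"
  shows "2 * small_ball v x V \<le> small_ball v (x + y) (V - y\<^sup>2) + small_ball v (x - y) (V - y\<^sup>2)"
proof -
  have "(x + y) ^ 4 + 6 * (x + y)\<^sup>2 * (V - y\<^sup>2) + 3 * (V - y\<^sup>2)\<^sup>2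
      + ((x - y) ^ 4 + 6 * (x - y)\<^sup>2 * (V - y\<^sup>2) + 3 * (V - y\<^sup>2)\<^sup>2)
      = 2 * (x ^ 4 + 6 * x\<^sup>2 * V + 3 * V\<^sup>2) - 4 * y ^ 4"
    by algebra
  moreover have "0 \<le> y ^ 4" by simp
  ultimately have "((x + y) ^ 4 + 6 * (x + y)\<^sup>2 * (V - y\<^sup>2) + 3 * (V - y\<^sup>2)\<^sup>2) / (36 * v\<^sup>2)
      + ((x - y) ^ 4 + 6 * (x - y)\<^sup>2 * (V - y\<^sup>2) + 3 * (V - y\<^sup>2)\<^sup>2) / (36 * v\<^sup>2)
      \<le> 2 * ((x ^ 4 + 6 * x\<^sup>2 * V + 3 * V\<^sup>2) / (36 * v\<^sup>2))"
    unfolding add_divide_distrib[symmetric] times_divide_eq_right by (intro divide_right_mono) auto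
  moreover have "((x + y)\<^sup>2 + (V - y\<^sup>2)) / (3 * v) + ((x - y)\<^sup>2 + (V - y\<^sup>2)) / (3 * v)
      = 2 * ((x\<^sup>2 + V) / (3 * v))"
    unfolding add_divide_distrib[symmetric] times_divide_eq_right
    by (rule arg_cong[where f = "\<lambda>z. z / (3 * v)"]) algebra
  moreover have "2 * (F - C - 1 / 6) \<le> D - A - 1 / 6 + (E - B - 1 / 6)"
    if "A + B \<le> 2 * C" "D + E = 2 * F" for A B C D E F :: real
    using that by force
  ultimately show ?thesis unfolding small_ball_def by blast
qed

lemma small_ball_le_indicator:
  assumes "0 < v"
  shows "small_ball v x 0 \<le> (if v \<le> 2 * x\<^sup>2 then 1 else 0)"
proof -
  define z where "z = x\<^sup>2 / v"
  have x: "x\<^sup>2 = z * v" using assms by (simp add: z_def)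
  then have x4: "x ^ 4 = z\<^sup>2 * v\<^sup>2"
    by (metis (no_types, opaque_lifting) numeral_Bit0 power_add power2_eq_square power_mult_distrib)
  have eq: "small_ball v x 0 = z / 3 - z\<^sup>2 / 36 - 1 / 6"
    using assms by (simp add: small_ball_def x x4)
  show ?thesis
  proof (cases "v \<le> 2 * x\<^sup>2")
    case True
    have "0 \<le> (z - 6)\<^sup>2" by simp
    then show ?thesis using True by (simp add: eq power2_eq_square algebra_simps)
  next
    case False
    then have "z < 1 / 2" using assms by (simp add: z_def field_simps)
    moreover have "0 \<le> z\<^sup>2" by simp
    ultimately have "z / 3 - z\<^sup>2 / 36 - 1 / 6 \<le> 0" by linarith
    then show ?thesis using False by (simp add: eq)
  qed
qed

lemma inner_prod_add_left: "inner_prod d (\<lambda>j. u j + v j) w = inner_prod d u w + inner_prod d v w"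
  by (simp add: inner_prod_def sum.distrib algebra_simps)

lemma inner_prod_diff_left: "inner_prod d (\<lambda>j. u j - v j) w = inner_prod d u w - inner_prod d v w"
  by (simp add: inner_prod_def sum_subtractf algebra_simps)

lemma inner_prod_scale_left: "inner_prod d (\<lambda>j. c * u j) w = c * inner_prod d u w"
  by (simp add: inner_prod_def sum_distrib_left algebra_simps)

lemma inner_prod_parallelogram:
  "inner_prod d (\<lambda>j. u j + v j) (\<lambda>j. u j + v j) + inner_prod d (\<lambda>j. u j - v j) (\<lambda>j. u j - v j)
     = 2 * (inner_prod d u u + inner_prod d v v)"
  unfolding inner_prod_def sum_distrib_left sum.distrib[symmetric]
  by (intro sum.cong) (auto simp: algebra_simps)

text \<open>
  A signed sum \<open>g\<close> of the rows of \<open>N\<close> has \<open>\<langle>g, y\<rangle>\<^sup>2\<close> equal to \<open>|N y|\<^sup>2\<close> and \<open>|g|\<^sup>2\<close> equal to \<open>|N|\<^sup>2\<close> on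
  average over the signs.  The signs are fixed one after the other by the method of conditional
  expectations, for a potential that rewards the points with \<open>\<langle>g, y\<rangle>\<^sup>2\<close> at least half its mean and
  penalises the length of \<open>g\<close>.
\<close>

lemma sign_rounding:
  assumes fin: "finite I" and pos: "\<And>i. i \<in> I \<Longrightarrow> 0 < image_norm_sq d N (y i)" and F: "0 < frob_inner d N N"
  obtains g where "real (card I) * (1 + inner_prod d g g / frob_inner d N N)
    \<le> 24 * real (card {i \<in> I. image_norm_sq d N (y i) \<le> 2 * (inner_prod d g (y i))\<^sup>2})"
proof -
  define c where "c = real (card I) / (24 * frob_inner d N N)"
  have "0 \<le> c" using F by (simp add: c_def)
  define v where "v i = image_norm_sq d N (y i)" for i
  \<comment> \<open>Variances and squared length contributed by the rows whose sign is still open.\<close>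
  define V where "V m i = v i - (\<Sum>a<m. (inner_prod d (N a) (y i))\<^sup>2)" for m i
  define L where "L m = frob_inner d N N - (\<Sum>a<m. inner_prod d (N a) (N a))" for m
  define \<Phi> where "\<Phi> m g = (\<Sum>i\<in>I. small_ball (v i) (inner_prod d g (y i)) (V m i)) - c * (inner_prod d g g + L m)"
    for m g
  have "\<exists>g. \<Phi> 0 (\<lambda>_. 0) \<le> \<Phi> m g" for m
  proof (induction m)
    case 0
    show ?case by blast
  next
    case (Suc m)
    then obtain g where g: "\<Phi> 0 (\<lambda>_. 0) \<le> \<Phi> m g" by blast
    define p q where "p = (\<lambda>j. g j + N m j)" and "q = (\<lambda>j. g j - N m j)"
    have "2 * (\<Sum>i\<in>I. small_ball (v i) (inner_prod d g (y i)) (V m i))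
        \<le> (\<Sum>i\<in>I. small_ball (v i) (inner_prod d p (y i)) (V (Suc m) i))
          + (\<Sum>i\<in>I. small_ball (v i) (inner_prod d q (y i)) (V (Suc m) i))"
      unfolding sum_distrib_left sum.distrib[symmetric]
    proof (rule sum_mono)
      fix i assume "i \<in> I"
      moreover have "V (Suc m) i = V m i - (inner_prod d (N m) (y i))\<^sup>2" by (simp add: V_def)
      ultimately show "2 * small_ball (v i) (inner_prod d g (y i)) (V m i)
          \<le> small_ball (v i) (inner_prod d p (y i)) (V (Suc m) i)
            + small_ball (v i) (inner_prod d q (y i)) (V (Suc m) i)"
        using pos small_ball_split by (simp add: p_def q_def v_def inner_prod_add_left inner_prod_diff_left)
    qed
    moreover have "inner_prod d p p + inner_prod d q q = 2 * (inner_prod d g g + inner_prod d (N m) (N m))"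
      unfolding p_def q_def by (rule inner_prod_parallelogram)
    then have "(inner_prod d p p + L (Suc m)) + (inner_prod d q q + L (Suc m)) = 2 * (inner_prod d g g + L m)"
      by (simp add: L_def)
    then have "c * (inner_prod d p p + L (Suc m)) + c * (inner_prod d q q + L (Suc m)) = 2 * (c * (inner_prod d g g + L m))"
      unfolding distrib_left[symmetric] by simp
    moreover have "2 * (F - C) \<le> D - A + (E - B)"
      if "2 * F \<le> D + E" "A + B = 2 * C" for A B C D E F :: real
      using that by force
    ultimately have "2 * \<Phi> m g \<le> \<Phi> (Suc m) p + \<Phi> (Suc m) q"
      unfolding \<Phi>_def by blast
    then have "\<Phi> m g \<le> \<Phi> (Suc m) p \<or> \<Phi> m g \<le> \<Phi> (Suc m) q" by linarith
    then show ?case using g by (meson order_trans)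
  qed
  then obtain g where g: "\<Phi> 0 (\<lambda>_. 0) \<le> \<Phi> d g" by blast
  define B where "B = {i \<in> I. v i \<le> 2 * (inner_prod d g (y i))\<^sup>2}"
  have "small_ball (v i) (inner_prod d (\<lambda>_. 0) (y i)) (V 0 i) = 1 / 12" if "i \<in> I" for i
    using pos[OF that] by (simp add: small_ball_def V_def v_def inner_prod_def power2_eq_square)
  then have "(\<Sum>i\<in>I. small_ball (v i) (inner_prod d (\<lambda>_. 0) (y i)) (V 0 i)) = (\<Sum>i\<in>I. 1 / 12)"
    by (rule sum.cong[OF refl])
  then have "\<Phi> 0 (\<lambda>_. 0) = real (card I) / 12 - c * frob_inner d N N"
    unfolding \<Phi>_def by (simp add: L_def inner_prod_def[of d "\<lambda>_. 0" "\<lambda>_. 0"])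
  also have "\<dots> = real (card I) / 24" using F by (simp add: c_def)
  finally have "real (card I) / 24 \<le> \<Phi> d g" using g by simp
  also have "L d = 0" by (simp add: L_def frob_inner_def inner_prod_def)
  then have "\<Phi> d g = (\<Sum>i\<in>I. small_ball (v i) (inner_prod d g (y i)) 0) - c * inner_prod d g g"
    by (simp add: \<Phi>_def V_def v_def image_norm_sq_def)
  also have "(\<Sum>i\<in>I. small_ball (v i) (inner_prod d g (y i)) 0)
      \<le> (\<Sum>i\<in>I. if v i \<le> 2 * (inner_prod d g (y i))\<^sup>2 then 1 else 0)"
    using pos by (intro sum_mono small_ball_le_indicator) (simp add: v_def)
  also have "\<dots> = real (card B)"
    using fin by (simp add: B_def sum.If_cases Int_def)
  finally have "real (card I) / 24 + c * inner_prod d g g \<le> real (card B)" by simp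
  moreover have "c * inner_prod d g g = real (card I) / 24 * (inner_prod d g g / frob_inner d N N)"
    by (simp add: c_def)
  moreover have "n * (1 + t) \<le> 24 * m" if "n / 24 + s \<le> m" "s = n / 24 * t" for n m s t :: real
    using that by (simp add: distrib_left)
  ultimately have "real (card I) * (1 + inner_prod d g g / frob_inner d N N) \<le> 24 * real (card B)"
    by blast
  then show ?thesis using that by (simp add: B_def v_def)
qed

text \<open>
  Rounding replaces the density matrix by a single direction; it costs the factor 24 in the number of
  points and 48 in the threshold.
\<close>

lemma not_spread_direction:
  assumes "0 < b" "0 \<le> e" "\<not> spread k d Y b e"
  obtains g where "e < 24 * real (card {i. i < k \<and> b / 48 * inner_prod d g g < (inner_prod d g (Y i))\<^sup>2})"
proof -
  obtain N where N: "e < real (card (heavy_points k d Y b N))"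
    using assms(3) by (auto simp: spread_def not_le)
  define I where "I = heavy_points k d Y b N"
  have fin: "finite I"
    by (rule finite_subset[of _ "{..<k}"]) (auto simp: I_def heavy_points_def)
  have heavy: "b * frob_inner d N N < image_norm_sq d N (Y i)" if "i \<in> I" for i
    using that by (simp add: I_def heavy_points_def)
  have card: "0 < card I" using N assms(2) by (simp add: I_def)
  then obtain i0 where "i0 \<in> I" by fastforce
  have F: "0 < frob_inner d N N"
  proof (rule ccontr)
    assume "\<not> ?thesis"
    then have "frob_inner d N N = 0" using frob_nonneg[of d N] by linarith
    then show False using heavy[OF \<open>i0 \<in> I\<close>] image_norm_sq_le_frob[of d N "Y i0"] by simp
  qed
  have pos: "0 < image_norm_sq d N (Y i)" if "i \<in> I" for i
    using heavy[OF that] F assms(1) by (smt (verit) mult_pos_pos)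
  obtain g where g: "real (card I) * (1 + inner_prod d g g / frob_inner d N N)
    \<le> 24 * real (card {i \<in> I. image_norm_sq d N (Y i) \<le> 2 * (inner_prod d g (Y i))\<^sup>2})"
    using sign_rounding[where y = Y, OF fin pos F] by blast
  define B where "B = {i \<in> I. image_norm_sq d N (Y i) \<le> 2 * (inner_prod d g (Y i))\<^sup>2}"
  have "card B \<le> card I" using fin by (intro card_mono) (auto simp: B_def)
  then have "real (card I) * (1 + inner_prod d g g / frob_inner d N N) \<le> real (card I) * 24"
    using g by (simp add: B_def[symmetric])
  then have "inner_prod d g g / frob_inner d N N \<le> 24" using card by simp
  then have gg: "inner_prod d g g \<le> 24 * frob_inner d N N" using F by (simp add: divide_le_eq)
  have "real (card I) * 1 \<le> real (card I) * (1 + inner_prod d g g / frob_inner d N N)"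
    using F by (intro mult_left_mono) auto
  then have "real (card I) \<le> 24 * real (card B)" using g by (simp add: B_def)
  moreover have "card B \<le> card {i. i < k \<and> b / 48 * inner_prod d g g < (inner_prod d g (Y i))\<^sup>2}"
  proof (intro card_mono subsetI)
    fix i assume i: "i \<in> B"
    have "b * inner_prod d g g \<le> b * (24 * frob_inner d N N)" using gg assms(1) by (intro mult_left_mono) auto
    also have "\<dots> < 24 * (2 * (inner_prod d g (Y i))\<^sup>2)"
      using heavy[of i] i by (simp add: B_def)
    finally show "i \<in> {i. i < k \<and> b / 48 * inner_prod d g g < (inner_prod d g (Y i))\<^sup>2}"
      using i by (simp add: B_def I_def heavy_points_def)
  qed simp
  ultimately show ?thesis using that[of g] N by (simp add: I_def)
qed

text \<open>
  A pattern assigns to every index one of four codes: 0 for an index to be tested, 1 and 2 for a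
  mistake of the perceptron on a positive or negative example, 3 for an index that is ignored.
\<close>

definition pat_sign :: "nat \<Rightarrow> real" where
  "pat_sign c = (if c = 1 then 1 else if c = 2 then - 1 else 0)"

definition pattern_vec :: "(nat \<Rightarrow> nat) \<Rightarrow> (nat \<Rightarrow> nat \<Rightarrow> real) \<Rightarrow> nat \<Rightarrow> nat \<Rightarrow> real" where
  "pattern_vec f y n = (\<lambda>c. \<Sum>j<n. pat_sign (f j) * y j c)"

text \<open>
  Both alternatives are rare for a random \<open>y\<close> with mean 0 when \<open>w\<close> is fixed.  For \<open>w = 0\<close> the second
  one is impossible, because the inequality is strict.
\<close>

definition hit :: "nat \<Rightarrow> real \<Rightarrow> real \<Rightarrow> (nat \<Rightarrow> real) \<Rightarrow> (nat \<Rightarrow> real) \<Rightarrow> bool" where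
  "hit d L h w y \<longleftrightarrow> L < inner_prod d y y \<or> h * inner_prod d w w < (inner_prod d w y)\<^sup>2"

lemma pattern_vec_Suc: "pattern_vec f y (Suc n) = (\<lambda>c. pattern_vec f y n c + pat_sign (f n) * y n c)"
  by (simp add: pattern_vec_def)

text \<open>
  The points along \<open>u\<close>, labelled by the sign of \<open>\<langle>u, Y\<^sub>i\<rangle>\<close>, are processed once by a perceptron \<open>w\<close> that is
  updated when the signed product \<open>\<langle>w, Y\<^sub>i\<rangle>\<close> is at most \<open>L / 2\<close>; points longer than \<open>\<surd>L\<close> are skipped,
  as they are hits anyway.  After \<open>m\<close> mistakes \<open>\<langle>w, u\<rangle> \<ge> m \<surd>\<alpha> |u|\<close> and \<open>|w|\<^sup>2 \<le> 2 m L\<close>, so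
  \<open>m \<le> 2 L / \<alpha>\<close>.  On a point without mistake the product exceeds \<open>L / 2\<close>, which is at least
  \<open>(\<surd>\<alpha> / 4) |w|\<close>.  Since \<open>w\<close> is a signed sum of earlier mistakes, the codes determine it from points
  that are not tested.
\<close>

lemma perceptron_pattern:
  assumes \<alpha>: "0 < \<alpha>" and L: "0 < L"
    and I: "I \<subseteq> {i. i < k \<and> \<alpha> * inner_prod d u u < (inner_prod d u (y i))\<^sup>2}"
  obtains f where "f \<in> {..<k} \<rightarrow>\<^sub>E {..<4}"
    "\<And>i. i < k \<Longrightarrow> f i = 0 \<Longrightarrow> hit d L (\<alpha> / 16) (pattern_vec f y i) (y i)"
    "real (card I) - 2 * L / \<alpha> \<le> real (card {i. i < k \<and> f i = 0})"
proof (cases "I = {}")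
  case True
  define f where "f = (\<lambda>i\<in>{..<k}. 3 :: nat)"
  show ?thesis
  proof (rule that[of f])
    show "f \<in> {..<k} \<rightarrow>\<^sub>E {..<4}" by (simp add: f_def)
    show "hit d L (\<alpha> / 16) (pattern_vec f y i) (y i)" if "i < k" "f i = 0" for i
      using that by (simp add: f_def)
    have "0 \<le> L / \<alpha>" using \<alpha> L by simp
    then show "real (card I) - 2 * L / \<alpha> \<le> real (card {i. i < k \<and> f i = 0})"
      using True by simp
  qed
next
  case False
  then obtain i0 where "i0 \<in> I" by blast
  define U where "U = inner_prod d u u"
  have U: "0 < U"
  proof (rule ccontr)
    assume "\<not> ?thesis"
    then have "U = 0" using inner_prod_self_nonneg[of d u] by (simp add: U_def)
    then show False using I \<open>i0 \<in> I\<close> inner_prod_Cauchy_Schwarz[of d u "y i0"] by (auto simp: U_def)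
  qed
  define s where "s i = (if 0 \<le> inner_prod d u (y i) then 1 else - 1 :: real)" for i
  have s2: "s i * s i = 1" for i by (simp add: s_def)
  have margin: "sqrt (\<alpha> * U) \<le> s i * inner_prod d u (y i)" if "i \<in> I" for i
  proof -
    have "s i * inner_prod d u (y i) = \<bar>inner_prod d u (y i)\<bar>" by (simp add: s_def)
    moreover have "sqrt (\<alpha> * U) \<le> sqrt ((inner_prod d u (y i))\<^sup>2)"
      using I that by (intro real_sqrt_le_mono) (auto simp: U_def)
    ultimately show ?thesis by simp
  qed
  \<comment> \<open>The threshold \<open>L / 2\<close> balances the two terms in the growth of \<open>|w|\<^sup>2\<close> per mistake.\<close>
  define mistake where
    "mistake i w \<longleftrightarrow> i \<in> I \<and> inner_prod d (y i) (y i) \<le> L \<and> s i * inner_prod d w (y i) \<le> L / 2" for i w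
  define w where "w = rec_nat (\<lambda>_. 0) (\<lambda>i w. if mistake i w then (\<lambda>c. w c + s i * y i c) else w)"
  have w0: "w 0 = (\<lambda>_. 0)" and wS: "w (Suc i) = (if mistake i (w i) then (\<lambda>c. w i c + s i * y i c) else w i)" for i
    by (simp_all add: w_def)
  define f where "f = (\<lambda>i\<in>{..<k}. if mistake i (w i) then (if s i = 1 then 1 else 2) else if i \<in> I then 0 else 3 :: nat)"
  have w_pat: "n \<le> k \<Longrightarrow> w n = pattern_vec f y n" for n
  proof (induction n)
    case 0
    then show ?case by (simp add: w0 pattern_vec_def)
  next
    case (Suc n)
    have "pat_sign (f n) = (if mistake n (w n) then s n else 0)"
      using Suc.prems by (simp add: f_def pat_sign_def s_def)
    then show ?case using Suc by (auto simp: wS pattern_vec_Suc)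
  qed
  define M where "M n = {i. i < n \<and> mistake i (w i)}" for n
  have M_Suc: "M (Suc n) = (if mistake n (w n) then insert n (M n) else M n)" for n
    by (auto simp: M_def less_Suc_eq)
  have M_card: "card (M (Suc n)) = (if mistake n (w n) then Suc (card (M n)) else card (M n))" for n
    unfolding M_Suc by (auto simp: M_def)
  have progress: "real (card (M n)) * sqrt (\<alpha> * U) \<le> inner_prod d (w n) u" for n
  proof (induction n)
    case 0
    then show ?case by (simp add: M_def w0 inner_prod_def)
  next
    case (Suc n)
    show ?case
    proof (cases "mistake n (w n)")
      case True
      then have "sqrt (\<alpha> * U) \<le> s n * inner_prod d u (y n)" using margin by (simp add: mistake_def)
      then show ?thesis using Suc True
        by (simp add: M_card wS inner_prod_add_left inner_prod_scale_left inner_prod_commute[of d "y n" u] distrib_right)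
    qed (use Suc in \<open>simp add: M_card wS\<close>)
  qed
  have norm: "inner_prod d (w n) (w n) \<le> 2 * real (card (M n)) * L" for n
  proof (induction n)
    case 0
    then show ?case by (simp add: M_def w0 inner_prod_def)
  next
    case (Suc n)
    show ?case
    proof (cases "mistake n (w n)")
      case True
      have "inner_prod d (w (Suc n)) (w (Suc n))
          = inner_prod d (w n) (w n) + 2 * (s n * inner_prod d (w n) (y n)) + s n * s n * inner_prod d (y n) (y n)"
        unfolding wS using True
        by (simp add: inner_prod_def sum.distrib sum_distrib_left algebra_simps)
      also have "\<dots> \<le> inner_prod d (w n) (w n) + 2 * (L / 2) + L"
        using True by (simp add: s2 mistake_def)
      finally show ?thesis using Suc True by (simp add: M_card algebra_simps)
    qed (use Suc in \<open>simp add: M_card wS\<close>)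
  qed
  have mistakes: "real (card (M n)) \<le> 2 * L / \<alpha>" for n
  proof (cases "card (M n) = 0")
    case True
    then show ?thesis using \<alpha> L by simp
  next
    case False
    define m where "m = real (card (M n))"
    have m: "0 < m" using False by (simp add: m_def)
    have "(m * sqrt (\<alpha> * U))\<^sup>2 \<le> (inner_prod d (w n) u)\<^sup>2"
      using progress[of n] m \<alpha> U by (intro power_mono) (auto simp: m_def)
    also have "\<dots> \<le> inner_prod d (w n) (w n) * U"
      using inner_prod_Cauchy_Schwarz by (simp add: U_def)
    also have "\<dots> \<le> 2 * m * L * U" using norm[of n] U by (simp add: m_def)
    finally have "m * U * (m * \<alpha>) \<le> m * U * (2 * L)"
      using \<alpha> U by (simp add: power_mult_distrib power2_eq_square algebra_simps)
    then have "m * \<alpha> \<le> 2 * L" using m U by simp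
    then show ?thesis using \<alpha> by (simp add: m_def le_divide_eq)
  qed
  show ?thesis
  proof (rule that[of f])
    show "f \<in> {..<k} \<rightarrow>\<^sub>E {..<4}" by (auto simp: f_def)
    show "hit d L (\<alpha> / 16) (pattern_vec f y i) (y i)" if i: "i < k" "f i = 0" for i
    proof (cases "inner_prod d (y i) (y i) \<le> L")
      case True
      from i have "i \<in> I" "\<not> mistake i (w i)" by (auto simp: f_def split: if_splits)
      with True have big: "L / 2 < s i * inner_prod d (w i) (y i)" by (simp add: mistake_def)
      have "\<alpha> / 16 * inner_prod d (w i) (w i) \<le> \<alpha> / 16 * (2 * (2 * L / \<alpha>) * L)"
        using \<alpha> L norm[of i] mistakes[of i]
        by (intro mult_left_mono order_trans[OF norm] mult_right_mono) auto
      also have "\<dots> = (L / 2)\<^sup>2" using \<alpha> by (simp add: power2_eq_square)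
      also have "\<dots> < (s i * inner_prod d (w i) (y i))\<^sup>2"
        using big L by (intro power_strict_mono) auto
      also have "\<dots> = (inner_prod d (w i) (y i))\<^sup>2"
        by (simp add: s_def)
      finally show ?thesis using i by (simp add: hit_def w_pat)
    qed (simp add: hit_def)
    have "I \<subseteq> {i. i < k \<and> f i = 0} \<union> M k"
      using I by (auto simp: f_def M_def)
    then have "card I \<le> card ({i. i < k \<and> f i = 0} \<union> M k)"
      by (intro card_mono) (auto simp: M_def)
    also have "\<dots> \<le> card {i. i < k \<and> f i = 0} + card (M k)" by (rule card_Un_le)
    finally show "real (card I) - 2 * L / \<alpha> \<le> real (card {i. i < k \<and> f i = 0})"
      using mistakes[of k] by linarith
  qed
qed

lemma not_spread_pattern:
  assumes "0 < b" "0 \<le> e" "0 < L" "\<not> spread k d Y b e"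
  obtains f where "f \<in> {..<k} \<rightarrow>\<^sub>E {..<4}"
    "\<And>i. i < k \<Longrightarrow> f i = 0 \<Longrightarrow> hit d L (b / 768) (pattern_vec f Y i) (Y i)"
    "e / 24 - 96 * L / b \<le> real (card {i. i < k \<and> f i = 0})"
proof -
  obtain g where g: "e < 24 * real (card {i. i < k \<and> b / 48 * inner_prod d g g < (inner_prod d g (Y i))\<^sup>2})"
    (is "_ < 24 * real (card ?I)")
    using not_spread_direction[OF assms(1,2,4)] by blast
  obtain f where "f \<in> {..<k} \<rightarrow>\<^sub>E {..<4}"
    "\<And>i. i < k \<Longrightarrow> f i = 0 \<Longrightarrow> hit d L (b / 48 / 16) (pattern_vec f Y i) (Y i)"
    "real (card ?I) - 2 * L / (b / 48) \<le> real (card {i. i < k \<and> f i = 0})"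
    using perceptron_pattern[of "b / 48" L ?I k d g Y] assms by auto
  with g show ?thesis by (intro that[of f]) auto
qed

section \<open>Moments and conditional independence\<close>

definition centered :: "(nat \<Rightarrow> real) measure \<Rightarrow> (nat \<Rightarrow> real) \<Rightarrow> nat \<Rightarrow> real" where
  "centered D z = (\<lambda>j. z j - mean D j)"

lemma law_prob_space: "random_vector_law d D \<Longrightarrow> prob_space D"
  by (simp add: random_vector_law_def)

lemma law_coordinate_measurable:
  assumes "random_vector_law d D" "j < d"
  shows "(\<lambda>z. z j) \<in> borel_measurable D"
proof -
  have "(\<lambda>z. z j) \<in> borel_measurable (\<Pi>\<^sub>M j\<in>{..<d}. (borel :: real measure))"
    using assms(2) by (intro measurable_component_singleton) auto
  moreover have "sets D = sets (\<Pi>\<^sub>M j\<in>{..<d}. (borel :: real measure))"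
    using assms(1) by (simp add: random_vector_law_def)
  ultimately show ?thesis by (simp cong: measurable_cong_sets)
qed

lemma law_centered_product_integrable:
  assumes law: "random_vector_law d D" and "i < d" "j < d"
  shows "integrable D (\<lambda>z. (z i - mean D i) * (z j - mean D j))"
proof -
  interpret prob_space D by (rule law_prob_space[OF law])
  note [measurable] = law_coordinate_measurable[OF law]
  have sq: "integrable D (\<lambda>z. (z l)\<^sup>2)" if "l < d" for l
    using law that by (simp add: random_vector_law_def)
  have int: "integrable D (\<lambda>z. z l)" if "l < d" for l
    using that by (intro square_integrable_imp_integrable[OF _ sq]) auto
  have csq: "integrable D (\<lambda>z. (z l - mean D l)\<^sup>2)" if "l < d" for l
    unfolding power2_diff using sq[OF that] int[OF that] by auto
  have "integrable D (\<lambda>z. (z i - mean D i)\<^sup>2 + (z j - mean D j)\<^sup>2)"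
    using csq assms by auto
  then show ?thesis
  proof (rule Bochner_Integration.integrable_bound)
    show "(\<lambda>z. (z i - mean D i) * (z j - mean D j)) \<in> borel_measurable D"
      using assms by measurable
    have "\<bar>a * b\<bar> \<le> a\<^sup>2 + b\<^sup>2" for a b :: real
    proof -
      have "2 * (\<bar>a\<bar> * \<bar>b\<bar>) \<le> a\<^sup>2 + b\<^sup>2"
        using sum_squares_bound[of "\<bar>a\<bar>" "\<bar>b\<bar>"] by simp
      moreover have "0 \<le> \<bar>a\<bar> * \<bar>b\<bar>" by simp
      ultimately show ?thesis unfolding abs_mult by linarith
    qed
    then show "AE z in D. norm ((z i - mean D i) * (z j - mean D j)) \<le> norm ((z i - mean D i)\<^sup>2 + (z j - mean D j)\<^sup>2)"
      by (auto intro!: AE_I2 order_trans[OF _ abs_ge_self])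
  qed
qed

lemma inner_prod_square_expand:
  "(inner_prod d w y)\<^sup>2 = (\<Sum>i<d. \<Sum>j<d. w i * w j * (y i * y j))"
  unfolding inner_prod_def power2_eq_square sum_product by (simp add: ac_simps)

lemma second_moment_direction:
  assumes law: "random_vector_law d D"
  shows "integrable D (\<lambda>z. (inner_prod d w (centered D z))\<^sup>2)"
    and "(\<integral>z. (inner_prod d w (centered D z))\<^sup>2 \<partial>D) = inner_prod d w (mat_vec d (covariance D) w)"
proof -
  note int = law_centered_product_integrable[OF law]
  show "integrable D (\<lambda>z. (inner_prod d w (centered D z))\<^sup>2)"
    unfolding inner_prod_square_expand centered_def
    by (intro Bochner_Integration.integrable_sum integrable_mult_right int) auto
  have "(\<integral>z. (inner_prod d w (centered D z))\<^sup>2 \<partial>D)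
      = (\<Sum>i<d. \<Sum>j<d. \<integral>z. w i * w j * ((z i - mean D i) * (z j - mean D j)) \<partial>D)"
    unfolding inner_prod_square_expand centered_def
    by (subst Bochner_Integration.integral_sum;
        (intro sum.cong refl Bochner_Integration.integral_sum Bochner_Integration.integrable_sum integrable_mult_right int)?) auto
  also have "\<dots> = (\<Sum>i<d. \<Sum>j<d. w i * w j * covariance D i j)"
    by (simp add: covariance_def)
  finally show "(\<integral>z. (inner_prod d w (centered D z))\<^sup>2 \<partial>D) = inner_prod d w (mat_vec d (covariance D) w)"
    by (simp add: inner_prod_def mat_vec_def sum_distrib_left ac_simps)
qed

lemma second_moment_norm:
  assumes law: "random_vector_law d D"
  shows "integrable D (\<lambda>z. inner_prod d (centered D z) (centered D z))"
    and "(\<integral>z. inner_prod d (centered D z) (centered D z) \<partial>D) = mat_trace d (covariance D)"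
proof -
  note int = law_centered_product_integrable[OF law]
  show "integrable D (\<lambda>z. inner_prod d (centered D z) (centered D z))"
    unfolding inner_prod_def centered_def by (intro Bochner_Integration.integrable_sum int) auto
  show "(\<integral>z. inner_prod d (centered D z) (centered D z) \<partial>D) = mat_trace d (covariance D)"
    unfolding inner_prod_def centered_def mat_trace_def covariance_def
    by (intro Bochner_Integration.integral_sum int) auto
qed

lemma L2_set_eq_inner_prod: "L2_set u {..<d} = sqrt (inner_prod d u u)"
  by (simp add: L2_set_def inner_prod_def power2_eq_square)

lemma op_norm_upper:
  assumes "inner_prod d u u = 1"
  shows "sqrt (image_norm_sq d A u) \<le> op_norm d A"
proof -
  have "sqrt (image_norm_sq d A u) = L2_set (\<lambda>i. inner_prod d (A i) u) {..<d}" for u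
    by (simp add: L2_set_def image_norm_sq_def)
  moreover have "bdd_above ((\<lambda>u. L2_set (\<lambda>i. inner_prod d (A i) u) {..<d}) ` {u. L2_set u {..<d} = 1})"
  proof (rule bdd_aboveI2)
    fix u assume "u \<in> {u. L2_set u {..<d} = 1}"
    then have "inner_prod d u u = 1" by (simp add: L2_set_eq_inner_prod)
    then show "L2_set (\<lambda>i. inner_prod d (A i) u) {..<d} \<le> sqrt (frob_inner d A A)"
      using image_norm_sq_le_frob[of d A u] unfolding L2_set_def image_norm_sq_def by simp
  qed
  ultimately show ?thesis unfolding op_norm_def
    using cSUP_upper[of u "{u. L2_set u {..<d} = 1}" "\<lambda>u. L2_set (\<lambda>i. inner_prod d (A i) u) {..<d}"] assms
    by (simp add: L2_set_eq_inner_prod)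
qed

lemma op_norm_nonneg:
  assumes "1 \<le> d" shows "0 \<le> op_norm d A"
proof -
  define u :: "nat \<Rightarrow> real" where "u = (\<lambda>j. if j = 0 then 1 else 0)"
  have "inner_prod d u u = (\<Sum>j<d. if j = 0 then 1 else 0)"
    unfolding inner_prod_def by (intro sum.cong) (auto simp: u_def)
  also have "\<dots> = 1" using assms by simp
  finally have "sqrt (image_norm_sq d A u) \<le> op_norm d A" by (rule op_norm_upper)
  then show ?thesis using real_sqrt_ge_zero[OF image_norm_sq_nonneg] order_trans by blast
qed

lemma quad_form_le_op_norm:
  "inner_prod d w (mat_vec d A w) \<le> op_norm d A * inner_prod d w w"
proof (cases "inner_prod d w w = 0")
  case True
  then have "(inner_prod d w (mat_vec d A w))\<^sup>2 \<le> 0" using quad_form_sq_le[of d w A] by simp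
  then show ?thesis using True by simp
next
  case False
  define n where "n = sqrt (inner_prod d w w)"
  have n: "0 < n" "n * n = inner_prod d w w"
    using False inner_prod_self_nonneg[of d w] by (auto simp: n_def less_le)
  define u where "u = (\<lambda>j. (1 / n) * w j)"
  have w: "w = (\<lambda>j. n * u j)" using n by (simp add: u_def)
  have "inner_prod d u u = (1 / n) * (1 / n) * inner_prod d w w"
    unfolding u_def inner_prod_scale_left by (subst inner_prod_commute) (simp only: inner_prod_scale_left mult.assoc)
  then have u1: "inner_prod d u u = 1" using n False by simp
  have "(inner_prod d u (mat_vec d A u))\<^sup>2 \<le> image_norm_sq d A u" using quad_form_sq_le[of d u A] u1 by simp
  then have "inner_prod d u (mat_vec d A u) \<le> sqrt (image_norm_sq d A u)"
    by (rule real_le_rsqrt)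
  also have "\<dots> \<le> op_norm d A" using u1 by (rule op_norm_upper)
  finally have "(n * n) * inner_prod d u (mat_vec d A u) \<le> (n * n) * op_norm d A"
    using n by (intro mult_left_mono) auto
  moreover have "inner_prod d w (mat_vec d A w) = (n * n) * inner_prod d u (mat_vec d A u)"
    unfolding w inner_prod_def mat_vec_def by (simp add: sum_distrib_left ac_simps)
  ultimately show ?thesis using n by (simp add: mult.commute)
qed

text \<open>
  Markov's inequality for \<open>|y|\<^sup>2\<close>, whose mean is the trace, and for \<open>\<langle>w, y\<rangle>\<^sup>2\<close>, whose mean is at most the
  operator norm times \<open>|w|\<^sup>2\<close>.
\<close>

lemma hit_prob_le:
  assumes law: "random_vector_law d D" and d: "1 \<le> d" and L: "0 < L" and h: "0 < h"
  shows "measure D {z \<in> space D. hit d L h w (centered D z)}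
     \<le> mat_trace d (covariance D) / L + op_norm d (covariance D) / h"
    (is "_ \<le> ?tr / L + ?op / h")
    and "{z \<in> space D. hit d L h w (centered D z)} \<in> sets D"
proof -
  interpret prob_space D by (rule law_prob_space[OF law])
  note [measurable] = law_coordinate_measurable[OF law]
  have [measurable]: "(\<lambda>z. inner_prod d (centered D z) (centered D z)) \<in> borel_measurable D"
    "(\<lambda>z. inner_prod d w (centered D z)) \<in> borel_measurable D"
    unfolding inner_prod_def centered_def by measurable
  let ?A = "{z \<in> space D. L \<le> inner_prod d (centered D z) (centered D z)}"
  let ?B = "{z \<in> space D. h * inner_prod d w w < (inner_prod d w (centered D z))\<^sup>2}"
  show "{z \<in> space D. hit d L h w (centered D z)} \<in> sets D"
    unfolding hit_def by measurable
  have "measure D {z \<in> space D. hit d L h w (centered D z)} \<le> measure D (?A \<union> ?B)"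
    by (intro finite_measure_mono) (auto simp: hit_def)
  also have "\<dots> \<le> measure D ?A + measure D ?B"
    by (intro measure_Un_le) auto
  also have "measure D ?A \<le> ?tr / L"
    using integral_Markov_inequality_measure[OF second_moment_norm(1)[OF law] sets.top _ L]
    by (simp add: second_moment_norm(2)[OF law])
  also have "measure D ?B \<le> ?op / h"
  proof (cases "inner_prod d w w = 0")
    case True
    then have "?B = {}" using inner_prod_Cauchy_Schwarz[of d w] by (auto simp: not_less)
    moreover have "0 \<le> ?op" using d by (rule op_norm_nonneg)
    ultimately show ?thesis using h by (simp only: measure_empty) simp
  next
    case False
    then have c: "0 < h * inner_prod d w w"
      using inner_prod_self_nonneg[of d w] h by (simp add: less_le)
    have "measure D ?B \<le> measure D {z \<in> space D. h * inner_prod d w w \<le> (inner_prod d w (centered D z))\<^sup>2}"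
      by (intro finite_measure_mono) auto
    also have "\<dots> \<le> inner_prod d w (mat_vec d (covariance D) w) / (h * inner_prod d w w)"
      using integral_Markov_inequality_measure[OF second_moment_direction(1)[OF law, of w] sets.top _ c]
      by (simp add: second_moment_direction(2)[OF law])
    also have "\<dots> \<le> (?op * inner_prod d w w) / (h * inner_prod d w w)"
      using c by (intro divide_right_mono quad_form_le_op_norm) simp
    also have "\<dots> = ?op / h" using False by simp
    finally show ?thesis .
  qed
  finally show "measure D {z \<in> space D. hit d L h w (centered D z)} \<le> ?tr / L + ?op / h" by simp
qed

text \<open>
  If the variance of coordinate \<open>i\<close> were 0, that coordinate would be almost surely constant and the whole
  \<open>i\<close>-th row of the covariance would vanish.
\<close>

lemma mat_trace_covariance_pos:
  assumes law: "random_vector_law d D" and ij: "i < d" "j < d" "covariance D i j \<noteq> 0"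
  shows "0 < mat_trace d (covariance D)"
proof -
  note int = law_centered_product_integrable[OF law]
  have diag: "0 \<le> covariance D l l" for l by (simp add: covariance_def)
  have "covariance D i i \<noteq> 0"
  proof
    assume "covariance D i i = 0"
    then have "AE z in D. (z i - mean D i) * (z i - mean D i) = 0"
      using integral_nonneg_eq_0_iff_AE[OF int[OF ij(1,1)]] by (simp add: covariance_def)
    then have "AE z in D. (z i - mean D i) * (z j - mean D j) = 0" by eventually_elim simp
    then have "covariance D i j = 0"
      unfolding covariance_def by (intro integral_eq_zero_AE)
    then show False using ij by simp
  qed
  then have "0 < covariance D i i" using diag[of i] by simp
  also have "\<dots> \<le> mat_trace d (covariance D)"
    unfolding mat_trace_def using ij(1) diag by (intro member_le_sum) auto
  finally show ?thesis .
qed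

text \<open>
  The event \<open>E i\<close> involves coordinate \<open>i\<close> and the coordinates in \<open>J\<close>.  Given the latter, the events for
  \<open>i \<in> T\<close> are independent.  Formally, the coordinates of \<open>T\<close> are integrated out one by one.
\<close>

lemma emeasure_PiM_conditional_le:
  fixes M :: "'a measure" and J T :: "'i set"
  assumes M: "prob_space M" and fin: "finite J" "finite T" and disj: "J \<inter> T = {}"
    and meas: "\<And>i. i \<in> T \<Longrightarrow> {x \<in> space (PiM (insert i J) (\<lambda>_. M)). E i x} \<in> sets (PiM (insert i J) (\<lambda>_. M))"
    and dep: "\<And>i x x'. i \<in> T \<Longrightarrow> (\<And>j. j \<in> insert i J \<Longrightarrow> x j = x' j) \<Longrightarrow> E i x = E i x'"
    and q: "\<And>i x. i \<in> T \<Longrightarrow> emeasure M {y \<in> space M. E i (x(i := y))} \<le> q"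
  shows "emeasure (PiM (J \<union> T) (\<lambda>_. M)) {x \<in> space (PiM (J \<union> T) (\<lambda>_. M)). \<forall>i\<in>T. E i x} \<le> q ^ card T"
  using fin(2) disj meas dep q
proof (induction T)
  case empty
  interpret P: prob_space "PiM J (\<lambda>_. M)" using M by (intro prob_space_PiM)
  show ?case using P.emeasure_space_1 by simp
next
  case (insert i T)
  interpret prob_space M by (rule M)
  interpret S: product_sigma_finite "\<lambda>_ :: 'i. M"
    by (rule product_sigma_finite.intro) (rule sigma_finite_measure_axioms)
  define I where "I = J \<union> T"
  have I: "finite I" "i \<notin> I"
    using fin(1) insert.hyps insert.prems(1) by (auto simp: I_def)
  have sets_E: "{x \<in> space (PiM K (\<lambda>_. M)). E j x} \<in> sets (PiM K (\<lambda>_. M))"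
    if "j \<in> insert i T" "insert j J \<subseteq> K" for j K
  proof -
    have "E j (restrict x (insert j J)) = E j x" for x
      by (rule insert.prems(3)[OF that(1)]) auto
    moreover have "restrict x (insert j J) \<in> space (PiM (insert j J) (\<lambda>_. M))"
      if "x \<in> space (PiM K (\<lambda>_. M))" for x
      using measurable_space[OF measurable_restrict_subset[OF \<open>insert j J \<subseteq> K\<close>] that] .
    ultimately have "{x \<in> space (PiM K (\<lambda>_. M)). E j x}
        = (\<lambda>x. restrict x (insert j J)) -` {x \<in> space (PiM (insert j J) (\<lambda>_. M)). E j x} \<inter> space (PiM K (\<lambda>_. M))"
      by blast
    then show ?thesis
      using measurable_sets[OF measurable_restrict_subset[OF that(2)] insert.prems(2)[OF that(1)]] by simp
  qed
  define F where "F x = (\<forall>j\<in>T. E j x)" for x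
  have F_sets: "{x \<in> space (PiM K (\<lambda>_. M)). F x} \<in> sets (PiM K (\<lambda>_. M))" if "I \<subseteq> K" for K
    unfolding F_def using that insert.hyps
    by (intro sets.sets_Collect_finite_All sets_E) (auto simp: I_def)
  have [measurable]: "{x \<in> space (PiM (insert i I) (\<lambda>_. M)). E i x \<and> F x} \<in> sets (PiM (insert i I) (\<lambda>_. M))"
    using F_sets[of "insert i I"] sets_E[of i "insert i I"] by (intro sets.sets_Collect_conj) (auto simp: I_def)
  let ?S = "{x \<in> space (PiM (insert i I) (\<lambda>_. M)). E i x \<and> F x}"
  have "emeasure (PiM (insert i I) (\<lambda>_. M)) ?S = (\<integral>\<^sup>+ x. indicator ?S x \<partial>PiM (insert i I) (\<lambda>_. M))"
    by simp
  \<comment> \<open>Integrating out coordinate \<open>i\<close> first: the events of \<open>T\<close> do not involve it.\<close>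
  also have "\<dots> = (\<integral>\<^sup>+ x. (\<integral>\<^sup>+ y. indicator ?S (x(i := y)) \<partial>M) \<partial>PiM I (\<lambda>_. M))"
    using I by (intro S.product_nn_integral_insert) auto
  also have "\<dots> \<le> (\<integral>\<^sup>+ x. q * indicator {x \<in> space (PiM I (\<lambda>_. M)). F x} x \<partial>PiM I (\<lambda>_. M))"
  proof (intro nn_integral_mono)
    fix x assume x: "x \<in> space (PiM I (\<lambda>_. M))"
    have F_upd: "F (x(i := y)) = F x" for y
      unfolding F_def using insert.prems(3) insert.hyps insert.prems(1)
      by (intro ball_cong refl insert.prems(3)) auto
    have "(\<integral>\<^sup>+ y. indicator ?S (x(i := y)) \<partial>M)
        \<le> (\<integral>\<^sup>+ y. indicator {x \<in> space (PiM I (\<lambda>_. M)). F x} x * indicator {y \<in> space M. E i (x(i := y))} y \<partial>M)"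
      using x by (intro nn_integral_mono) (auto simp: indicator_def F_upd)
    also have "\<dots> = indicator {x \<in> space (PiM I (\<lambda>_. M)). F x} x * emeasure M {y \<in> space M. E i (x(i := y))}"
    proof (cases "F x")
      case True
      have "(\<lambda>y. x(i := y)) \<in> measurable M (PiM (insert i I) (\<lambda>_. M))"
        using x by (intro measurable_fun_upd[where J = I]) auto
      from measurable_sets[OF this sets_E[of i "insert i I"]]
      have "(\<lambda>y. x(i := y)) -` {x \<in> space (PiM (insert i I) (\<lambda>_. M)). E i x} \<inter> space M \<in> sets M"
        by (auto simp: I_def)
      also have "(\<lambda>y. x(i := y)) -` {x \<in> space (PiM (insert i I) (\<lambda>_. M)). E i x} \<inter> space M
          = {y \<in> space M. E i (x(i := y))}"
        using x by (auto simp: space_PiM PiE_iff extensional_def)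
      finally show ?thesis by (simp add: nn_integral_cmult_indicator)
    qed simp
    also have "\<dots> \<le> indicator {x \<in> space (PiM I (\<lambda>_. M)). F x} x * q"
      by (intro mult_left_mono insert.prems(4)) auto
    finally show "(\<integral>\<^sup>+ y. indicator ?S (x(i := y)) \<partial>M) \<le> q * indicator {x \<in> space (PiM I (\<lambda>_. M)). F x} x"
      by (simp add: mult.commute)
  qed
  also have "\<dots> = q * emeasure (PiM I (\<lambda>_. M)) {x \<in> space (PiM I (\<lambda>_. M)). F x}"
    using F_sets by (intro nn_integral_cmult_indicator) auto
  also have "\<dots> \<le> q * q ^ card T"
  proof (rule mult_left_mono)
    show "emeasure (PiM I (\<lambda>_. M)) {x \<in> space (PiM I (\<lambda>_. M)). F x} \<le> q ^ card T"
      unfolding I_def F_def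
    proof (rule insert.IH)
      show "J \<inter> T = {}" using insert.prems(1) by blast
    qed (rule insert.prems(2-4); simp)+
  qed simp
  finally show ?case using insert.hyps by (simp add: I_def F_def)
qed

section \<open>The union bound over patterns\<close>

text \<open>
  Tested indices have coefficient 0, so the hypotheses depend on the other points only.
\<close>

lemma pattern_vec_nonzero:
  "pattern_vec f y n c = (\<Sum>j\<in>{j. j < n \<and> f j \<noteq> 0}. pat_sign (f j) * y j c)"
  unfolding pattern_vec_def
  by (rule sum.mono_neutral_right) (auto simp: pat_sign_def)

lemma pattern_event_prob_le:
  fixes k d D L h and f :: "nat \<Rightarrow> nat"
  defines "A \<equiv> {Z \<in> space (iid_law k D). \<forall>i<k. f i = 0 \<longrightarrow>
      hit d L h (pattern_vec f (\<lambda>j. centered D (Z j)) i) (centered D (Z i))}"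
  assumes law: "random_vector_law d D" and d: "1 \<le> d" and L: "0 < L" and h: "0 < h"
    and q: "mat_trace d (covariance D) / L + op_norm d (covariance D) / h \<le> q"
  shows "A \<in> sets (iid_law k D)" and "measure (iid_law k D) A \<le> q ^ card {i. i < k \<and> f i = 0}"
proof -
  define T where "T = {i. i < k \<and> f i = 0}"
  define J where "J = {i. i < k \<and> f i \<noteq> 0}"
  define E where "E i Z = hit d L h (pattern_vec f (\<lambda>j. centered D (Z j)) i) (centered D (Z i))" for i Z
  interpret D: prob_space D by (rule law_prob_space[OF law])
  interpret P: prob_space "iid_law k D" unfolding iid_law_def by (intro prob_space_PiM law_prob_space[OF law])
  have JT: "J \<union> T = {..<k}" "J \<inter> T = {}" "finite J" "finite T" by (auto simp: J_def T_def)
  have pat_cong: "pattern_vec f (\<lambda>j. centered D (Z j)) i = pattern_vec f (\<lambda>j. centered D (Z' j)) i"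
    if "i < k" "\<And>j. j \<in> J \<Longrightarrow> Z j = Z' j" for i Z Z'
    unfolding pattern_vec_nonzero[abs_def] using that by (intro ext sum.cong) (auto simp: J_def)
  have meas: "{x \<in> space (PiM K (\<lambda>_. D)). E i x} \<in> sets (PiM K (\<lambda>_. D))"
    if "i \<in> T" "insert i J \<subseteq> K" for i K
  proof -
    have [measurable]: "(\<lambda>x. x j c) \<in> borel_measurable (PiM K (\<lambda>_. D))" if "j \<in> K" "c < d" for j c
      by (rule measurable_compose[OF measurable_component_singleton[OF that(1)] law_coordinate_measurable[OF law that(2)]])
    have sub: "j \<in> K" if "j < i" "f j \<noteq> 0" for j
      using that \<open>i \<in> T\<close> \<open>insert i J \<subseteq> K\<close> by (auto simp: T_def J_def)
    have "i \<in> K" using that by auto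
    have [measurable]: "(\<lambda>x. pattern_vec f (\<lambda>j. centered D (x j)) i c) \<in> borel_measurable (PiM K (\<lambda>_. D))" if "c < d" for c
      unfolding pattern_vec_nonzero centered_def
      using that sub by (intro borel_measurable_sum borel_measurable_times borel_measurable_diff) auto
    have [measurable]: "(\<lambda>x. centered D (x i) c) \<in> borel_measurable (PiM K (\<lambda>_. D))" if "c < d" for c
      unfolding centered_def using that \<open>i \<in> K\<close> by measurable
    show ?thesis unfolding E_def hit_def inner_prod_def by measurable
  qed
  have A_eq: "A = {Z \<in> space (PiM (J \<union> T) (\<lambda>_. D)). \<forall>i\<in>T. E i Z}"
    unfolding A_def JT iid_law_def by (auto simp: T_def E_def)
  have "{Z \<in> space (PiM (J \<union> T) (\<lambda>_. D)). \<forall>i\<in>T. E i Z} \<in> sets (PiM (J \<union> T) (\<lambda>_. D))"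
    using JT by (intro sets.sets_Collect_finite_All meas) auto
  then show "A \<in> sets (iid_law k D)" unfolding A_eq JT iid_law_def .
  have "emeasure (PiM (J \<union> T) (\<lambda>_. D)) {Z \<in> space (PiM (J \<union> T) (\<lambda>_. D)). \<forall>i\<in>T. E i Z} \<le> ennreal q ^ card T"
  proof (rule emeasure_PiM_conditional_le)
    show "prob_space D" by (rule law_prob_space[OF law])
    show "finite J" "finite T" "J \<inter> T = {}" using JT by auto
    show "{x \<in> space (PiM (insert i J) (\<lambda>_. D)). E i x} \<in> sets (PiM (insert i J) (\<lambda>_. D))" if "i \<in> T" for i
      using that by (rule meas) simp
    show "E i x = E i x'" if "i \<in> T" "\<And>j. j \<in> insert i J \<Longrightarrow> x j = x' j" for i x x'
      using pat_cong[of i x x'] that by (simp add: E_def T_def)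
    show "emeasure D {y \<in> space D. E i (x(i := y))} \<le> ennreal q" if "i \<in> T" for i x
    proof -
      have "pattern_vec f (\<lambda>j. centered D ((x(i := y)) j)) i = pattern_vec f (\<lambda>j. centered D (x j)) i" for y
        using that JT(2) by (intro pat_cong) (auto simp: T_def)
      then have "{y \<in> space D. E i (x(i := y))}
          = {y \<in> space D. hit d L h (pattern_vec f (\<lambda>j. centered D (x j)) i) (centered D y)}"
        by (simp add: E_def)
      then show ?thesis
        using hit_prob_le(1)[OF law d L h, of "pattern_vec f (\<lambda>j. centered D (x j)) i"] q
        by (simp add: D.emeasure_eq_measure ennreal_leI)
    qed
  qed
  then have "emeasure (iid_law k D) A \<le> ennreal q ^ card T"
    unfolding A_eq JT iid_law_def .
  moreover have "0 \<le> q"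
    using order_trans[OF measure_nonneg order_trans[OF hit_prob_le(1)[OF law d L h] q]] .
  ultimately show "measure (iid_law k D) A \<le> q ^ card {i. i < k \<and> f i = 0}"
    by (simp add: P.emeasure_eq_measure T_def ennreal_power)
qed

lemma pattern_union_prob_le:
  fixes k d D L h m
  defines "B \<equiv> \<Union>f\<in>{f \<in> {..<k} \<rightarrow>\<^sub>E {..<4}. m \<le> real (card {i. i < k \<and> f i = 0})}.
      {Z \<in> space (iid_law k D). \<forall>i<k. f i = 0 \<longrightarrow>
        hit d L h (pattern_vec f (\<lambda>j. centered D (Z j)) i) (centered D (Z i))}"
  assumes law: "random_vector_law d D" and d: "1 \<le> d" and L: "0 < L" and h: "0 < h"
    and q: "mat_trace d (covariance D) / L + op_norm d (covariance D) / h \<le> q" "0 < q" "q \<le> 1"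
  shows "B \<in> sets (iid_law k D)" and "measure (iid_law k D) B \<le> 4 ^ k * q powr m"
proof -
  interpret P: prob_space "iid_law k D" unfolding iid_law_def by (intro prob_space_PiM law_prob_space[OF law])
  define F where "F = {f \<in> {..<k} \<rightarrow>\<^sub>E {..<4::nat}. m \<le> real (card {i. i < k \<and> f i = 0})}"
  define A where "A f = {Z \<in> space (iid_law k D). \<forall>i<k. f i = 0 \<longrightarrow>
        hit d L h (pattern_vec f (\<lambda>j. centered D (Z j)) i) (centered D (Z i))}" for f
  have B: "B = (\<Union>f\<in>F. A f)" by (simp add: B_def F_def A_def)
  have fin: "finite ({..<k} \<rightarrow>\<^sub>E {..<4::nat})" by (intro finite_PiE) auto
  have F: "finite F" "F \<subseteq> {..<k} \<rightarrow>\<^sub>E {..<4}"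
    using fin by (auto simp: F_def)
  have A: "A f \<in> sets (iid_law k D)" "measure (iid_law k D) (A f) \<le> q ^ card {i. i < k \<and> f i = 0}" for f
    unfolding A_def by (rule pattern_event_prob_le[OF law d L h q(1)])+
  show "B \<in> sets (iid_law k D)" unfolding B using F A by (intro sets.finite_UN) auto
  have "card F \<le> card ({..<k} \<rightarrow>\<^sub>E {..<4::nat})" using F fin by (intro card_mono)
  also have "\<dots> = 4 ^ k" by (simp add: card_PiE)
  finally have card: "real (card F) \<le> 4 ^ k" by (metis of_nat_le_iff of_nat_numeral of_nat_power)
  have "measure (iid_law k D) B \<le> (\<Sum>f\<in>F. measure (iid_law k D) (A f))"
    unfolding B using F A by (intro measure_UNION_le) auto
  also have "\<dots> \<le> (\<Sum>f\<in>F. q powr m)"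
  proof (intro sum_mono)
    fix f assume f: "f \<in> F"
    have "measure (iid_law k D) (A f) \<le> q powr real (card {i. i < k \<and> f i = 0})"
      using A q by (simp add: powr_realpow)
    also have "\<dots> \<le> q powr m" using f q by (intro powr_mono') (auto simp: F_def)
    finally show "measure (iid_law k D) (A f) \<le> q powr m" .
  qed
  also have "\<dots> \<le> 4 ^ k * q powr m" using card by (simp add: mult_right_mono)
  finally show "measure (iid_law k D) B \<le> 4 ^ k * q powr m" .
qed

text \<open>
  With \<open>q = 8\<^bsup>-19200\<^esup>\<close> the union bound over \<open>4\<^sup>k\<close> patterns with at least \<open>k / 19200\<close> tested indices gives
  \<open>4\<^sup>k 8\<^sup>-\<^sup>k = 2\<^sup>-\<^sup>k\<close>.  The length bound \<open>L\<close> makes long points rare enough, and the size of \<open>C\<close> then takes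
  care both of the Chebyshev bound and of the number of mistakes.
\<close>

lemma spread_with_high_probability:
  obtains C where "0 < C"
    "\<And>k d D r. 1 \<le> k \<Longrightarrow> 1 \<le> d \<Longrightarrow> random_vector_law d D \<Longrightarrow>
       0 < mat_trace d (covariance D) \<Longrightarrow>
       r = C * (sqrt (mat_trace d (covariance D) / real k) + sqrt (op_norm d (covariance D))) \<Longrightarrow>
       0 < r \<and> (\<exists>B \<in> sets (iid_law k D). measure (iid_law k D) B \<le> (1 / 2) ^ k \<and>
         (\<forall>Z \<in> space (iid_law k D) - B.
            spread k d (\<lambda>i. centered D (Z i)) (r\<^sup>2 / 1600) (real k / 400)))"
proof -
  obtain q :: real where q: "0 < q" "q \<le> 1" "q powr (1 / 19200) = 1 / 8"
  proof
    show "0 < (1 / 8 :: real) powr 19200" by (simp only: powr_gt_zero)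
    show "(1 / 8 :: real) powr 19200 \<le> 1" by (rule powr_le1) simp_all
    have "((1 / 8 :: real) powr 19200) powr (1 / 19200) = (1 / 8) powr (19200 * (1 / 19200))"
      by (rule powr_powr)
    also have "19200 * (1 / 19200) = (1 :: real)" by simp
    finally show "((1 / 8 :: real) powr 19200) powr (1 / 19200) = 1 / 8"
      by (simp only: powr_one_gt_zero_iff)
  qed
  \<comment> \<open>The number of mistakes needs \<open>C\<^sup>2 \<ge> 307200 * 19200 / q\<close>, Chebyshev only \<open>C\<^sup>2 \<ge> 2457600 / q\<close>.\<close>
  define C where "C = sqrt (6000000000 / q)"
  have C: "0 < C" "C\<^sup>2 = 6000000000 / q" using q(1) by (auto simp: C_def)
  show ?thesis
  proof (rule that[OF C(1)])
    fix k d :: nat and D :: "(nat \<Rightarrow> real) measure" and r :: real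
    assume k: "1 \<le> k" and d: "1 \<le> d" and law: "random_vector_law d D"
      and tr: "0 < mat_trace d (covariance D)"
      and r: "r = C * (sqrt (mat_trace d (covariance D) / real k) + sqrt (op_norm d (covariance D)))"
    define tr' op where "tr' = mat_trace d (covariance D)" and "op = op_norm d (covariance D)"
    have op: "0 \<le> op" using op_norm_nonneg[OF d] by (simp add: op_def)
    have tr': "0 < tr'" using tr by (simp add: tr'_def)
    have s: "0 < sqrt (tr' / real k)" "0 \<le> sqrt op" using tr' op k by auto
    have r0: "0 < r" unfolding r tr'_def[symmetric] op_def[symmetric] using C(1) s by (intro mult_pos_pos add_pos_nonneg)
    have "tr' / real k + op = (sqrt (tr' / real k))\<^sup>2 + (sqrt op)\<^sup>2" using tr' op by simp
    also have "\<dots> \<le> (sqrt (tr' / real k) + sqrt op)\<^sup>2"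
      using s by (simp add: power2_sum)
    finally have "C\<^sup>2 * (tr' / real k + op) \<le> r\<^sup>2"
      unfolding r tr'_def[symmetric] op_def[symmetric] power_mult_distrib by (intro mult_left_mono) auto
    then have r2: "6000000000 / q * (tr' / real k) + 6000000000 / q * op \<le> r\<^sup>2"
      by (simp only: C(2) distrib_left)
    have pos: "0 \<le> 6000000000 / q * (tr' / real k)" "0 \<le> 6000000000 / q * op"
      using q(1) tr' op by auto
    define L where "L = 2 * tr' / q"
    define h where "h = r\<^sup>2 / 1600 / 768"
    have L: "0 < L" using tr' q by (simp add: L_def)
    have h: "0 < h" using r0 by (simp add: h_def)
    have "tr' / L = q / 2" using tr' q by (simp add: L_def)
    moreover have "op / h \<le> q / 2"
    proof -
      have "6000000000 * op \<le> r\<^sup>2 * q"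
        using r2 pos q(1) by (simp add: pos_divide_le_eq[symmetric])
      then have "op * 2 \<le> q * h" using op by (simp add: h_def mult.commute[of q])
      then show ?thesis using h by (simp add: divide_le_eq)
    qed
    ultimately have hitq: "mat_trace d (covariance D) / L + op_norm d (covariance D) / h \<le> q"
      unfolding tr'_def[symmetric] op_def[symmetric] by linarith
    have few: "96 * L / (r\<^sup>2 / 1600) \<le> real k / 19200"
    proof -
      have "6000000000 / q * (tr' / real k) \<le> r\<^sup>2" using r2 pos by linarith
      then have "6000000000 / q * (tr' / real k) * real k \<le> r\<^sup>2 * real k"
        by (rule mult_right_mono) simp
      moreover have "6000000000 / q * (tr' / real k) * real k = 3000000000 * L"
        using k by (simp add: L_def)
      ultimately have "3000000000 * L \<le> r\<^sup>2 * real k" by simp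
      then have "96 * L * 1600 * 19200 \<le> r\<^sup>2 * real k" using L by linarith
      then show ?thesis using r0 by (simp add: field_simps)
    qed
    define m where "m = real k / 19200"
    define B where "B = (\<Union>f\<in>{f \<in> {..<k} \<rightarrow>\<^sub>E {..<4}. m \<le> real (card {i. i < k \<and> f i = 0})}.
      {Z \<in> space (iid_law k D). \<forall>i<k. f i = 0 \<longrightarrow>
        hit d L h (pattern_vec f (\<lambda>j. centered D (Z j)) i) (centered D (Z i))})"
    note union = pattern_union_prob_le[OF law d L h hitq q(1,2), of k m, folded B_def]
    have "q powr m = (q powr (1 / 19200)) ^ k"
      using q(1) by (simp only: powr_realpow[symmetric] powr_gt_zero powr_powr m_def) simp
    then have "4 ^ k * q powr m = (1 / 2) ^ k"
      by (simp add: q(3) power_mult_distrib[symmetric])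
    then have prob: "measure (iid_law k D) B \<le> (1 / 2) ^ k" using union(2) by simp
    have "spread k d (\<lambda>i. centered D (Z i)) (r\<^sup>2 / 1600) (real k / 400)"
      if Z: "Z \<in> space (iid_law k D) - B" for Z
    proof (rule ccontr)
      assume "\<not> ?thesis"
      then obtain f where f: "f \<in> {..<k} \<rightarrow>\<^sub>E {..<4}"
        "\<And>i. i < k \<Longrightarrow> f i = 0 \<Longrightarrow>
          hit d L (r\<^sup>2 / 1600 / 768) (pattern_vec f (\<lambda>i. centered D (Z i)) i) (centered D (Z i))"
        "real k / 400 / 24 - 96 * L / (r\<^sup>2 / 1600) \<le> real (card {i. i < k \<and> f i = 0})"
        using not_spread_pattern[of "r\<^sup>2 / 1600" "real k / 400" L k d "\<lambda>i. centered D (Z i)"] r0 L by auto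
      have "m \<le> real (card {i. i < k \<and> f i = 0})" using f(3) few by (simp add: m_def)
      then have "Z \<in> B" using Z f(1,2) by (auto simp: B_def h_def)
      then show False using Z by blast
    qed
    then show "0 < r \<and> (\<exists>B \<in> sets (iid_law k D). measure (iid_law k D) B \<le> (1 / 2) ^ k \<and>
         (\<forall>Z \<in> space (iid_law k D) - B.
            spread k d (\<lambda>i. centered D (Z i)) (r\<^sup>2 / 1600) (real k / 400)))"
      using r0 union(1) prob by blast
  qed
qed

section \<open>Timed correctness of real RAM programs\<close>

definition halts_within :: "com \<Rightarrow> nat \<Rightarrow> (state \<Rightarrow> bool) \<Rightarrow> state \<Rightarrow> bool" where
  "halts_within c T Q s \<longleftrightarrow> (\<exists>t s'. exec c s t s' \<and> t \<le> T \<and> Q s')"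

abbreviation set_nvar :: "state \<Rightarrow> nat \<Rightarrow> nat \<Rightarrow> state" where
  "set_nvar s v x \<equiv> s\<lparr>nvar := (nvar s)(v := x)\<rparr>"

abbreviation set_cell :: "state \<Rightarrow> nat \<Rightarrow> nat \<Rightarrow> nat \<Rightarrow> real \<Rightarrow> state" where
  "set_cell s a i j x \<equiv> s\<lparr>cell := (cell s)(a := (cell s a)(i := (cell s a i)(j := x)))\<rparr>"

text \<open>
  The frame condition: only the variables in \<open>V\<close> and the arrays in \<open>A\<close> may have changed.
\<close>

definition agree_off :: "nat set \<Rightarrow> nat set \<Rightarrow> state \<Rightarrow> state \<Rightarrow> bool" where
  "agree_off V A s s' \<longleftrightarrow> (\<forall>v. v \<notin> V \<longrightarrow> nvar s' v = nvar s v) \<and> (\<forall>a. a \<notin> A \<longrightarrow> cell s' a = cell s a)"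

lemma agree_off_refl: "agree_off V A s s"
  by (simp add: agree_off_def)

lemma agree_off_trans: "agree_off V A s s' \<Longrightarrow> agree_off V A s' s'' \<Longrightarrow> agree_off V A s s''"
  by (simp add: agree_off_def)

lemma agree_off_mono: "agree_off V A s s' \<Longrightarrow> V \<subseteq> V' \<Longrightarrow> A \<subseteq> A' \<Longrightarrow> agree_off V' A' s s'"
  by (auto simp: agree_off_def)

lemma halts_within_mono:
  assumes "halts_within c T Q s" "T \<le> T'" "\<And>s'. Q s' \<Longrightarrow> Q' s'"
  shows "halts_within c T' Q' s"
  using assms unfolding halts_within_def by (meson order_trans)

lemma halts_within_Skip: "Q s \<Longrightarrow> halts_within Skip 1 Q s"
  unfolding halts_within_def using exec.Skip by blast

lemma halts_within_NAssign: "Q (set_nvar s v (nval e s)) \<Longrightarrow> halts_within (NAssign v e) 1 Q s"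
  unfolding halts_within_def using exec.NAssign by blast

lemma halts_within_RAssign:
  "Q (set_cell s a (nval e s) (nval f s) (rval q s)) \<Longrightarrow> halts_within (RAssign a e f q) 1 Q s"
  unfolding halts_within_def using exec.RAssign by blast

lemma halts_within_Seq:
  assumes "halts_within c\<^sub>1 T\<^sub>1 R s" "\<And>s'. R s' \<Longrightarrow> halts_within c\<^sub>2 T\<^sub>2 Q s'"
  shows "halts_within (Seq c\<^sub>1 c\<^sub>2) (T\<^sub>1 + T\<^sub>2) Q s"
proof -
  obtain t s' where 1: "exec c\<^sub>1 s t s'" "t \<le> T\<^sub>1" "R s'"
    using assms(1) by (auto simp: halts_within_def)
  obtain u s'' where 2: "exec c\<^sub>2 s' u s''" "u \<le> T\<^sub>2" "Q s''"
    using assms(2)[OF 1(3)] by (auto simp: halts_within_def)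
  from exec.Seq[OF 1(1) 2(1)] 1 2 show ?thesis
    unfolding halts_within_def by (intro exI[of _ "t + u"] exI[of _ s'']) simp
qed

lemma halts_within_Cond:
  assumes "bval b s \<Longrightarrow> halts_within c\<^sub>1 T Q s" "\<not> bval b s \<Longrightarrow> halts_within c\<^sub>2 T Q s"
  shows "halts_within (Cond b c\<^sub>1 c\<^sub>2) (T + 1) Q s"
proof (cases "bval b s")
  case True
  then obtain t s' where 1: "exec c\<^sub>1 s t s'" "t \<le> T" "Q s'"
    using assms(1) by (auto simp: halts_within_def)
  from exec.CondTrue[OF True 1(1)] 1 show ?thesis
    unfolding halts_within_def by (intro exI[of _ "t + 1"] exI[of _ s']) simp
next
  case False
  then obtain t s' where 1: "exec c\<^sub>2 s t s'" "t \<le> T" "Q s'"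
    using assms(2) by (auto simp: halts_within_def)
  from exec.CondFalse[OF False 1(1)] 1 show ?thesis
    unfolding halts_within_def by (intro exI[of _ "t + 1"] exI[of _ s']) simp
qed

definition for_loop :: "nat \<Rightarrow> nexp \<Rightarrow> com \<Rightarrow> com" where
  "for_loop v n c = Seq (NAssign v (NConst 0))
     (While (NLess (NVar v) n) (Seq c (NAssign v (NAdd (NVar v) (NConst 1)))))"

definition loop_time :: "nat \<Rightarrow> nat \<Rightarrow> nat" where
  "loop_time N T = N * (T + 2) + 2"

text \<open>
  The invariant has to be restored only after the loop variable has been advanced, and the body must not
  leave a changed loop variable behind.
\<close>

lemma halts_within_for_loop:
  assumes init: "I 0 (set_nvar s v 0)"
    and bound: "\<And>i s'. I i s' \<Longrightarrow> nval n s' = N"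
    and body: "\<And>i s'. i < N \<Longrightarrow> nvar s' v = i \<Longrightarrow> I i s' \<Longrightarrow>
      halts_within c T (\<lambda>s''. nvar s'' v = i \<and> I (Suc i) (set_nvar s'' v (Suc i))) s'"
  shows "halts_within (for_loop v n c) (loop_time N T) (I N) s"
proof -
  let ?W = "While (NLess (NVar v) n) (Seq c (NAssign v (NAdd (NVar v) (NConst 1))))"
  have "halts_within ?W ((N - i) * (T + 2) + 1) (I N) s'"
    if "i \<le> N" "nvar s' v = i" "I i s'" for i s'
    using that
  proof (induction i arbitrary: s' rule: inc_induct)
    case base
    then have "\<not> bval (NLess (NVar v) n) s'" using bound by simp
    from exec.WhileFalse[OF this] show ?case
      using base unfolding halts_within_def by fastforce
  next
    case (step i)
    then have b: "bval (NLess (NVar v) n) s'" using bound by simp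
    obtain t s'' where 1: "exec c s' t s''" "t \<le> T" "nvar s'' v = i" "I (Suc i) (set_nvar s'' v (Suc i))"
      using body[of i s'] step by (auto simp: halts_within_def)
    have "exec (NAssign v (NAdd (NVar v) (NConst 1))) s'' 1 (set_nvar s'' v (Suc i))"
      using exec.NAssign[of v "NAdd (NVar v) (NConst 1)" s''] 1(3) by simp
    from exec.Seq[OF 1(1) this]
    have 2: "exec (Seq c (NAssign v (NAdd (NVar v) (NConst 1)))) s' (t + 1) (set_nvar s'' v (Suc i))" .
    obtain u s3 where 3: "exec ?W (set_nvar s'' v (Suc i)) u s3" "u \<le> (N - Suc i) * (T + 2) + 1" "I N s3"
      using step.IH[of "set_nvar s'' v (Suc i)"] 1(4) by (auto simp: halts_within_def)
    have "N - i = Suc (N - Suc i)" using step.hyps by simp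
    then have "t + 1 + u + 1 \<le> (N - i) * (T + 2) + 1" using 1(2) 3(2) by simp
    with exec.WhileTrue[OF b 2 3(1)] 3(3) show ?case
      unfolding halts_within_def by blast
  qed
  from this[of 0 "set_nvar s v 0"] init
  have "halts_within ?W (N * (T + 2) + 1) (I N) (set_nvar s v 0)" by simp
  then have "halts_within (for_loop v n c) (1 + (N * (T + 2) + 1)) (I N) s"
    unfolding for_loop_def
    by (intro halts_within_Seq[where R = "\<lambda>s'. s' = set_nvar s v 0"] halts_within_NAssign) auto
  then show ?thesis by (simp add: loop_time_def)
qed

definition sum_loop :: "nat \<Rightarrow> nexp \<Rightarrow> nat \<Rightarrow> nexp \<Rightarrow> nexp \<Rightarrow> rexp \<Rightarrow> com" where
  "sum_loop v n a e f q = Seq (RAssign a e f (ROfNat (NConst 0)))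
     (for_loop v n (RAssign a e f (RAdd (RCell a e f) q)))"

lemma halts_within_sum_loop:
  assumes idx: "\<And>s'. agree_off {v} {a} s s' \<Longrightarrow> nval n s' = N \<and> nval e s' = x \<and> nval f s' = y"
    and summand: "\<And>i s'. i < N \<Longrightarrow> agree_off {v} {a} s s' \<Longrightarrow> nvar s' v = i \<Longrightarrow> rval q s' = g i"
  shows "halts_within (sum_loop v n a e f q) (1 + loop_time N 1)
    (\<lambda>s'. agree_off {v} {a} s s' \<and> cell s' a = (cell s a)(x := (cell s a x)(y := \<Sum>i<N. g i))) s"
  unfolding sum_loop_def
proof (rule halts_within_Seq)
  show "halts_within (RAssign a e f (ROfNat (NConst 0))) 1 (\<lambda>s'. s' = set_cell s a x y 0) s"
    by (rule halts_within_RAssign) (use idx[OF agree_off_refl] in auto)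
next
  fix s1 assume s1: "s1 = set_cell s a x y 0"
  define I where "I m s' \<longleftrightarrow> agree_off {v} {a} s s' \<and>
    cell s' a = (cell s a)(x := (cell s a x)(y := \<Sum>i<m. g i))" for m s'
  have "halts_within (for_loop v n (RAssign a e f (RAdd (RCell a e f) q))) (loop_time N 1) (I N) s1"
  proof (rule halts_within_for_loop)
    show "I 0 (set_nvar s1 v 0)" by (simp add: I_def s1 agree_off_def)
    show "nval n s' = N" if "I i s'" for i s' using that idx by (simp add: I_def)
    show "halts_within (RAssign a e f (RAdd (RCell a e f) q)) 1
        (\<lambda>s''. nvar s'' v = i \<and> I (Suc i) (set_nvar s'' v (Suc i))) s'"
      if "i < N" "nvar s' v = i" "I i s'" for i s'
      using that idx[of s'] summand[of i s']
      by (intro halts_within_RAssign) (auto simp: I_def agree_off_def)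
  qed
  then show "halts_within (for_loop v n (RAssign a e f (RAdd (RCell a e f) q))) (loop_time N 1)
    (\<lambda>s'. agree_off {v} {a} s s' \<and> cell s' a = (cell s a)(x := (cell s a x)(y := \<Sum>i<N. g i))) s1"
    unfolding I_def .
qed

text \<open>
  The body may rely on the current content of the row, so that the rule also covers updates in place.
\<close>

lemma halts_within_fill_row:
  assumes bound: "\<And>s'. agree_off (insert v V) (insert a A) s s' \<Longrightarrow> nval n s' = N"
    and v: "v \<notin> V"
    and body: "\<And>y s'. y < N \<Longrightarrow> agree_off (insert v V) (insert a A) s s' \<Longrightarrow> nvar s' v = y \<Longrightarrow>
      cell s' a = (cell s a)(x := (\<lambda>z. if z < y then g z else cell s a x z)) \<Longrightarrow>
      halts_within c T (\<lambda>s''. agree_off V (insert a A) s' s'' \<and>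
        cell s'' a = (cell s' a)(x := (cell s' a x)(y := g y))) s'"
  shows "halts_within (for_loop v n c) (loop_time N T)
    (\<lambda>s'. agree_off (insert v V) (insert a A) s s' \<and>
      cell s' a = (cell s a)(x := (\<lambda>z. if z < N then g z else cell s a x z))) s"
proof -
  define I where "I y s' \<longleftrightarrow> agree_off (insert v V) (insert a A) s s' \<and>
      cell s' a = (cell s a)(x := (\<lambda>z. if z < y then g z else cell s a x z))" for y s'
  have "halts_within (for_loop v n c) (loop_time N T) (I N) s"
  proof (rule halts_within_for_loop)
    show "I 0 (set_nvar s v 0)" by (simp add: I_def agree_off_def)
    show "nval n s' = N" if "I i s'" for i s' using that bound by (simp add: I_def)
    show "halts_within c T (\<lambda>s''. nvar s'' v = i \<and> I (Suc i) (set_nvar s'' v (Suc i))) s'"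
      if "i < N" "nvar s' v = i" "I i s'" for i s'
    proof (rule halts_within_mono[OF body[of i s'] order_refl])
      fix s'' assume s'': "agree_off V (insert a A) s' s'' \<and> cell s'' a = (cell s' a)(x := (cell s' a x)(i := g i))"
      have "agree_off (insert v V) (insert a A) s (set_nvar s'' v (Suc i))"
        using s'' that by (auto simp: I_def agree_off_def)
      moreover have "cell s'' a = (cell s a)(x := (\<lambda>z. if z < Suc i then g z else cell s a x z))"
        using s'' that by (auto simp: I_def fun_eq_iff less_Suc_eq)
      ultimately show "nvar s'' v = i \<and> I (Suc i) (set_nvar s'' v (Suc i))"
        using s'' that v by (auto simp: I_def agree_off_def)
    qed (use that in \<open>auto simp: I_def\<close>)
  qed
  then show ?thesis unfolding I_def .
qed

lemma halts_within_fill_rows: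
  assumes bound: "\<And>s'. agree_off (insert v V) (insert a A) s s' \<Longrightarrow> nval n s' = N"
    and v: "v \<notin> V"
    and body: "\<And>x s'. x < N \<Longrightarrow> agree_off (insert v V) (insert a A) s s' \<Longrightarrow> nvar s' v = x \<Longrightarrow>
      cell s' a x = cell s a x \<Longrightarrow>
      halts_within c T (\<lambda>s''. agree_off V (insert a A) s' s'' \<and> cell s'' a = (cell s' a)(x := h x)) s'"
  shows "halts_within (for_loop v n c) (loop_time N T)
    (\<lambda>s'. agree_off (insert v V) (insert a A) s s' \<and>
      cell s' a = (\<lambda>z. if z < N then h z else cell s a z)) s"
proof -
  define I where "I x s' \<longleftrightarrow> agree_off (insert v V) (insert a A) s s' \<and>
      cell s' a = (\<lambda>z. if z < x then h z else cell s a z)" for x s'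
  have "halts_within (for_loop v n c) (loop_time N T) (I N) s"
  proof (rule halts_within_for_loop)
    show "I 0 (set_nvar s v 0)" by (simp add: I_def agree_off_def)
    show "nval n s' = N" if "I i s'" for i s' using that bound by (simp add: I_def)
    show "halts_within c T (\<lambda>s''. nvar s'' v = i \<and> I (Suc i) (set_nvar s'' v (Suc i))) s'"
      if "i < N" "nvar s' v = i" "I i s'" for i s'
    proof (rule halts_within_mono[OF body[of i s'] order_refl])
      fix s'' assume s'': "agree_off V (insert a A) s' s'' \<and> cell s'' a = (cell s' a)(i := h i)"
      have "agree_off (insert v V) (insert a A) s (set_nvar s'' v (Suc i))"
        using s'' that by (auto simp: I_def agree_off_def)
      moreover have "cell s'' a = (\<lambda>z. if z < Suc i then h z else cell s a z)"
        using s'' that by (auto simp: I_def fun_eq_iff less_Suc_eq)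
      ultimately show "nvar s'' v = i \<and> I (Suc i) (set_nvar s'' v (Suc i))"
        using s'' that v by (auto simp: I_def agree_off_def)
    qed (use that in \<open>auto simp: I_def\<close>)
  qed
  then show ?thesis unfolding I_def .
qed

lemma halts_within_fill_matrix:
  assumes bounds: "\<And>s'. agree_off (insert v (insert w V)) (insert a A) s s' \<Longrightarrow> nval n s' = N \<and> nval m s' = M"
    and vars: "v \<noteq> w" "v \<notin> V" "w \<notin> V"
    and body: "\<And>x y s'. x < N \<Longrightarrow> y < M \<Longrightarrow> agree_off (insert v (insert w V)) (insert a A) s s' \<Longrightarrow>
      nvar s' v = x \<Longrightarrow> nvar s' w = y \<Longrightarrow>
      halts_within c T (\<lambda>s''. agree_off V (insert a A) s' s'' \<and>
        cell s'' a = (cell s' a)(x := (cell s' a x)(y := g x y))) s'"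
  shows "halts_within (for_loop v n (for_loop w m c)) (loop_time N (loop_time M T))
    (\<lambda>s'. agree_off (insert v (insert w V)) (insert a A) s s' \<and>
      (\<forall>x<N. \<forall>y<M. cell s' a x y = g x y)) s"
proof -
  have "halts_within (for_loop v n (for_loop w m c)) (loop_time N (loop_time M T))
    (\<lambda>s'. agree_off (insert v (insert w V)) (insert a A) s s' \<and>
      cell s' a = (\<lambda>x. if x < N then (\<lambda>y. if y < M then g x y else cell s a x y) else cell s a x)) s"
  proof (rule halts_within_fill_rows)
    fix x s' assume x: "x < N" "agree_off (insert v (insert w V)) (insert a A) s s'" "nvar s' v = x"
      "cell s' a x = cell s a x"
    have "halts_within (for_loop w m c) (loop_time M T)
      (\<lambda>s''. agree_off (insert w V) (insert a A) s' s'' \<and>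
        cell s'' a = (cell s' a)(x := (\<lambda>y. if y < M then g x y else cell s' a x y))) s'"
    proof (rule halts_within_fill_row)
      show "nval m s'' = M" if "agree_off (insert w V) (insert a A) s' s''" for s''
        using bounds[of s''] agree_off_trans[OF x(2) agree_off_mono[OF that]] by blast
      fix y s'' assume y: "y < M" "agree_off (insert w V) (insert a A) s' s''" "nvar s'' w = y"
      have "agree_off (insert v (insert w V)) (insert a A) s s''"
        using agree_off_trans[OF x(2) agree_off_mono[OF y(2)]] by blast
      moreover have "nvar s'' v = x" using x y vars by (auto simp: agree_off_def)
      ultimately show "halts_within c T (\<lambda>s3. agree_off V (insert a A) s'' s3 \<and>
          cell s3 a = (cell s'' a)(x := (cell s'' a x)(y := g x y))) s''"
        using body x(1) y by blast
    qed (use vars in auto)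
    then show "halts_within (for_loop w m c) (loop_time M T)
      (\<lambda>s''. agree_off (insert w V) (insert a A) s' s'' \<and>
        cell s'' a = (cell s' a)(x := (\<lambda>y. if y < M then g x y else cell s a x y))) s'"
      unfolding x(4) .
  qed (use bounds vars in auto)
  then show ?thesis by (rule halts_within_mono) auto
qed

text \<open>
  The running times are nested expressions in \<open>k\<close> and \<open>d\<close>; closure under the operations that occur
  avoids any explicit bound.
\<close>

definition poly_bounded :: "(nat \<Rightarrow> nat \<Rightarrow> nat) \<Rightarrow> bool" where
  "poly_bounded f \<longleftrightarrow> (\<exists>A m. \<forall>k d. 1 \<le> k \<longrightarrow> 1 \<le> d \<longrightarrow> f k d \<le> A * (k * d) ^ m)"

lemma poly_bounded_const: "poly_bounded (\<lambda>k d. c)"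
  unfolding poly_bounded_def by (intro exI[of _ c] exI[of _ 0]) simp

lemma poly_bounded_fst: "poly_bounded (\<lambda>k d. k)"
  unfolding poly_bounded_def by (intro exI[of _ 1]) simp

lemma poly_bounded_snd: "poly_bounded (\<lambda>k d. d)"
  unfolding poly_bounded_def by (intro exI[of _ 1]) simp

lemma poly_bounded_mult:
  assumes "poly_bounded f" "poly_bounded g"
  shows "poly_bounded (\<lambda>k d. f k d * g k d)"
proof -
  obtain A m B n where 1: "\<And>k d. 1 \<le> k \<Longrightarrow> 1 \<le> d \<Longrightarrow> f k d \<le> A * (k * d) ^ m"
    "\<And>k d. 1 \<le> k \<Longrightarrow> 1 \<le> d \<Longrightarrow> g k d \<le> B * (k * d) ^ n"
    using assms unfolding poly_bounded_def by blast
  show ?thesis unfolding poly_bounded_def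
  proof (intro exI allI impI)
    fix k d :: nat assume "1 \<le> k" "1 \<le> d"
    then have "f k d * g k d \<le> (A * (k * d) ^ m) * (B * (k * d) ^ n)"
      using 1 by (intro mult_mono) auto
    then show "f k d * g k d \<le> (A * B) * (k * d) ^ (m + n)"
      by (simp only: power_add ac_simps)
  qed
qed

lemma poly_bounded_add:
  assumes "poly_bounded f" "poly_bounded g"
  shows "poly_bounded (\<lambda>k d. f k d + g k d)"
proof -
  obtain A m B n where 1: "\<And>k d. 1 \<le> k \<Longrightarrow> 1 \<le> d \<Longrightarrow> f k d \<le> A * (k * d) ^ m"
    "\<And>k d. 1 \<le> k \<Longrightarrow> 1 \<le> d \<Longrightarrow> g k d \<le> B * (k * d) ^ n"
    using assms unfolding poly_bounded_def by blast
  show ?thesis unfolding poly_bounded_def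
  proof (intro exI allI impI)
    fix k d :: nat assume kd: "1 \<le> k" "1 \<le> d"
    then have "(k * d) ^ m \<le> (k * d) ^ (m + n)" "(k * d) ^ n \<le> (k * d) ^ (m + n)"
      by (auto intro!: power_increasing)
    then have "A * (k * d) ^ m + B * (k * d) ^ n \<le> (A + B) * (k * d) ^ (m + n)"
      unfolding distrib_right by (intro add_mono mult_left_mono) auto
    then show "f k d + g k d \<le> (A + B) * (k * d) ^ (m + n)"
      using 1[OF kd] by linarith
  qed
qed

lemma poly_bounded_loop_time:
  "poly_bounded f \<Longrightarrow> poly_bounded g \<Longrightarrow> poly_bounded (\<lambda>k d. loop_time (f k d) (g k d))"
  unfolding loop_time_def by (intro poly_bounded_add poly_bounded_mult poly_bounded_const)

section \<open>The certification program\<close>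

text \<open>
  Memory layout of the program.  Variable 3 counts the rounds, variables 4 to 7 are loop indices.  Array 3
  holds the centred points and row 0 of array 4 the weights.  Array 5 holds \<open>A\<close> and its powers and array 6
  is used for squaring; array 7 holds the vectors \<open>N Y\<^sub>i\<close>.  In row 0, array 8 has the squared row norms of
  \<open>N\<close> and array 9 the scores.  Cell \<open>(0, 0)\<close> of array 10 has the squared norm of \<open>N\<close>; of array 11, the
  maximal score; cell \<open>(0, 1)\<close> of array 11 finally has the removed weight.
\<close>

definition inputs :: "nat \<Rightarrow> nat \<Rightarrow> real \<Rightarrow> real \<Rightarrow> (nat \<Rightarrow> nat \<Rightarrow> real) \<Rightarrow> state \<Rightarrow> bool" where
  "inputs k d r p Y s \<longleftrightarrow> nvar s 0 = k \<and> nvar s 1 = d \<and> cell s 2 0 0 = r \<and> cell s 2 0 1 = p \<and>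
     (\<forall>i<k. \<forall>j<d. cell s 3 i j = Y i j)"

lemma inputs_agree_off:
  "inputs k d r p Y s \<Longrightarrow> agree_off V A s s' \<Longrightarrow> 0 \<notin> V \<Longrightarrow> 1 \<notin> V \<Longrightarrow> 2 \<notin> A \<Longrightarrow> 3 \<notin> A
    \<Longrightarrow> inputs k d r p Y s'"
  by (simp add: inputs_def agree_off_def)

definition moment_prog :: com where
  "moment_prog = for_loop 4 (NVar 1) (for_loop 5 (NVar 1)
     (Seq (sum_loop 6 (NVar 0) 5 (NVar 4) (NVar 5)
            (RMul (RMul (RCell 4 (NConst 0) (NVar 6)) (RCell 3 (NVar 6) (NVar 4))) (RCell 3 (NVar 6) (NVar 5))))
          (RAssign 5 (NVar 4) (NVar 5)
            (RDiv (RMul (RCell 5 (NVar 4) (NVar 5)) (ROfNat (NConst 200)))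
              (RMul (RMul (RCell 2 (NConst 0) (NConst 0)) (RCell 2 (NConst 0) (NConst 0))) (ROfNat (NVar 0)))))))"

lemma moment_prog_correct:
  assumes inp: "inputs k d r p Y s" and w: "\<And>i. i < k \<Longrightarrow> cell s 4 0 i = w i"
  shows "halts_within moment_prog (loop_time d (loop_time d (1 + loop_time k 1 + 1)))
    (\<lambda>s'. agree_off {4, 5, 6} {5} s s' \<and>
      (\<forall>a<d. \<forall>b<d. cell s' 5 a b = moment_mat k w Y a b * 200 / (r * r * real k))) s"
  unfolding moment_prog_def
proof (rule halts_within_fill_matrix)
  fix x y s1 assume x: "x < d" and y: "y < d" and s1: "agree_off {4, 5, 6} {5} s s1"
    and xy: "nvar s1 4 = x" "nvar s1 5 = y"
  have inp1: "inputs k d r p Y s1" using inputs_agree_off[OF inp s1] by simp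
  have w1: "cell s1 4 0 i = w i" if "i < k" for i using w[OF that] s1 by (simp add: agree_off_def)
  show "halts_within (Seq (sum_loop 6 (NVar 0) 5 (NVar 4) (NVar 5)
            (RMul (RMul (RCell 4 (NConst 0) (NVar 6)) (RCell 3 (NVar 6) (NVar 4))) (RCell 3 (NVar 6) (NVar 5))))
          (RAssign 5 (NVar 4) (NVar 5)
            (RDiv (RMul (RCell 5 (NVar 4) (NVar 5)) (ROfNat (NConst 200)))
              (RMul (RMul (RCell 2 (NConst 0) (NConst 0)) (RCell 2 (NConst 0) (NConst 0))) (ROfNat (NVar 0))))))
     (1 + loop_time k 1 + 1)
     (\<lambda>s''. agree_off {6} {5} s1 s'' \<and> cell s'' 5
        = (cell s1 5)(x := (cell s1 5 x)(y := moment_mat k w Y x y * 200 / (r * r * real k)))) s1"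
  proof (rule halts_within_Seq)
    show "halts_within (sum_loop 6 (NVar 0) 5 (NVar 4) (NVar 5)
            (RMul (RMul (RCell 4 (NConst 0) (NVar 6)) (RCell 3 (NVar 6) (NVar 4))) (RCell 3 (NVar 6) (NVar 5))))
       (1 + loop_time k 1) (\<lambda>s2. agree_off {6} {5} s1 s2 \<and>
         cell s2 5 = (cell s1 5)(x := (cell s1 5 x)(y := \<Sum>i<k. w i * Y i x * Y i y))) s1"
      by (rule halts_within_sum_loop) (use inp1 w1 x y xy in \<open>auto simp: agree_off_def inputs_def\<close>)
    fix s2 assume "agree_off {6} {5} s1 s2 \<and>
         cell s2 5 = (cell s1 5)(x := (cell s1 5 x)(y := \<Sum>i<k. w i * Y i x * Y i y))"
    then show "halts_within (RAssign 5 (NVar 4) (NVar 5)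
            (RDiv (RMul (RCell 5 (NVar 4) (NVar 5)) (ROfNat (NConst 200)))
              (RMul (RMul (RCell 2 (NConst 0) (NConst 0)) (RCell 2 (NConst 0) (NConst 0))) (ROfNat (NVar 0))))) 1
       (\<lambda>s''. agree_off {6} {5} s1 s'' \<and> cell s'' 5
        = (cell s1 5)(x := (cell s1 5 x)(y := moment_mat k w Y x y * 200 / (r * r * real k)))) s2"
      using inp1 xy by (intro halts_within_RAssign) (auto simp: agree_off_def inputs_def moment_mat_def)
  qed
qed (use inp in \<open>auto simp: agree_off_def inputs_def\<close>)

definition square_prog :: "nat \<Rightarrow> nat \<Rightarrow> com" where
  "square_prog a b = for_loop 4 (NVar 1) (for_loop 5 (NVar 1)
     (sum_loop 6 (NVar 1) b (NVar 4) (NVar 5) (RMul (RCell a (NVar 4) (NVar 6)) (RCell a (NVar 6) (NVar 5)))))"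

lemma square_prog_correct:
  assumes "nvar s 1 = d" "a \<noteq> b" and A: "\<And>i j. i < d \<Longrightarrow> j < d \<Longrightarrow> cell s a i j = A i j"
  shows "halts_within (square_prog a b) (loop_time d (loop_time d (1 + loop_time d 1)))
    (\<lambda>s'. agree_off {4, 5, 6} {b} s s' \<and> (\<forall>i<d. \<forall>j<d. cell s' b i j = mat_square d A i j)) s"
  unfolding square_prog_def
proof (rule halts_within_fill_matrix)
  fix x y s1 assume x: "x < d" and y: "y < d" and s1: "agree_off {4, 5, 6} {b} s s1"
    and xy: "nvar s1 4 = x" "nvar s1 5 = y"
  show "halts_within (sum_loop 6 (NVar 1) b (NVar 4) (NVar 5) (RMul (RCell a (NVar 4) (NVar 6)) (RCell a (NVar 6) (NVar 5))))
     (1 + loop_time d 1)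
     (\<lambda>s''. agree_off {6} {b} s1 s'' \<and> cell s'' b
        = (cell s1 b)(x := (cell s1 b x)(y := mat_square d A x y))) s1"
    unfolding mat_square_def mat_mult_def
    by (rule halts_within_sum_loop) (use s1 x y xy assms in \<open>auto simp: agree_off_def\<close>)
qed (use assms in \<open>auto simp: agree_off_def\<close>)

definition squarings_prog :: com where
  "squarings_prog = for_loop 7 (NVar 1) (Seq (square_prog 5 6) (square_prog 6 5))"

abbreviation square_time :: "nat \<Rightarrow> nat" where
  "square_time d \<equiv> loop_time d (loop_time d (1 + loop_time d 1))"

lemma squarings_prog_correct:
  assumes d: "nvar s 1 = d" and A: "\<And>i j. i < d \<Longrightarrow> j < d \<Longrightarrow> cell s 5 i j = A i j"
  shows "halts_within squarings_prog (loop_time d (square_time d + square_time d))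
    (\<lambda>s'. agree_off {4, 5, 6, 7} {5, 6} s s' \<and>
      (\<forall>i<d. \<forall>j<d. cell s' 5 i j = (mat_square d ^^ (2 * d)) A i j)) s"
proof -
  define I where "I m s' \<longleftrightarrow> agree_off {4, 5, 6, 7} {5, 6} s s' \<and>
      (\<forall>i<d. \<forall>j<d. cell s' 5 i j = (mat_square d ^^ (2 * m)) A i j)" for m s'
  have "halts_within squarings_prog (loop_time d (square_time d + square_time d)) (I d) s"
    unfolding squarings_prog_def
  proof (rule halts_within_for_loop)
    show "I 0 (set_nvar s 7 0)" using A by (simp add: I_def agree_off_def)
    show "nval (NVar 1) s' = d" if "I m s'" for m s'
      using that d by (simp add: I_def agree_off_def)
    show "halts_within (Seq (square_prog 5 6) (square_prog 6 5)) (square_time d + square_time d)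
        (\<lambda>s''. nvar s'' 7 = m \<and> I (Suc m) (set_nvar s'' 7 (Suc m))) s1"
      if m: "m < d" "nvar s1 7 = m" "I m s1" for m s1
    proof (rule halts_within_Seq)
      show "halts_within (square_prog 5 6) (square_time d)
        (\<lambda>s2. agree_off {4, 5, 6} {6} s1 s2 \<and>
          (\<forall>i<d. \<forall>j<d. cell s2 6 i j = mat_square d ((mat_square d ^^ (2 * m)) A) i j)) s1"
        using m d by (intro square_prog_correct) (auto simp: I_def agree_off_def)
      fix s2 assume s2: "agree_off {4, 5, 6} {6} s1 s2 \<and>
          (\<forall>i<d. \<forall>j<d. cell s2 6 i j = mat_square d ((mat_square d ^^ (2 * m)) A) i j)"
      have "halts_within (square_prog 6 5) (square_time d)
        (\<lambda>s3. agree_off {4, 5, 6} {5} s2 s3 \<and>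
          (\<forall>i<d. \<forall>j<d. cell s3 5 i j = mat_square d (mat_square d ((mat_square d ^^ (2 * m)) A)) i j)) s2"
        using m d s2 by (intro square_prog_correct) (auto simp: I_def agree_off_def)
      then show "halts_within (square_prog 6 5) (square_time d)
        (\<lambda>s''. nvar s'' 7 = m \<and> I (Suc m) (set_nvar s'' 7 (Suc m))) s2"
        by (rule halts_within_mono) (use m s2 in \<open>auto simp: I_def agree_off_def\<close>)
    qed
  qed
  then show ?thesis unfolding I_def .
qed

definition norm_prog :: com where
  "norm_prog = Seq
     (for_loop 4 (NVar 1) (sum_loop 6 (NVar 1) 8 (NConst 0) (NVar 4)
       (RMul (RCell 5 (NVar 4) (NVar 6)) (RCell 5 (NVar 4) (NVar 6)))))
     (sum_loop 6 (NVar 1) 10 (NConst 0) (NConst 0) (RCell 8 (NConst 0) (NVar 6)))"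

lemma norm_prog_correct:
  assumes d: "nvar s 1 = d" and N: "\<And>i j. i < d \<Longrightarrow> j < d \<Longrightarrow> cell s 5 i j = N i j"
  shows "halts_within norm_prog (loop_time d (1 + loop_time d 1) + (1 + loop_time d 1))
    (\<lambda>s'. agree_off {4, 6} {8, 10} s s' \<and> cell s' 10 0 0 = frob_inner d N N) s"
  unfolding norm_prog_def
proof (rule halts_within_Seq)
  let ?g = "\<lambda>i. \<Sum>j<d. N i j * N i j"
  show "halts_within (for_loop 4 (NVar 1) (sum_loop 6 (NVar 1) 8 (NConst 0) (NVar 4)
       (RMul (RCell 5 (NVar 4) (NVar 6)) (RCell 5 (NVar 4) (NVar 6))))) (loop_time d (1 + loop_time d 1))
     (\<lambda>s'. agree_off {4, 6} {8} s s' \<and> cell s' 8 = (cell s 8)(0 := \<lambda>z. if z < d then ?g z else cell s 8 0 z)) s"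
  proof (rule halts_within_fill_row)
    show "halts_within (sum_loop 6 (NVar 1) 8 (NConst 0) (NVar 4) (RMul (RCell 5 (NVar 4) (NVar 6)) (RCell 5 (NVar 4) (NVar 6))))
       (1 + loop_time d 1) (\<lambda>s''. agree_off {6} {8} s1 s'' \<and> cell s'' 8 = (cell s1 8)(0 := (cell s1 8 0)(y := ?g y))) s1"
      if "y < d" "agree_off {4, 6} {8} s s1" "nvar s1 4 = y" for y s1
      by (rule halts_within_sum_loop) (use that d N in \<open>auto simp: agree_off_def\<close>)
  qed (use d in \<open>auto simp: agree_off_def\<close>)
  fix s1 assume s1: "agree_off {4, 6} {8} s s1 \<and> cell s1 8 = (cell s 8)(0 := \<lambda>z. if z < d then ?g z else cell s 8 0 z)"
  have "halts_within (sum_loop 6 (NVar 1) 10 (NConst 0) (NConst 0) (RCell 8 (NConst 0) (NVar 6))) (1 + loop_time d 1)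
     (\<lambda>s'. agree_off {6} {10} s1 s' \<and> cell s' 10 = (cell s1 10)(0 := (cell s1 10 0)(0 := \<Sum>i<d. ?g i))) s1"
    by (rule halts_within_sum_loop) (use s1 d in \<open>auto simp: agree_off_def\<close>)
  then show "halts_within (sum_loop 6 (NVar 1) 10 (NConst 0) (NConst 0) (RCell 8 (NConst 0) (NVar 6))) (1 + loop_time d 1)
     (\<lambda>s'. agree_off {4, 6} {8, 10} s s' \<and> cell s' 10 0 0 = frob_inner d N N) s1"
    by (rule halts_within_mono) (use s1 in \<open>auto simp: agree_off_def frob_inner_def\<close>)
qed

definition score_prog :: com where
  "score_prog = Seq
     (for_loop 4 (NVar 0) (for_loop 5 (NVar 1)
       (sum_loop 6 (NVar 1) 7 (NVar 4) (NVar 5) (RMul (RCell 5 (NVar 5) (NVar 6)) (RCell 3 (NVar 4) (NVar 6))))))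
     (for_loop 4 (NVar 0) (sum_loop 6 (NVar 1) 9 (NConst 0) (NVar 4)
       (RMul (RCell 7 (NVar 4) (NVar 6)) (RCell 7 (NVar 4) (NVar 6)))))"

lemma score_prog_correct:
  assumes inp: "inputs k d r p Y s" and N: "\<And>i j. i < d \<Longrightarrow> j < d \<Longrightarrow> cell s 5 i j = N i j"
  shows "halts_within score_prog (loop_time k (loop_time d (1 + loop_time d 1)) + loop_time k (1 + loop_time d 1))
    (\<lambda>s'. agree_off {4, 5, 6} {7, 9} s s' \<and> (\<forall>i<k. cell s' 9 0 i = image_norm_sq d N (Y i))) s"
  unfolding score_prog_def
proof (rule halts_within_Seq)
  show "halts_within (for_loop 4 (NVar 0) (for_loop 5 (NVar 1)
       (sum_loop 6 (NVar 1) 7 (NVar 4) (NVar 5) (RMul (RCell 5 (NVar 5) (NVar 6)) (RCell 3 (NVar 4) (NVar 6))))))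
     (loop_time k (loop_time d (1 + loop_time d 1)))
     (\<lambda>s'. agree_off {4, 5, 6} {7} s s' \<and> (\<forall>i<k. \<forall>a<d. cell s' 7 i a = inner_prod d (N a) (Y i))) s"
  proof (rule halts_within_fill_matrix)
    show "halts_within (sum_loop 6 (NVar 1) 7 (NVar 4) (NVar 5) (RMul (RCell 5 (NVar 5) (NVar 6)) (RCell 3 (NVar 4) (NVar 6))))
       (1 + loop_time d 1) (\<lambda>s''. agree_off {6} {7} s1 s'' \<and>
         cell s'' 7 = (cell s1 7)(x := (cell s1 7 x)(y := inner_prod d (N y) (Y x)))) s1"
      if "x < k" "y < d" "agree_off {4, 5, 6} {7} s s1" "nvar s1 4 = x" "nvar s1 5 = y" for x y s1
      unfolding inner_prod_def
      by (rule halts_within_sum_loop) (use that inp N in \<open>auto simp: agree_off_def inputs_def\<close>)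
  qed (use inp in \<open>auto simp: agree_off_def inputs_def\<close>)
  fix s1 assume s1: "agree_off {4, 5, 6} {7} s s1 \<and> (\<forall>i<k. \<forall>a<d. cell s1 7 i a = inner_prod d (N a) (Y i))"
  have "halts_within (for_loop 4 (NVar 0) (sum_loop 6 (NVar 1) 9 (NConst 0) (NVar 4)
       (RMul (RCell 7 (NVar 4) (NVar 6)) (RCell 7 (NVar 4) (NVar 6))))) (loop_time k (1 + loop_time d 1))
     (\<lambda>s'. agree_off {4, 6} {9} s1 s' \<and>
       cell s' 9 = (cell s1 9)(0 := \<lambda>z. if z < k then image_norm_sq d N (Y z) else cell s1 9 0 z)) s1"
  proof (rule halts_within_fill_row)
    show "halts_within (sum_loop 6 (NVar 1) 9 (NConst 0) (NVar 4) (RMul (RCell 7 (NVar 4) (NVar 6)) (RCell 7 (NVar 4) (NVar 6))))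
       (1 + loop_time d 1) (\<lambda>s''. agree_off {6} {9} s2 s'' \<and>
         cell s'' 9 = (cell s2 9)(0 := (cell s2 9 0)(y := image_norm_sq d N (Y y)))) s2"
      if "y < k" "agree_off {4, 6} {9} s1 s2" "nvar s2 4 = y" for y s2
      unfolding image_norm_sq_def
      by (rule halts_within_sum_loop)
         (use that inp s1 in \<open>auto simp: agree_off_def inputs_def power2_eq_square\<close>)
  qed (use inp s1 in \<open>auto simp: agree_off_def inputs_def\<close>)
  then show "halts_within (for_loop 4 (NVar 0) (sum_loop 6 (NVar 1) 9 (NConst 0) (NVar 4)
       (RMul (RCell 7 (NVar 4) (NVar 6)) (RCell 7 (NVar 4) (NVar 6))))) (loop_time k (1 + loop_time d 1))
     (\<lambda>s'. agree_off {4, 5, 6} {7, 9} s s' \<and> (\<forall>i<k. cell s' 9 0 i = image_norm_sq d N (Y i))) s1"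
    by (rule halts_within_mono) (use s1 in \<open>auto simp: agree_off_def\<close>)
qed

definition max_prog :: com where
  "max_prog = Seq (RAssign 11 (NConst 0) (NConst 0) (ROfNat (NConst 0)))
     (for_loop 4 (NVar 0)
       (Cond (BAnd (RLess (ROfNat (NConst 0)) (RCell 4 (NConst 0) (NVar 4)))
                   (RLess (RCell 11 (NConst 0) (NConst 0)) (RCell 9 (NConst 0) (NVar 4))))
         (RAssign 11 (NConst 0) (NConst 0) (RCell 9 (NConst 0) (NVar 4))) Skip))"

lemma max_prog_correct:
  assumes k: "nvar s 0 = k"
  shows "halts_within max_prog (1 + loop_time k (1 + 1))
    (\<lambda>s'. agree_off {4} {11} s s' \<and> cell s' 11 0 0 = max_score (cell s 4 0) (cell s 9 0) k) s"
  unfolding max_prog_def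
proof (rule halts_within_Seq)
  show "halts_within (RAssign 11 (NConst 0) (NConst 0) (ROfNat (NConst 0))) 1
      (\<lambda>s'. agree_off {} {11} s s' \<and> cell s' 11 0 0 = 0) s"
    by (rule halts_within_RAssign) (simp add: agree_off_def)
  fix s1 assume s1: "agree_off {} {11} s s1 \<and> cell s1 11 0 0 = 0"
  define I where "I m s' \<longleftrightarrow> agree_off {4} {11} s s' \<and> cell s' 11 0 0 = max_score (cell s 4 0) (cell s 9 0) m" for m s'
  let ?c = "Cond (BAnd (RLess (ROfNat (NConst 0)) (RCell 4 (NConst 0) (NVar 4)))
                   (RLess (RCell 11 (NConst 0) (NConst 0)) (RCell 9 (NConst 0) (NVar 4))))
         (RAssign 11 (NConst 0) (NConst 0) (RCell 9 (NConst 0) (NVar 4))) Skip"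
  have "halts_within (for_loop 4 (NVar 0) ?c) (loop_time k (1 + 1)) (I k) s1"
  proof (rule halts_within_for_loop)
    show "I 0 (set_nvar s1 4 0)" using s1 by (simp add: I_def agree_off_def)
    show "nval (NVar 0) s' = k" if "I m s'" for m s'
      using that k by (simp add: I_def agree_off_def)
    show "halts_within ?c (1 + 1) (\<lambda>s''. nvar s'' 4 = m \<and> I (Suc m) (set_nvar s'' 4 (Suc m))) s2"
      if "m < k" "nvar s2 4 = m" "I m s2" for m s2
      using that by (intro halts_within_Cond halts_within_RAssign halts_within_Skip)
        (auto simp: I_def agree_off_def)
  qed
  then show "halts_within (for_loop 4 (NVar 0) ?c) (loop_time k (1 + 1))
      (\<lambda>s'. agree_off {4} {11} s s' \<and> cell s' 11 0 0 = max_score (cell s 4 0) (cell s 9 0) k) s1"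
    unfolding I_def .
qed

definition update_prog :: com where
  "update_prog = for_loop 4 (NVar 0) (RAssign 4 (NConst 0) (NVar 4)
     (RMul (RCell 4 (NConst 0) (NVar 4)) (RSub (ROfNat (NConst 1))
       (RDiv (RCell 9 (NConst 0) (NVar 4)) (RCell 11 (NConst 0) (NConst 0))))))"

lemma update_prog_correct:
  assumes k: "nvar s 0 = k"
  shows "halts_within update_prog (loop_time k 1)
    (\<lambda>s'. agree_off {4} {4} s s' \<and>
      (\<forall>i<k. cell s' 4 0 i = cell s 4 0 i * (1 - cell s 9 0 i / cell s 11 0 0))) s"
proof -
  have "halts_within update_prog (loop_time k 1)
    (\<lambda>s'. agree_off {4} {4} s s' \<and> cell s' 4 = (cell s 4)(0 := \<lambda>z. if z < k
      then cell s 4 0 z * (1 - cell s 9 0 z / cell s 11 0 0) else cell s 4 0 z)) s"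
    unfolding update_prog_def
    by (rule halts_within_fill_row, use k in \<open>simp add: agree_off_def\<close>, simp,
        rule halts_within_RAssign) (auto simp: agree_off_def)
  then show ?thesis by (rule halts_within_mono) auto
qed

lemma max_score_cong:
  "(\<And>i. i < n \<Longrightarrow> w i = w' i) \<Longrightarrow> (\<And>i. i < n \<Longrightarrow> \<tau> i = \<tau>' i) \<Longrightarrow> max_score w \<tau> n = max_score w' \<tau>' n"
  by (induction n) auto

definition round_prog :: com where
  "round_prog = Seq moment_prog (Seq squarings_prog (Seq norm_prog
     (Cond (RLess (ROfNat (NConst 1)) (RCell 10 (NConst 0) (NConst 0)))
       (Seq score_prog (Seq max_prog update_prog)) Skip)))"

definition round_time :: "nat \<Rightarrow> nat \<Rightarrow> nat" where
  "round_time k d = loop_time d (loop_time d (1 + loop_time k 1 + 1)) +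
     (loop_time d (square_time d + square_time d) +
     ((loop_time d (1 + loop_time d 1) + (1 + loop_time d 1)) +
     (((loop_time k (loop_time d (1 + loop_time d 1)) + loop_time k (1 + loop_time d 1)) +
       ((1 + loop_time k (1 + 1)) + loop_time k 1)) + 1)))"

lemma round_prog_correct:
  assumes inp: "inputs k d r p Y s" and w: "\<And>i. i < k \<Longrightarrow> cell s 4 0 i = w i"
  defines "N \<equiv> filter_mat k d r Y w"
  shows "halts_within round_prog (round_time k d)
    (\<lambda>s'. agree_off {4, 5, 6, 7} {4, 5, 6, 7, 8, 9, 10, 11} s s' \<and>
      (\<forall>i<k. cell s' 4 0 i = filter_step k d r Y w i) \<and> cell s' 10 0 0 = frob_inner d N N) s"
  unfolding round_prog_def round_time_def
proof (rule halts_within_Seq, rule moment_prog_correct[OF inp w], assumption)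
  fix s1 assume s1: "agree_off {4, 5, 6} {5} s s1 \<and>
      (\<forall>a<d. \<forall>b<d. cell s1 5 a b = moment_mat k w Y a b * 200 / (r * r * real k))"
  have inp1: "inputs k d r p Y s1" using inputs_agree_off[OF inp conjunct1[OF s1]] by simp
  show "halts_within (Seq squarings_prog (Seq norm_prog
     (Cond (RLess (ROfNat (NConst 1)) (RCell 10 (NConst 0) (NConst 0)))
       (Seq score_prog (Seq max_prog update_prog)) Skip)))
     (loop_time d (square_time d + square_time d) +
     ((loop_time d (1 + loop_time d 1) + (1 + loop_time d 1)) +
     (((loop_time k (loop_time d (1 + loop_time d 1)) + loop_time k (1 + loop_time d 1)) +
       ((1 + loop_time k (1 + 1)) + loop_time k 1)) + 1)))
    (\<lambda>s'. agree_off {4, 5, 6, 7} {4, 5, 6, 7, 8, 9, 10, 11} s s' \<and>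
      (\<forall>i<k. cell s' 4 0 i = filter_step k d r Y w i) \<and> cell s' 10 0 0 = frob_inner d N N) s1"
  proof (rule halts_within_Seq)
    show "halts_within squarings_prog (loop_time d (square_time d + square_time d))
        (\<lambda>s'. agree_off {4, 5, 6, 7} {5, 6} s1 s' \<and> (\<forall>i<d. \<forall>j<d. cell s' 5 i j = N i j)) s1"
      unfolding N_def filter_mat_def
      by (rule squarings_prog_correct) (use inp1 s1 in \<open>auto simp: inputs_def\<close>)
    fix s2 assume s2: "agree_off {4, 5, 6, 7} {5, 6} s1 s2 \<and> (\<forall>i<d. \<forall>j<d. cell s2 5 i j = N i j)"
    have inp2: "inputs k d r p Y s2" using inputs_agree_off[OF inp1 conjunct1[OF s2]] by simp
    show "halts_within (Seq norm_prog
       (Cond (RLess (ROfNat (NConst 1)) (RCell 10 (NConst 0) (NConst 0)))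
         (Seq score_prog (Seq max_prog update_prog)) Skip))
      ((loop_time d (1 + loop_time d 1) + (1 + loop_time d 1)) +
       (((loop_time k (loop_time d (1 + loop_time d 1)) + loop_time k (1 + loop_time d 1)) +
       ((1 + loop_time k (1 + 1)) + loop_time k 1)) + 1))
      (\<lambda>s'. agree_off {4, 5, 6, 7} {4, 5, 6, 7, 8, 9, 10, 11} s s' \<and>
        (\<forall>i<k. cell s' 4 0 i = filter_step k d r Y w i) \<and> cell s' 10 0 0 = frob_inner d N N) s2"
    proof (rule halts_within_Seq)
      show "halts_within norm_prog (loop_time d (1 + loop_time d 1) + (1 + loop_time d 1))
        (\<lambda>s'. agree_off {4, 6} {8, 10} s2 s' \<and> cell s' 10 0 0 = frob_inner d N N) s2"
        by (rule norm_prog_correct) (use inp2 s2 in \<open>auto simp: inputs_def\<close>)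
      fix s3 assume s3: "agree_off {4, 6} {8, 10} s2 s3 \<and> cell s3 10 0 0 = frob_inner d N N"
      have inp3: "inputs k d r p Y s3" using inputs_agree_off[OF inp2 conjunct1[OF s3]] by simp
      have w3: "cell s3 4 0 i = w i" if "i < k" for i
        using w[OF that] s1 s2 s3 by (simp add: agree_off_def)
      have off3: "agree_off {4, 5, 6, 7} {5, 6, 8, 10} s s3"
        using s1 s2 s3 by (simp add: agree_off_def)
      show "halts_within (Cond (RLess (ROfNat (NConst 1)) (RCell 10 (NConst 0) (NConst 0)))
         (Seq score_prog (Seq max_prog update_prog)) Skip)
       (((loop_time k (loop_time d (1 + loop_time d 1)) + loop_time k (1 + loop_time d 1)) +
         ((1 + loop_time k (1 + 1)) + loop_time k 1)) + 1)
       (\<lambda>s'. agree_off {4, 5, 6, 7} {4, 5, 6, 7, 8, 9, 10, 11} s s' \<and>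
        (\<forall>i<k. cell s' 4 0 i = filter_step k d r Y w i) \<and> cell s' 10 0 0 = frob_inner d N N) s3"
      proof (rule halts_within_Cond)
        assume "\<not> bval (RLess (ROfNat (NConst 1)) (RCell 10 (NConst 0) (NConst 0))) s3"
        then have "filter_step k d r Y w = w"
          using s3 by (simp add: filter_step_def Let_def N_def)
        then have "halts_within Skip 1
          (\<lambda>s'. agree_off {4, 5, 6, 7} {4, 5, 6, 7, 8, 9, 10, 11} s s' \<and>
            (\<forall>i<k. cell s' 4 0 i = filter_step k d r Y w i) \<and> cell s' 10 0 0 = frob_inner d N N) s3"
          using off3 s3 w3 by (intro halts_within_Skip) (auto intro: agree_off_mono)
        then show "halts_within Skip
         ((loop_time k (loop_time d (1 + loop_time d 1)) + loop_time k (1 + loop_time d 1)) +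
           ((1 + loop_time k (1 + 1)) + loop_time k 1))
          (\<lambda>s'. agree_off {4, 5, 6, 7} {4, 5, 6, 7, 8, 9, 10, 11} s s' \<and>
            (\<forall>i<k. cell s' 4 0 i = filter_step k d r Y w i) \<and> cell s' 10 0 0 = frob_inner d N N) s3"
          by (rule halts_within_mono) auto
      next
        assume uncert: "bval (RLess (ROfNat (NConst 1)) (RCell 10 (NConst 0) (NConst 0))) s3"
        define \<tau> where "\<tau> = (\<lambda>i. image_norm_sq d N (Y i))"
        have step: "filter_step k d r Y w i = w i * (1 - \<tau> i / max_score w \<tau> k)" for i
          using uncert s3 by (simp add: filter_step_def Let_def N_def \<tau>_def)
        show "halts_within (Seq score_prog (Seq max_prog update_prog))
         ((loop_time k (loop_time d (1 + loop_time d 1)) + loop_time k (1 + loop_time d 1)) +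
           ((1 + loop_time k (1 + 1)) + loop_time k 1))
          (\<lambda>s'. agree_off {4, 5, 6, 7} {4, 5, 6, 7, 8, 9, 10, 11} s s' \<and>
            (\<forall>i<k. cell s' 4 0 i = filter_step k d r Y w i) \<and> cell s' 10 0 0 = frob_inner d N N) s3"
        proof (rule halts_within_Seq)
          show "halts_within score_prog
              (loop_time k (loop_time d (1 + loop_time d 1)) + loop_time k (1 + loop_time d 1))
              (\<lambda>s'. agree_off {4, 5, 6} {7, 9} s3 s' \<and> (\<forall>i<k. cell s' 9 0 i = \<tau> i)) s3"
            unfolding \<tau>_def
            by (rule score_prog_correct[OF inp3]) (use s2 s3 in \<open>auto simp: agree_off_def\<close>)
          fix s4 assume s4: "agree_off {4, 5, 6} {7, 9} s3 s4 \<and> (\<forall>i<k. cell s4 9 0 i = \<tau> i)"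
          have inp4: "inputs k d r p Y s4" using inputs_agree_off[OF inp3 conjunct1[OF s4]] by simp
          have w4: "cell s4 4 0 i = w i" if "i < k" for i
            using w3[OF that] s4 by (simp add: agree_off_def)
          have mx: "max_score (cell s4 4 0) (cell s4 9 0) k = max_score w \<tau> k"
            using w4 s4 by (intro max_score_cong) auto
          show "halts_within (Seq max_prog update_prog) ((1 + loop_time k (1 + 1)) + loop_time k 1)
            (\<lambda>s'. agree_off {4, 5, 6, 7} {4, 5, 6, 7, 8, 9, 10, 11} s s' \<and>
              (\<forall>i<k. cell s' 4 0 i = filter_step k d r Y w i) \<and> cell s' 10 0 0 = frob_inner d N N) s4"
          proof (rule halts_within_Seq, rule max_prog_correct)
            show "nvar s4 0 = k" using inp4 by (simp add: inputs_def)
            fix s5 assume s5: "agree_off {4} {11} s4 s5 \<and>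
              cell s5 11 0 0 = max_score (cell s4 4 0) (cell s4 9 0) k"
            have "nvar s5 0 = k" using s5 inp4 by (simp add: inputs_def agree_off_def)
            from update_prog_correct[OF this]
            show "halts_within update_prog (loop_time k 1)
              (\<lambda>s'. agree_off {4, 5, 6, 7} {4, 5, 6, 7, 8, 9, 10, 11} s s' \<and>
                (\<forall>i<k. cell s' 4 0 i = filter_step k d r Y w i) \<and> cell s' 10 0 0 = frob_inner d N N) s5"
            proof (rule halts_within_mono[OF _ order_refl])
              fix s6 assume s6: "agree_off {4} {4} s5 s6 \<and>
                (\<forall>i<k. cell s6 4 0 i = cell s5 4 0 i * (1 - cell s5 9 0 i / cell s5 11 0 0))"
              have "agree_off {4, 5, 6, 7} {4, 5, 6, 7, 8, 9, 10, 11} s s6"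
                using off3 s4 s5 s6 by (simp add: agree_off_def)
              moreover have "cell s6 4 0 i = filter_step k d r Y w i" if "i < k" for i
                using that s4 s5 s6 w4[OF that] mx by (simp add: step agree_off_def)
              moreover have "cell s6 10 0 0 = frob_inner d N N"
                using s3 s4 s5 s6 by (simp add: agree_off_def)
              ultimately show "agree_off {4, 5, 6, 7} {4, 5, 6, 7, 8, 9, 10, 11} s s6 \<and>
                (\<forall>i<k. cell s6 4 0 i = filter_step k d r Y w i) \<and> cell s6 10 0 0 = frob_inner d N N" by blast
            qed
          qed
        qed
      qed
    qed
  qed
qed

definition init_prog :: com where
  "init_prog = Seq (for_loop 4 (NVar 0) (RAssign 4 (NConst 0) (NVar 4) (ROfNat (NConst 1))))
     (for_loop 4 (NVar 0) (for_loop 5 (NVar 1) (RAssign 3 (NVar 4) (NVar 5)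
       (RSub (RCell 0 (NVar 4) (NVar 5)) (RCell 1 (NConst 0) (NVar 5))))))"

lemma init_prog_correct:
  "halts_within init_prog (loop_time k 1 + loop_time k (loop_time d 1))
    (\<lambda>s. inputs k d r p (\<lambda>i j. Z i j - x j) s \<and> (\<forall>i<k. cell s 4 0 i = 1) \<and> nvar s 2 = 0)
    (initial_state k d Z x r p)"
  unfolding init_prog_def
proof (rule halts_within_Seq)
  let ?s = "initial_state k d Z x r p"
  show "halts_within (for_loop 4 (NVar 0) (RAssign 4 (NConst 0) (NVar 4) (ROfNat (NConst 1)))) (loop_time k 1)
     (\<lambda>s'. agree_off {4} {4} ?s s' \<and> cell s' 4 = (cell ?s 4)(0 := \<lambda>z. if z < k then 1 else cell ?s 4 0 z)) ?s"
    by (rule halts_within_fill_row, simp add: agree_off_def initial_state_def, simp, rule halts_within_RAssign)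
       (auto simp: agree_off_def)
  fix s1 assume s1: "agree_off {4} {4} ?s s1 \<and> cell s1 4 = (cell ?s 4)(0 := \<lambda>z. if z < k then 1 else cell ?s 4 0 z)"
  have "halts_within (for_loop 4 (NVar 0) (for_loop 5 (NVar 1) (RAssign 3 (NVar 4) (NVar 5)
       (RSub (RCell 0 (NVar 4) (NVar 5)) (RCell 1 (NConst 0) (NVar 5)))))) (loop_time k (loop_time d 1))
     (\<lambda>s'. agree_off {4, 5} {3} s1 s' \<and> (\<forall>i<k. \<forall>j<d. cell s' 3 i j = Z i j - x j)) s1"
  proof (rule halts_within_fill_matrix)
    fix a b s2 assume "a < k" "b < d" "agree_off {4, 5} {3} s1 s2" "nvar s2 4 = a" "nvar s2 5 = b"
    then show "halts_within (RAssign 3 (NVar 4) (NVar 5)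
       (RSub (RCell 0 (NVar 4) (NVar 5)) (RCell 1 (NConst 0) (NVar 5)))) 1
       (\<lambda>s''. agree_off {} {3} s2 s'' \<and> cell s'' 3 = (cell s2 3)(a := (cell s2 3 a)(b := Z a b - x b))) s2"
      using s1 by (intro halts_within_RAssign) (auto simp: agree_off_def initial_state_def)
  qed (use s1 in \<open>auto simp: agree_off_def initial_state_def\<close>)
  then show "halts_within (for_loop 4 (NVar 0) (for_loop 5 (NVar 1) (RAssign 3 (NVar 4) (NVar 5)
       (RSub (RCell 0 (NVar 4) (NVar 5)) (RCell 1 (NConst 0) (NVar 5)))))) (loop_time k (loop_time d 1))
    (\<lambda>s. inputs k d r p (\<lambda>i j. Z i j - x j) s \<and> (\<forall>i<k. cell s 4 0 i = 1) \<and> nvar s 2 = 0) s1"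
    by (rule halts_within_mono) (use s1 in \<open>auto simp: agree_off_def initial_state_def inputs_def\<close>)
qed

text \<open>
  The loop runs \<open>k + 1\<close> times so that the last norm computed belongs to the weights after \<open>k\<close> rounds; if it
  is at most 1, these are also the final weights.
\<close>

definition certify :: com where
  "certify = Seq init_prog
     (Seq (for_loop 3 (NAdd (NVar 0) (NConst 1)) round_prog)
     (Seq (sum_loop 6 (NVar 0) 11 (NConst 0) (NConst 1) (RSub (ROfNat (NConst 1)) (RCell 4 (NConst 0) (NVar 6))))
     (Cond (BAnd (BNot (RLess (ROfNat (NConst 1)) (RCell 10 (NConst 0) (NConst 0))))
           (BAnd (BNot (RLess (RDiv (ROfNat (NVar 0)) (ROfNat (NConst 200))) (RCell 11 (NConst 0) (NConst 1))))
                 (BNot (RLess (RCell 2 (NConst 0) (NConst 1)) (RDiv (ROfNat (NConst 1)) (ROfNat (NConst 100)))))))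
       (NAssign 2 (NConst 1)) Skip)))"

definition certify_time :: "nat \<Rightarrow> nat \<Rightarrow> nat" where
  "certify_time k d = (loop_time k 1 + loop_time k (loop_time d 1)) +
     (loop_time (k + 1) (round_time k d) + ((1 + loop_time k 1) + (1 + 1)))"

lemma certify_correct:
  "halts_within certify (certify_time k d)
     (\<lambda>s. verdict_of s = (if accepts k d r p (\<lambda>i j. Z i j - x j) then YES else DO_NOT_KNOW))
     (initial_state k d Z x r p)"
  unfolding certify_def certify_time_def
proof (rule halts_within_Seq[OF init_prog_correct])
  let ?Y = "\<lambda>i j. Z i j - x j"
  let ?w = "filter_weights k d r ?Y"
  let ?N = "\<lambda>m. filter_mat k d r ?Y (?w m)"
  let ?out = "\<lambda>s. verdict_of s = (if accepts k d r p ?Y then YES else DO_NOT_KNOW)"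
  let ?sum = "sum_loop 6 (NVar 0) 11 (NConst 0) (NConst 1) (RSub (ROfNat (NConst 1)) (RCell 4 (NConst 0) (NVar 6)))"
  let ?test = "BAnd (BNot (RLess (ROfNat (NConst 1)) (RCell 10 (NConst 0) (NConst 0))))
           (BAnd (BNot (RLess (RDiv (ROfNat (NVar 0)) (ROfNat (NConst 200))) (RCell 11 (NConst 0) (NConst 1))))
                 (BNot (RLess (RCell 2 (NConst 0) (NConst 1)) (RDiv (ROfNat (NConst 1)) (ROfNat (NConst 100))))))"
  fix s1 assume s1: "inputs k d r p ?Y s1 \<and> (\<forall>i<k. cell s1 4 0 i = 1) \<and> nvar s1 2 = 0"
  define I where "I m s \<longleftrightarrow> agree_off {3, 4, 5, 6, 7} {4, 5, 6, 7, 8, 9, 10, 11} s1 s \<and>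
    (\<forall>i<k. cell s 4 0 i = ?w m i) \<and> (\<forall>l. m = Suc l \<longrightarrow> cell s 10 0 0 = frob_inner d (?N l) (?N l))" for m s
  have I_inputs: "inputs k d r p ?Y s" if "I m s" for m s
    using inputs_agree_off[OF conjunct1[OF s1] conjunct1[OF that[unfolded I_def]]] by simp
  show "halts_within (Seq (for_loop 3 (NAdd (NVar 0) (NConst 1)) round_prog) (Seq ?sum (Cond ?test (NAssign 2 (NConst 1)) Skip)))
     (loop_time (k + 1) (round_time k d) + ((1 + loop_time k 1) + (1 + 1))) ?out s1"
  proof (rule halts_within_Seq[where R = "I (k + 1)"])
    show "halts_within (for_loop 3 (NAdd (NVar 0) (NConst 1)) round_prog) (loop_time (k + 1) (round_time k d)) (I (k + 1)) s1"
    proof (rule halts_within_for_loop)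
      show "I 0 (set_nvar s1 3 0)" using s1 by (simp add: I_def agree_off_def filter_weights_def)
      show "nval (NAdd (NVar 0) (NConst 1)) s = k + 1" if "I m s" for m s
        using I_inputs[OF that] by (simp add: inputs_def)
      show "halts_within round_prog (round_time k d) (\<lambda>s'. nvar s' 3 = m \<and> I (Suc m) (set_nvar s' 3 (Suc m))) s"
        if m: "m < k + 1" "nvar s 3 = m" "I m s" for m s
      proof (rule halts_within_mono[OF round_prog_correct[OF I_inputs[OF m(3)], of "?w m"] order_refl])
        show "cell s 4 0 i = ?w m i" if "i < k" for i using m(3) that by (simp add: I_def)
        have w_Suc: "?w (Suc m) = filter_step k d r ?Y (?w m)" by (simp add: filter_weights_def)
        show "nvar s' 3 = m \<and> I (Suc m) (set_nvar s' 3 (Suc m))"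
          if "agree_off {4, 5, 6, 7} {4, 5, 6, 7, 8, 9, 10, 11} s s' \<and>
            (\<forall>i<k. cell s' 4 0 i = filter_step k d r ?Y (?w m) i) \<and> cell s' 10 0 0 = frob_inner d (?N m) (?N m)" for s'
          using that m unfolding I_def w_Suc by (auto simp: agree_off_def)
      qed
    qed
    fix s2 assume s2: "I (k + 1) s2"
    note inp2 = I_inputs[OF s2]
    show "halts_within (Seq ?sum (Cond ?test (NAssign 2 (NConst 1)) Skip)) ((1 + loop_time k 1) + (1 + 1)) ?out s2"
    proof (rule halts_within_Seq)
      show "halts_within ?sum (1 + loop_time k 1) (\<lambda>s'. agree_off {6} {11} s2 s' \<and>
          cell s' 11 = (cell s2 11)(0 := (cell s2 11 0)(1 := \<Sum>i<k. 1 - ?w (k + 1) i))) s2"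
        by (rule halts_within_sum_loop) (use inp2 s2 in \<open>auto simp: agree_off_def inputs_def I_def\<close>)
      fix s3 assume s3: "agree_off {6} {11} s2 s3 \<and>
          cell s3 11 = (cell s2 11)(0 := (cell s2 11 0)(1 := \<Sum>i<k. 1 - ?w (k + 1) i))"
      have "nvar s3 2 = 0" using s1 s2 s3 by (simp add: I_def agree_off_def)
      moreover have "bval ?test s3 \<longleftrightarrow> accepts k d r p ?Y"
      proof -
        have "cell s3 10 0 0 = frob_inner d (?N k) (?N k)" using s2 s3 by (simp add: I_def agree_off_def)
        moreover have "cell s3 11 0 1 = (\<Sum>i<k. 1 - ?w (k + 1) i)" using s3 by simp
        moreover have "cell s3 2 0 1 = p" "nvar s3 0 = k"
          using inp2 s3 by (simp_all add: inputs_def agree_off_def)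
        moreover have "?w (k + 1) = ?w k" if "frob_inner d (?N k) (?N k) \<le> 1"
          using that by (simp add: filter_weights_def filter_step_def Let_def)
        ultimately show ?thesis by (auto simp: accepts_def Let_def not_less)
      qed
      ultimately show "halts_within (Cond ?test (NAssign 2 (NConst 1)) Skip) (1 + 1) ?out s3"
        by (intro halts_within_Cond halts_within_NAssign halts_within_Skip) (simp_all add: verdict_of_def)
    qed
  qed
qed

lemma certify_outputs:
  "outputs certify k d Z x r p v
     \<longleftrightarrow> v = (if accepts k d r p (\<lambda>i j. Z i j - x j) then YES else DO_NOT_KNOW)"
proof -
  obtain t s where "exec certify (initial_state k d Z x r p) t s"
    "verdict_of s = (if accepts k d r p (\<lambda>i j. Z i j - x j) then YES else DO_NOT_KNOW)"
    using certify_correct unfolding halts_within_def by blast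
  then show ?thesis unfolding outputs_def using exec_deterministic by metis
qed

lemma certification_algorithm_certify: "certification_algorithm certify"
  unfolding certification_algorithm_def certify_outputs
  using accepts_imp_central by auto

lemma polynomial_time_certify: "polynomial_time certify"
proof -
  have "poly_bounded certify_time"
    unfolding certify_time_def round_time_def
    by (intro poly_bounded_add poly_bounded_loop_time poly_bounded_const poly_bounded_fst poly_bounded_snd)
  then obtain A m where "\<And>k d. 1 \<le> k \<Longrightarrow> 1 \<le> d \<Longrightarrow> certify_time k d \<le> A * (k * d) ^ m"
    unfolding poly_bounded_def by blast
  then show ?thesis
    unfolding polynomial_time_def using certify_correct unfolding halts_within_def
    by (meson order_trans)
qed

section \<open>Probability of acceptance\<close>

text \<open>
  The weights are built from the data by finitely many arithmetic operations and comparisons.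
\<close>

lemma accepts_measurable:
  assumes Y: "\<And>i j. i < k \<Longrightarrow> j < d \<Longrightarrow> (\<lambda>x. Y x i j) \<in> borel_measurable M"
  shows "{x \<in> space M. accepts k d r p (Y x)} \<in> sets M"
proof -
  have mat: "(\<lambda>x. filter_mat k d r (Y x) (w x) a b) \<in> borel_measurable M"
    if w: "\<And>i. i < k \<Longrightarrow> (\<lambda>x. w x i) \<in> borel_measurable M" and ab: "a < d" "b < d" for w a b
  proof -
    have "(\<lambda>x. (mat_square d ^^ n) (\<lambda>a b. moment_mat k (w x) (Y x) a b * 200 / (r * r * real k)) a b) \<in> borel_measurable M"
      for n using ab
    proof (induction n arbitrary: a b)
      case 0
      then show ?case unfolding moment_mat_def using w Y by simp
    next
      case (Suc n)
      then show ?case by (simp add: mat_square_def mat_mult_def)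
    qed
    then show ?thesis by (simp add: filter_mat_def)
  qed
  have frob_mat: "(\<lambda>x. frob_inner d (filter_mat k d r (Y x) (w x)) (filter_mat k d r (Y x) (w x))) \<in> borel_measurable M"
    if w: "\<And>i. i < k \<Longrightarrow> (\<lambda>x. w x i) \<in> borel_measurable M" for w
    unfolding frob_inner_def using mat[OF w] by (intro borel_measurable_sum borel_measurable_times) auto
  have weights: "(\<lambda>x. filter_weights k d r (Y x) t i) \<in> borel_measurable M" if "i < k" for t i
    using that
  proof (induction t arbitrary: i)
    case 0
    then show ?case by (simp add: filter_weights_def)
  next
    case (Suc t)
    define w where "w x = filter_weights k d r (Y x) t" for x
    have w: "(\<lambda>x. w x i) \<in> borel_measurable M" if "i < k" for i
      using Suc.IH that by (simp add: w_def)
    define \<tau> where "\<tau> = (\<lambda>x i. image_norm_sq d (filter_mat k d r (Y x) (w x)) (Y x i))"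
    have \<tau>: "(\<lambda>x. \<tau> x i) \<in> borel_measurable M" if "i < k" for i
      unfolding \<tau>_def image_norm_sq_def inner_prod_def using mat[OF w] Y that
      by (intro borel_measurable_sum borel_measurable_power borel_measurable_times) auto
    have mx: "n \<le> k \<Longrightarrow> (\<lambda>x. max_score (w x) (\<tau> x) n) \<in> borel_measurable M" for n
    proof (induction n)
      case (Suc n)
      have [measurable]: "(\<lambda>x. w x n) \<in> borel_measurable M" "(\<lambda>x. \<tau> x n) \<in> borel_measurable M"
        "(\<lambda>x. max_score (w x) (\<tau> x) n) \<in> borel_measurable M"
        using Suc w \<tau> by auto
      show ?case unfolding max_score.simps by measurable
    qed simp
    note [measurable] = w[OF Suc.prems] \<tau>[OF Suc.prems] mx[OF order_refl] frob_mat[of w, OF w]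
    have "(\<lambda>x. if 1 < frob_inner d (filter_mat k d r (Y x) (w x)) (filter_mat k d r (Y x) (w x))
        then w x i * (1 - \<tau> x i / max_score (w x) (\<tau> x) k) else w x i) \<in> borel_measurable M"
      by measurable
    moreover have "filter_weights k d r (Y x) (Suc t) i
      = (if 1 < frob_inner d (filter_mat k d r (Y x) (w x)) (filter_mat k d r (Y x) (w x))
        then w x i * (1 - \<tau> x i / max_score (w x) (\<tau> x) k) else w x i)" for x
      by (simp add: filter_weights_def filter_step_def Let_def w_def \<tau>_def)
    ultimately show ?case by simp
  qed
  have [measurable]: "(\<lambda>x. \<Sum>i<k. 1 - filter_weights k d r (Y x) k i) \<in> borel_measurable M"
    using weights by (intro borel_measurable_sum borel_measurable_diff) auto
  note [measurable] = frob_mat[of "\<lambda>x. filter_weights k d r (Y x) k", OF weights]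
  show ?thesis unfolding accepts_def Let_def by measurable
qed

theorem theorem2p4:
  "\<exists>(c :: real) (C :: real) (alg :: com).
     c > 0 \<and> C > 0 \<and> certification_algorithm alg \<and> polynomial_time alg \<and>
     (\<forall>(k :: nat) (d :: nat) (D :: (nat \<Rightarrow> real) measure).
        k \<ge> 1 \<longrightarrow> d \<ge> 1 \<longrightarrow> random_vector_law d D \<longrightarrow>
        (\<exists>i<d. \<exists>j<d. covariance D i j \<noteq> 0) \<longrightarrow>
        measure (iid_law k D)
          {Z \<in> space (iid_law k D).
             outputs alg k d Z (mean D)
               (C * (sqrt (mat_trace d (covariance D) / real k) + sqrt (op_norm d (covariance D))))
               (1 / 100) YES}
          \<ge> 1 - 2 powr (- c * real k))"
proof -
  obtain C where C: "0 < C" and good: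
    "\<And>k d D r. 1 \<le> k \<Longrightarrow> 1 \<le> d \<Longrightarrow> random_vector_law d D \<Longrightarrow>
       0 < mat_trace d (covariance D) \<Longrightarrow>
       r = C * (sqrt (mat_trace d (covariance D) / real k) + sqrt (op_norm d (covariance D))) \<Longrightarrow>
       0 < r \<and> (\<exists>B \<in> sets (iid_law k D). measure (iid_law k D) B \<le> (1 / 2) ^ k \<and>
         (\<forall>Z \<in> space (iid_law k D) - B.
            spread k d (\<lambda>i. centered D (Z i)) (r\<^sup>2 / 1600) (real k / 400)))"
    using spread_with_high_probability by blast
  have prob: "1 - 2 powr (- 1 * real k) \<le> measure (iid_law k D) {Z \<in> space (iid_law k D).
       outputs certify k d Z (mean D)
         (C * (sqrt (mat_trace d (covariance D) / real k) + sqrt (op_norm d (covariance D)))) (1 / 100) YES}"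
    if k: "1 \<le> k" and d: "1 \<le> d" and law: "random_vector_law d D"
      and nz: "\<exists>i<d. \<exists>j<d. covariance D i j \<noteq> 0" for k d :: nat and D :: "(nat \<Rightarrow> real) measure"
  proof -
    define r where "r = C * (sqrt (mat_trace d (covariance D) / real k) + sqrt (op_norm d (covariance D)))"
    define S where "S = {Z \<in> space (iid_law k D). accepts k d r (1 / 100) (\<lambda>i. centered D (Z i))}"
    interpret P: prob_space "iid_law k D"
      unfolding iid_law_def by (intro prob_space_PiM law_prob_space[OF law])
    have "0 < mat_trace d (covariance D)" using nz mat_trace_covariance_pos[OF law] by blast
    from good[OF k d law this r_def] obtain B where r: "0 < r" and B: "B \<in> sets (iid_law k D)"
      "measure (iid_law k D) B \<le> (1 / 2) ^ k"
      "\<And>Z. Z \<in> space (iid_law k D) - B \<Longrightarrow> spread k d (\<lambda>i. centered D (Z i)) (r\<^sup>2 / 1600) (real k / 400)"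
      by blast
    have "S \<in> sets (iid_law k D)" unfolding S_def
    proof (rule accepts_measurable)
      fix i j assume "i < k" "j < d"
      then have "(\<lambda>Z. Z i) \<in> measurable (iid_law k D) D" "(\<lambda>z. z j) \<in> borel_measurable D"
        unfolding iid_law_def
        by (auto intro: measurable_component_singleton law_coordinate_measurable[OF law])
      from measurable_compose[OF this]
      show "(\<lambda>Z. centered D (Z i) j) \<in> borel_measurable (iid_law k D)"
        unfolding centered_def by (intro borel_measurable_diff borel_measurable_const)
    qed
    moreover have "space (iid_law k D) - B \<subseteq> S"
      using spread_imp_accepts[OF k r] B(3) by (auto simp: S_def)
    ultimately have "measure (iid_law k D) (space (iid_law k D) - B) \<le> measure (iid_law k D) S"
      by (intro P.finite_measure_mono)
    then have "1 - (1 / 2) ^ k \<le> measure (iid_law k D) S"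
      using P.prob_compl[OF B(1)] B(2) by simp
    moreover have "(1 / 2 :: real) ^ k = 2 powr (- 1 * real k)"
    proof -
      have "(1 / 2 :: real) ^ k = inverse (2 powr real k)"
        by (simp add: powr_realpow power_one_over inverse_eq_divide)
      then show ?thesis by (simp add: powr_minus)
    qed
    moreover have "S = {Z \<in> space (iid_law k D). outputs certify k d Z (mean D) r (1 / 100) YES}"
      by (auto simp: S_def certify_outputs centered_def)
    ultimately show ?thesis by (simp add: r_def)
  qed
  show ?thesis
    using C certification_algorithm_certify polynomial_time_certify prob
    by (intro exI[of _ "1 :: real"] exI[of _ C] exI[of _ certify]) auto
qed

end
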